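(* Let $\varphi$ be a probability measure on $\mathbb{R}^2$ with density $\dot\varphi(x_1,x_2)$ with respect to Lebesgue measure, and assume that $(x_1,x_2)\mapsto-\log\dot\varphi(x_1,x_2)$ is twice differentiable and that the eigenvalues of its Hessian are bounded between two positive numbers $m$ and $L$, where $m\le L$. For $i\in\{1,2\}$ (with $x_{-1}=x_2$, $x_{-2}=x_1$) let $\dot\varphi_{i,x_{-i}}$ be the conditional density of the $i$-th coordinate given that the other coordinate equals $x_{-i}$, and let $H_{i,x_{-i}}=\sum_{j=1}^Jp_jH_{i,x_{-i},j}$ be the multi-scale Gaussian random-walk Metropolis–Hastings kernel on $\mathbb{R}$ targeting it, as defined in the context, with $$J=1+\lceil\log_2(L/m)\rceil,\qquad p_j=\frac1J,\qquad \sigma_j^2=\frac{2^{j-1}}L,\quad j=1,\dots,J.$$ Let $T$ be the Markov transition kernel on $\mathbb{R}^2$ $$T((x_1,x_2),\mathrm{d}(x_1',x_2'))=H_{1,x_2}(x_1,\mathrm{d}x_1')\,H_{2,x_1'}(x_2,\mathrm{d}x_2').$$ Then $$1-\|T\|_\varphi^2\ \ge\ \Big(\frac{C_*}{1+\lceil\log_2(L/m)\rceil}\Big)^2\,\frac mL,$$ where $C_*\approx10^{-14}$ is the universal constant given in the context.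
   Context: With $\phi$ the standard normal density and $a_{i,x_{-i}}(x_i,x_i')=\min\{1,\dot\varphi_{i,x_{-i}}(x_i')/\dot\varphi_{i,x_{-i}}(x_i)\}$, $$H_{i,x_{-i},j}(x_i,\mathrm{d}x_i')=\frac1{\sigma_j}\phi\Big(\frac{x_i'-x_i}{\sigma_j}\Big)a_{i,x_{-i}}(x_i,x_i')\,\mathrm{d}x_i'+\Big[1-\int_{\mathbb{R}}\frac1{\sigma_j}\phi\Big(\frac{x_i''-x_i}{\sigma_j}\Big)a_{i,x_{-i}}(x_i,x_i'')\,\mathrm{d}x_i''\Big]\delta_{x_i}(\mathrm{d}x_i').$$ The kernel $T$ satisfies $\varphi T=\varphi$ and acts on $L_0^2(\varphi)$ (real $\varphi$-square-integrable functions with $\varphi$-mean zero) by $Tf(x)=\int T(x,\mathrm{d}x')f(x')$; $\|T\|_\varphi$ is its operator norm on $L_0^2(\varphi)$. The constant is $$C_*=\frac12\inf_{c\in[1,2]}\min\Big\{\frac{b(c)}8,\frac{b(c)^2\sqrt c}{96\sqrt3}\Big\}^2,\qquad b(c)=\frac12e^{-2.6}\frac1{\sqrt{2\pi c}}\exp\Big(-\frac{1.5^2}{2c}\Big).$$ *)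

theory Defs
  imports "HOL-Probability.Probability"
begin

definition eigenvalue_of :: "('a::real_vector \<Rightarrow> 'a) \<Rightarrow> real \<Rightarrow> bool" where
  "eigenvalue_of A l \<longleftrightarrow> (\<exists>v. v \<noteq> 0 \<and> A v = l *\<^sub>R v)"

definition cond_density1 :: "(real \<times> real \<Rightarrow> real) \<Rightarrow> real \<Rightarrow> real \<Rightarrow> real" where
  "cond_density1 p x2 = (\<lambda>x1. p (x1, x2) / (\<integral>t. p (t, x2) \<partial>lborel))"

definition cond_density2 :: "(real \<times> real \<Rightarrow> real) \<Rightarrow> real \<Rightarrow> real \<Rightarrow> real" where
  "cond_density2 p x1 = (\<lambda>x2. p (x1, x2) / (\<integral>t. p (x1, t) \<partial>lborel))"

definition mh_accept :: "(real \<Rightarrow> real) \<Rightarrow> real \<Rightarrow> real \<Rightarrow> real" where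
  "mh_accept d x y = min 1 (d y / d x)"

text \<open>Random-walk Metropolis--Hastings kernel with target density \<open>d\<close> and step size \<open>s\<close>.\<close>

definition rwm_kernel :: "(real \<Rightarrow> real) \<Rightarrow> real \<Rightarrow> real \<Rightarrow> real measure" where
  "rwm_kernel d s x = measure_of UNIV (sets borel) (\<lambda>A.
     (\<integral>\<^sup>+y\<in>A. ennreal (1 / s * std_normal_density ((y - x) / s) * mh_accept d x y) \<partial>lborel)
     + ennreal (1 - (\<integral>y. 1 / s * std_normal_density ((y - x) / s) * mh_accept d x y \<partial>lborel))
       * indicator A x)"

definition multiscale_rwm_kernel ::
    "nat \<Rightarrow> (nat \<Rightarrow> real) \<Rightarrow> (nat \<Rightarrow> real) \<Rightarrow> (real \<Rightarrow> real) \<Rightarrow> real \<Rightarrow> real measure" where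
  "multiscale_rwm_kernel J w s d x = measure_of UNIV (sets borel) (\<lambda>A.
     \<Sum>j\<in>{1..J}. ennreal (w j) * emeasure (rwm_kernel d (s j) x) A)"

text \<open>\<open>T((x1,x2), d(y1,y2)) = H1\<^bsub>x2\<^esub>(x1, dy1) H2\<^bsub>y1\<^esub>(x2, dy2)\<close>;
  the first argument of \<open>H1\<close>, \<open>H2\<close> is the coordinate that is conditioned on.\<close>

definition scan_kernel ::
    "(real \<Rightarrow> real \<Rightarrow> real measure) \<Rightarrow> (real \<Rightarrow> real \<Rightarrow> real measure) \<Rightarrow>
     real \<times> real \<Rightarrow> (real \<times> real) measure" where
  "scan_kernel H1 H2 = (\<lambda>(x1, x2).
     H1 x2 x1 \<bind> (\<lambda>y1. H2 y1 x2 \<bind> (\<lambda>y2. return borel (y1, y2))))"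

definition kernel_op :: "('a \<Rightarrow> 'a measure) \<Rightarrow> ('a \<Rightarrow> real) \<Rightarrow> 'a \<Rightarrow> real" where
  "kernel_op K f x = (\<integral>y. f y \<partial>K x)"

definition L2norm :: "'a measure \<Rightarrow> ('a \<Rightarrow> real) \<Rightarrow> real" where
  "L2norm M f = sqrt (\<integral>x. (f x)\<^sup>2 \<partial>M)"

definition L20 :: "'a measure \<Rightarrow> ('a \<Rightarrow> real) set" where
  "L20 M = {f \<in> borel_measurable M. integrable M (\<lambda>x. (f x)\<^sup>2) \<and> (\<integral>x. f x \<partial>M) = 0}"

text \<open>Operator norm on mean-zero square-integrable functions. It is real-valued, hence meaningful only
  for kernels leaving \<open>M\<close> invariant, for which the set below is bounded by 1.\<close>

definition kernel_opnorm :: "'a measure \<Rightarrow> ('a \<Rightarrow> 'a measure) \<Rightarrow> real" where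
  "kernel_opnorm M K = Sup {L2norm M (kernel_op K f) | f. f \<in> L20 M \<and> L2norm M f \<le> 1}"

definition b_const :: "real \<Rightarrow> real" where
  "b_const c = 1/2 * exp (- 2.6) * (1 / sqrt (2 * pi * c)) * exp (- (1.5\<^sup>2 / (2 * c)))"

definition C_star :: real where
  "C_star = 1/2 * (INF c\<in>{1..2}. (min (b_const c / 8) ((b_const c)\<^sup>2 * sqrt c / (96 * sqrt 3)))\<^sup>2)"

end

theory Submission
  imports Defs
begin

text \<open>
  Let \<open>P\<^sub>1\<close>, \<open>P\<^sub>2\<close> be the conditional expectations given the second and the first coordinate, and \<open>H\<^sub>1\<close>, \<open>H\<^sub>2\<close> the
  operators of the two Metropolis steps, so that \<open>T = H\<^sub>1 H\<^sub>2\<close>.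

  Each \<open>H\<^sub>i\<close> satisfies \<open>\<parallel>H\<^sub>i f\<parallel>\<^sup>2 \<le> \<parallel>f\<parallel>\<^sup>2 - \<kappa> \<parallel>f - P\<^sub>i f\<parallel>\<^sup>2\<close> with \<open>\<kappa>\<close> a constant over \<open>J\<close>. Indeed, the Gaussian
  Metropolis operator is positive, so that \<open>H\<^sup>2 \<le> H\<close> and \<open>\<parallel>H f\<parallel>\<^sup>2\<close> is at most \<open>\<parallel>f\<parallel>\<^sup>2\<close> minus the Dirichlet form of
  \<open>H\<close>. One of the \<open>J\<close> proposal scales matches the width of the conditional density, and for this scale the Dirichlet
  form dominates the variance. The corresponding Poincare inequality for jumps of size at most \<open>h\<close> is
  obtained from the test function \<open>cosh\<close>, which has a negative drift away from the mode, and from chains of short jumps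
  in the core.

  The same Poincare inequality with \<open>h\<close> of order \<open>1 / sqrt L\<close>, applied to the first marginal (strongly log-concave by
  Prekopa--Leindler), shows that \<open>\<parallel>g - P\<^sub>1 g\<parallel>\<^sup>2 \<ge> \<delta> \<parallel>g\<parallel>\<^sup>2\<close> for mean-zero functions \<open>g\<close> of the first coordinate, with
  \<open>\<delta>\<close> a constant times \<open>m / L\<close>. Combining the two half-steps gives \<open>1 - \<parallel>T\<parallel>\<^sup>2 \<ge> \<kappa> \<delta> / 3\<close>, which is larger than
  required because \<open>C_star\<close> is tiny and enters squared.
\<close>

subsection \<open>Convexity from bounds on the Hessian\<close>

text \<open>Two obstacles shape the proof. The Hessian is merely assumed to exist, so its bounds are
  turned at once into a chord inequality and a midpoint inequality; both survive restriction to
  slices and integration over a coordinate. And the width \<open>a\<close> of a conditional density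
  is known only to lie between 4 / sqrt L and 8 / sqrt m, so every Poincare inequality is stated
  relative to \<open>a\<close>; the J dyadic scales cover just this range.

  The bound with \<delta> rests on overlap. For |x - y| of order 1 / sqrt L, the slices of the joint
  density at x and y share a fixed fraction of the smaller marginal density. An increment g(x) -
  g(y) can then be charged to common values z of the other coordinate and split into g(x) - c(z) and
  g(y) - c(z), for any function c. So the box form of the marginal is at most a constant times h
  times the squared distance of g to c. The Poincare constant a^2 / h^3 turns this into a^2 / h^2,
  which is a constant times L / m at worst. Taking for c the conditional mean after the first
  half-step links this to the loss of the second one.\<close>

definition strongly_convex :: "real \<Rightarrow> ('a::real_inner \<Rightarrow> real) \<Rightarrow> bool" where
  "strongly_convex m V \<longleftrightarrow> (\<forall>x y t. 0 \<le> t \<longrightarrow> t \<le> 1 \<longrightarrow>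
     V ((1 - t) *\<^sub>R x + t *\<^sub>R y) + m / 2 * (t * (1 - t)) * (norm (x - y))\<^sup>2 \<le> (1 - t) * V x + t * V y)"

text \<open>An upper Hessian bound in the form that Cauchy-Schwarz carries over to marginals: the
  geometric mean of two slices is measured against the slice halfway between them.\<close>

definition midpoint_smooth :: "real \<Rightarrow> ('a::real_inner \<Rightarrow> real) \<Rightarrow> bool" where
  "midpoint_smooth L V \<longleftrightarrow> (\<forall>x y.
     V x + V y \<le> 2 * V ((1/2) *\<^sub>R x + (1/2) *\<^sub>R y) + L / 4 * (norm (x - y))\<^sup>2)"

text \<open>The mean value theorem in direction \<open>v\<close>, applied to the increment in
  direction \<open>w\<close>, leaves a difference of two gradients; each is expanded around
  \<open>x\<close> with the remainder from differentiability at that one point. The mixed difference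
  is symmetric in \<open>v\<close> and \<open>w\<close>, its approximation a priori is not.\<close>

lemma mixed_difference_estimate:
  fixes U :: "'a::real_inner \<Rightarrow> real"
  assumes U: "\<And>y. GDERIV U y :> grad y"
    and d: "\<And>y. norm (y - x) < d \<Longrightarrow> norm (grad y - grad x - h (y - x)) \<le> e * norm (y - x)"
    and h: "bounded_linear h" and e: "0 \<le> e"
    and t: "0 < t" "t * (norm v + norm w) < d"
  shows "\<bar>U (x + t *\<^sub>R v + t *\<^sub>R w) - U (x + t *\<^sub>R v) - U (x + t *\<^sub>R w) + U x - t\<^sup>2 * inner (h w) v\<bar>
    \<le> 2 * e * t\<^sup>2 * (norm v + norm w)\<^sup>2"
proof -
  interpret h: bounded_linear h by fact
  define \<psi> where "\<psi> s = U (x + s *\<^sub>R v + t *\<^sub>R w) - U (x + s *\<^sub>R v)" for s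
  have der: "((\<lambda>s. U (a + s *\<^sub>R v)) has_real_derivative inner v (grad (a + s *\<^sub>R v))) (at s)" for a s
  proof -
    have "((\<lambda>s. a + s *\<^sub>R v) has_derivative (\<lambda>s. s *\<^sub>R v)) (at s)"
      by (auto intro!: derivative_eq_intros)
    from has_derivative_compose[OF this U[unfolded gderiv_def]]
    show ?thesis
      by (simp add: has_field_derivative_def inner_scaleR_left mult_commute_abs)
  qed
  have "(\<psi> has_real_derivative inner v (grad (x + s *\<^sub>R v + t *\<^sub>R w)) - inner v (grad (x + s *\<^sub>R v))) (at s)" for s
    unfolding \<psi>_def
    using der[of "x + t *\<^sub>R w" s] der[of x s] by (intro DERIV_diff) (auto simp: algebra_simps)
  then obtain s where s: "0 < s" "s < t"
    and eq: "\<psi> t - \<psi> 0 = t * (inner v (grad (x + s *\<^sub>R v + t *\<^sub>R w)) - inner v (grad (x + s *\<^sub>R v)))"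
    using MVT2[of 0 t \<psi> "\<lambda>s. inner v (grad (x + s *\<^sub>R v + t *\<^sub>R w)) - inner v (grad (x + s *\<^sub>R v))"] t(1)
    by auto
  let ?N = "norm v + norm w"
  define r where "r y = grad y - grad x - h (y - x)" for y
  have r: "norm (r (x + z)) \<le> e * (t * ?N)" if "norm z \<le> t * ?N" for z
  proof -
    have "norm (r (x + z)) \<le> e * norm z"
      unfolding r_def using d[of "x + z"] that t(2) by simp
    also have "\<dots> \<le> e * (t * ?N)" using that e by (intro mult_left_mono)
    finally show ?thesis .
  qed
  have n1: "norm (s *\<^sub>R v) \<le> t * norm v" using s by (simp add: mult_right_mono)
  have n2: "norm (s *\<^sub>R v + t *\<^sub>R w) \<le> t * ?N"
    using norm_triangle_ineq[of "s *\<^sub>R v" "t *\<^sub>R w"] n1 s by (simp add: algebra_simps)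
  have n3: "norm (s *\<^sub>R v) \<le> t * ?N"
    using n1 t(1) by (simp add: algebra_simps add_increasing2)
  have "grad (x + s *\<^sub>R v + t *\<^sub>R w) - grad (x + s *\<^sub>R v)
     = r (x + (s *\<^sub>R v + t *\<^sub>R w)) - r (x + s *\<^sub>R v) + t *\<^sub>R h w"
    unfolding r_def by (simp add: h.add h.scaleR algebra_simps)
  then have "\<psi> t - \<psi> 0 - t\<^sup>2 * inner (h w) v
     = t * inner v (r (x + (s *\<^sub>R v + t *\<^sub>R w)) - r (x + s *\<^sub>R v))"
    unfolding eq inner_diff_right[symmetric]
    by (simp only: inner_add_right) (simp add: inner_commute power2_eq_square algebra_simps)
  then have "\<bar>\<psi> t - \<psi> 0 - t\<^sup>2 * inner (h w) v\<bar>
      \<le> t * (norm v * norm (r (x + (s *\<^sub>R v + t *\<^sub>R w)) - r (x + s *\<^sub>R v)))"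
    using t(1) Cauchy_Schwarz_ineq2[of v "r (x + (s *\<^sub>R v + t *\<^sub>R w)) - r (x + s *\<^sub>R v)"]
    by (simp add: abs_mult)
  also have "\<dots> \<le> t * (?N * (e * (t * ?N) + e * (t * ?N)))"
    using t(1) e r[OF n2] r[OF n3]
      norm_triangle_ineq4[of "r (x + (s *\<^sub>R v + t *\<^sub>R w))" "r (x + s *\<^sub>R v)"]
    by (intro mult_left_mono mult_mono) auto
  also have "\<dots> = 2 * e * t\<^sup>2 * ?N\<^sup>2" by (simp add: power2_eq_square algebra_simps)
  finally show ?thesis by (simp add: \<psi>_def algebra_simps)
qed

text \<open>Symmetry holds without continuity of the second derivative: swapping \<open>v\<close>
  and \<open>w\<close> leaves the mixed difference unchanged, and divided by t^2 it is close to both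
  inner products. Only for a symmetric Hessian do bounds on real eigenvalues control the quadratic
  form.\<close>

lemma second_derivative_symmetric:
  fixes U :: "'a::real_inner \<Rightarrow> real"
  assumes U: "\<And>y. GDERIV U y :> grad y" and h: "(grad has_derivative h) (at x)"
  shows "inner (h v) w = inner (h w) v"
proof -
  let ?N = "norm v + norm w"
  have bl: "bounded_linear h" using h by (rule has_derivative_bounded_linear)
  have bound: "\<bar>inner (h v) w - inner (h w) v\<bar> \<le> e * (4 * ?N\<^sup>2)" if e: "0 < e" for e
  proof -
    obtain d where d: "0 < d"
      "\<And>y. norm (y - x) < d \<Longrightarrow> norm (grad y - grad x - h (y - x)) \<le> e * norm (y - x)"
      using h e unfolding has_derivative_at_alt by blast
    \<comment> \<open>The added 1 keeps \<open>t\<close> meaningful when \<open>v\<close> and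
      \<open>w\<close> both vanish.\<close>
    define M where "M = ?N + 1"
    define t where "t = d / (2 * M)"
    have M: "0 < M" by (simp add: M_def add_nonneg_pos)
    then have t0: "0 < t" unfolding t_def using d(1) by simp
    have "t * ?N < d"
    proof -
      have "t * ?N \<le> t * M" using t0 by (simp add: M_def)
      also have "\<dots> = d / 2" unfolding t_def using M by simp
      finally show ?thesis using d(1) by simp
    qed
    then have td: "t * (norm v + norm w) < d" "t * (norm w + norm v) < d" by (simp_all add: add.commute)
    have "\<bar>t\<^sup>2 * inner (h v) w - t\<^sup>2 * inner (h w) v\<bar> \<le> 4 * e * t\<^sup>2 * ?N\<^sup>2"
      using mixed_difference_estimate[OF U d(2) bl less_imp_le[OF e] t0 td(1)]
        mixed_difference_estimate[OF U d(2) bl less_imp_le[OF e] t0 td(2)]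
      by (simp add: algebra_simps)
    also have "t\<^sup>2 * inner (h v) w - t\<^sup>2 * inner (h w) v = t\<^sup>2 * (inner (h v) w - inner (h w) v)"
      by (simp add: right_diff_distrib)
    finally have "t\<^sup>2 * \<bar>inner (h v) w - inner (h w) v\<bar> \<le> t\<^sup>2 * (e * (4 * ?N\<^sup>2))"
      by (simp add: abs_mult mult_ac)
    then show ?thesis using t0 by simp
  qed
  have "\<bar>inner (h v) w - inner (h w) v\<bar> \<le> 0 + e" if e: "0 < e" for e
  proof -
    have "0 < 4 * ?N\<^sup>2 + 1" by (simp add: add_nonneg_pos)
    with bound[where e="e / (4 * ?N\<^sup>2 + 1)"] e
    have "\<bar>inner (h v) w - inner (h w) v\<bar> \<le> e / (4 * ?N\<^sup>2 + 1) * (4 * ?N\<^sup>2)" by simp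
    also have "\<dots> \<le> e / (4 * ?N\<^sup>2 + 1) * (4 * ?N\<^sup>2 + 1)"
      using e \<open>0 < 4 * ?N\<^sup>2 + 1\<close> by (intro mult_left_mono) auto
    also have "\<dots> = e" using \<open>0 < 4 * ?N\<^sup>2 + 1\<close> by simp
    finally show ?thesis by simp
  qed
  then have "\<bar>inner (h v) w - inner (h w) v\<bar> \<le> 0" by (rule field_le_epsilon)
  then show ?thesis by simp
qed

section \<open>Eigenvalues and quadratic forms in the plane\<close>

lemma eigenvalue_2x2:
  fixes A :: "real \<times> real \<Rightarrow> real \<times> real"
  assumes A: "\<And>x y. A (x, y) = (a * x + c * y, c * x + d * y)"
    and l: "(a - l) * (d - l) = c\<^sup>2"
  shows "eigenvalue_of A l"
proof (cases "c = 0")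
  case True
  then have "a = l \<or> d = l" using l by simp
  then show ?thesis
  proof
    assume "a = l" then show ?thesis unfolding eigenvalue_of_def
      by (intro exI[of _ "(1, 0)"]) (simp add: A True zero_prod_def)
  next
    assume "d = l" then show ?thesis unfolding eigenvalue_of_def
      by (intro exI[of _ "(0, 1)"]) (simp add: A True zero_prod_def)
  qed
next
  case False
  then show ?thesis unfolding eigenvalue_of_def using l
    by (intro exI[of _ "(c, l - a)"])
      (simp add: A zero_prod_def power2_eq_square algebra_simps)
qed

lemma quadratic_form_nonneg:
  fixes a c d x y :: real
  assumes "0 \<le> a" "0 \<le> d" "c\<^sup>2 \<le> a * d"
  shows "0 \<le> a * x\<^sup>2 + 2 * c * x * y + d * y\<^sup>2"
proof (cases "a = 0")
  case True
  then show ?thesis using assms by simp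
next
  case False
  then have a: "0 < a" using assms by simp
  have "a * (a * x\<^sup>2 + 2 * c * x * y + d * y\<^sup>2) = (a * x + c * y)\<^sup>2 + (a * d - c\<^sup>2) * y\<^sup>2"
    by (simp add: power2_eq_square algebra_simps)
  also have "\<dots> \<ge> 0" using assms by (intro add_nonneg_nonneg mult_nonneg_nonneg) auto
  finally show ?thesis using a by (simp add: zero_le_mult_iff)
qed

text \<open>For the symmetric matrix with entries a, c, d the eigenvalues are (a + d) / 2 + R and (a
  + d) / 2 - R. Placing both between m and L gives A - m and L - A a nonnegative diagonal and a
  nonnegative determinant.\<close>

lemma quadratic_form_bounds:
  fixes A :: "real \<times> real \<Rightarrow> real \<times> real"
  assumes lin: "linear A" and sym: "\<And>v w. inner (A v) w = inner (A w) v"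
    and ev: "\<And>l. eigenvalue_of A l \<Longrightarrow> m \<le> l \<and> l \<le> L"
  shows "m * (norm v)\<^sup>2 \<le> inner (A v) v" "inner (A v) v \<le> L * (norm v)\<^sup>2"
proof -
  interpret linear A by fact
  define a c d where "a = fst (A (1, 0))" and "c = snd (A (1, 0))" and "d = snd (A (0, 1))"
  have c': "fst (A (0, 1)) = c"
    using sym[of "(1, 0)" "(0, 1)"] by (simp add: c_def inner_prod_def)
  have A: "A (x, y) = (a * x + c * y, c * x + d * y)" for x y
  proof -
    have "A (x, y) = A (x *\<^sub>R (1, 0) + y *\<^sub>R (0, 1))" by simp
    also have "\<dots> = x *\<^sub>R A (1, 0) + y *\<^sub>R A (0, 1)" by (simp only: add scale)
    also have "\<dots> = (a * x + c * y, c * x + d * y)"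
      using c' by (auto simp: prod_eq_iff a_def c_def d_def)
    finally show ?thesis .
  qed
  define R where "R = sqrt (((a - d) / 2)\<^sup>2 + c\<^sup>2)"
  have R0: "0 \<le> R" by (simp add: R_def)
  have R: "R\<^sup>2 = ((a - d) / 2)\<^sup>2 + c\<^sup>2" by (simp add: R_def)
  have hi: "m \<le> (a + d) / 2 + R \<and> (a + d) / 2 + R \<le> L"
    using R by (intro ev eigenvalue_2x2[OF A]) (simp add: power2_eq_square field_simps)
  have lo: "m \<le> (a + d) / 2 - R \<and> (a + d) / 2 - R \<le> L"
    using R by (intro ev eigenvalue_2x2[OF A]) (simp add: power2_eq_square field_simps)
  have "\<bar>(a - d) / 2\<bar> \<le> R" unfolding R_def by (rule real_le_rsqrt) (simp add: power_divide)
  then have "(a - d) / 2 \<le> R" "(d - a) / 2 \<le> R" unfolding abs_le_iff by (simp_all add: field_simps)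
  then have am: "m \<le> a" "m \<le> d" "a \<le> L" "d \<le> L" using hi lo by (simp_all add: field_simps)
  obtain x y where v: "v = (x, y)" by force
  have nv: "(norm v)\<^sup>2 = x\<^sup>2 + y\<^sup>2" by (simp add: v norm_prod_def)
  have iv: "inner (A v) v = a * x\<^sup>2 + 2 * c * x * y + d * y\<^sup>2"
    by (simp add: v A inner_prod_def power2_eq_square algebra_simps)
  have "R\<^sup>2 \<le> ((a + d) / 2 - m)\<^sup>2" using lo R0 by (intro power_mono) auto
  then have "c\<^sup>2 \<le> (a - m) * (d - m)" unfolding R by (simp add: power2_eq_square field_simps)
  from quadratic_form_nonneg[OF _ _ this, of x y] am
  show "m * (norm v)\<^sup>2 \<le> inner (A v) v" unfolding nv iv by (simp add: algebra_simps)
  have "R\<^sup>2 \<le> (L - (a + d) / 2)\<^sup>2" using hi R0 by (intro power_mono) auto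
  then have "(- c)\<^sup>2 \<le> (L - a) * (L - d)" unfolding R by (simp add: power2_eq_square field_simps)
  from quadratic_form_nonneg[OF _ _ this, of x y] am
  show "inner (A v) v \<le> L * (norm v)\<^sup>2" unfolding nv iv by (simp add: algebra_simps)
qed

lemma second_derivative_chord:
  fixes f :: "real \<Rightarrow> real"
  assumes f: "\<And>s. (f has_real_derivative f' s) (at s)" "\<And>s. (f' has_real_derivative f'' s) (at s)"
    and lower: "\<And>s. c \<le> f'' s" and t: "0 \<le> t" "t \<le> 1"
  shows "f t + c / 2 * (t * (1 - t)) \<le> (1 - t) * f 0 + t * f 1"
proof -
  have "convex_on UNIV (\<lambda>s. f s - c / 2 * s\<^sup>2)"
  proof (rule f''_ge0_imp_convex)
    show "((\<lambda>s. f s - c / 2 * s\<^sup>2) has_real_derivative f' s - c * s) (at s)" for s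
      by (auto intro!: derivative_eq_intros f)
    show "((\<lambda>s. f' s - c * s) has_real_derivative f'' s - c) (at s)" for s
      by (auto intro!: derivative_eq_intros f)
  qed (use lower in auto)
  from convex_onD[OF this t, of 0 1] show ?thesis
    by (simp add: power2_eq_square field_simps)
qed

lemma hessian_bounds_imp_convexity:
  fixes U :: "'a::real_inner \<Rightarrow> real"
  assumes U: "\<And>y. GDERIV U y :> grad y" and h: "\<And>x. (grad has_derivative hess x) (at x)"
    and bounds: "\<And>x v. m * (norm v)\<^sup>2 \<le> inner (hess x v) v" "\<And>x v. inner (hess x v) v \<le> L * (norm v)\<^sup>2"
  shows "strongly_convex m U" "midpoint_smooth L U"
proof -
  define f where "f x y s = U (x + s *\<^sub>R (y - x))" for x y and s :: real
  define f' where "f' x y s = inner (y - x) (grad (x + s *\<^sub>R (y - x)))" for x y and s :: real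
  define f'' where "f'' x y s = inner (hess (x + s *\<^sub>R (y - x)) (y - x)) (y - x)" for x y and s :: real
  have lin: "((\<lambda>s. x + s *\<^sub>R (y - x)) has_derivative (\<lambda>s. s *\<^sub>R (y - x))) (at s)" for x y :: 'a and s
    by (auto intro!: derivative_eq_intros)
  have f: "(f x y has_real_derivative f' x y s) (at s)" for x y s
    using has_derivative_compose[OF lin U[unfolded gderiv_def]]
    unfolding f_def f'_def
    by (simp add: has_field_derivative_def inner_scaleR_left mult_commute_abs)
  have f': "(f' x y has_real_derivative f'' x y s) (at s)" for x y s
  proof -
    have "((\<lambda>s. inner (y - x) (grad (x + s *\<^sub>R (y - x)))) has_derivative
        (\<lambda>s'. inner (y - x) (hess (x + s *\<^sub>R (y - x)) (s' *\<^sub>R (y - x))))) (at s)"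
      by (intro has_derivative_inner_right has_derivative_compose[OF lin h])
    moreover have "linear (hess (x + s *\<^sub>R (y - x)))" using h has_derivative_linear by blast
    ultimately show ?thesis unfolding f'_def f''_def
      by (simp add: has_field_derivative_def linear_scale inner_commute mult_commute_abs)
  qed
  have f0: "f x y 0 = U x" "f x y 1 = U y" for x y by (simp_all add: f_def)
  have ft: "f x y t = U ((1 - t) *\<^sub>R x + t *\<^sub>R y)" for x y t
    by (simp add: f_def algebra_simps)
  show "strongly_convex m U" unfolding strongly_convex_def
  proof (intro allI impI)
    fix x y :: 'a and t :: real assume t: "0 \<le> t" "t \<le> 1"
    have "f x y t + m * (norm (y - x))\<^sup>2 / 2 * (t * (1 - t)) \<le> (1 - t) * f x y 0 + t * f x y 1"
      by (rule second_derivative_chord[OF f f' _ t]) (simp add: f''_def bounds(1))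
    then show "U ((1 - t) *\<^sub>R x + t *\<^sub>R y) + m / 2 * (t * (1 - t)) * (norm (x - y))\<^sup>2 \<le> (1 - t) * U x + t * U y"
      by (simp add: f0 ft norm_minus_commute mult_ac)
  qed
  show "midpoint_smooth L U" unfolding midpoint_smooth_def
  proof (intro allI)
    fix x y
    \<comment> \<open>The upper bound is the chord estimate at 1/2 for the negated potential, whose
      second derivative is at least - L |y - x|^2.\<close>
    have "- f x y (1/2) + - (L * (norm (y - x))\<^sup>2) / 2 * (1/2 * (1 - 1/2)) \<le> (1 - 1/2) * - f x y 0 + 1/2 * - f x y 1"
      by (rule second_derivative_chord[where f'="\<lambda>s. - f' x y s" and f''="\<lambda>s. - f'' x y s"])
        (rule DERIV_minus[OF f] DERIV_minus[OF f'] | simp add: f''_def bounds(2))+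
    then show "U x + U y \<le> 2 * U ((1/2) *\<^sub>R x + (1/2) *\<^sub>R y) + L / 4 * (norm (x - y))\<^sup>2"
      by (simp add: f0 ft norm_minus_commute field_simps)
  qed
qed

subsection \<open>One-dimensional strongly convex potentials\<close>

lemma strongly_convexD:
  assumes "strongly_convex m V" "0 \<le> t" "t \<le> 1"
  shows "V ((1 - t) *\<^sub>R x + t *\<^sub>R y) + m / 2 * (t * (1 - t)) * (norm (x - y))\<^sup>2 \<le> (1 - t) * V x + t * V y"
  using assms unfolding strongly_convex_def by blast

lemma strongly_convex_imp_convex_on:
  assumes "strongly_convex m V" "0 \<le> m"
  shows "convex_on UNIV (V :: 'a::real_inner \<Rightarrow> real)"
proof (rule convex_onI)
  fix t :: real and x y :: 'a assume t: "0 < t" "t < 1"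
  have "0 \<le> m / 2 * (t * (1 - t)) * (norm (x - y))\<^sup>2"
    using t assms(2) by simp
  then show "V ((1 - t) *\<^sub>R x + t *\<^sub>R y) \<le> (1 - t) * V x + t * V y"
    using strongly_convexD[OF assms(1), of t x y] t by simp
qed simp

lemma strongly_convex_continuous:
  fixes V :: "'a::euclidean_space \<Rightarrow> real"
  assumes "strongly_convex m V" "0 \<le> m"
  shows "continuous_on UNIV V"
  using strongly_convex_imp_convex_on[OF assms] by (intro convex_on_continuous) auto

lemma strongly_convex_slices:
  fixes U :: "real \<times> real \<Rightarrow> real"
  assumes "strongly_convex m U"
  shows "strongly_convex m (\<lambda>x. U (x, z))" "strongly_convex m (\<lambda>x. U (z, x))"
proof -
  have *: "(1 - t) *\<^sub>R z + t *\<^sub>R z = z" for t z :: real by (simp add: algebra_simps)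
  show "strongly_convex m (\<lambda>x. U (x, z))" unfolding strongly_convex_def
    using strongly_convexD[OF assms, of _ "(_, z)" "(_, z)"] * by (simp add: norm_prod_def)
  show "strongly_convex m (\<lambda>x. U (z, x))" unfolding strongly_convex_def
    using strongly_convexD[OF assms, of _ "(z, _)" "(z, _)"] * by (simp add: norm_prod_def)
qed

lemma midpoint_smooth_slices:
  fixes U :: "real \<times> real \<Rightarrow> real"
  assumes "midpoint_smooth L U"
  shows "midpoint_smooth L (\<lambda>x. U (x, z))" "midpoint_smooth L (\<lambda>x. U (z, x))"
  using assms[unfolded midpoint_smooth_def, rule_format, of "(_, z)" "(_, z)"]
    assms[unfolded midpoint_smooth_def, rule_format, of "(z, _)" "(z, _)"]
  unfolding midpoint_smooth_def by (simp_all add: norm_prod_def)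

lemma strongly_convex_add_const:
  "strongly_convex m V \<Longrightarrow> strongly_convex m (\<lambda>x. V x + c)"
  unfolding strongly_convex_def by (auto simp: algebra_simps)

lemma midpoint_smooth_add_const:
  "midpoint_smooth L V \<Longrightarrow> midpoint_smooth L (\<lambda>x. V x + c)"
  unfolding midpoint_smooth_def by (auto simp: algebra_simps)

lemma strongly_convex_reflect:
  fixes V :: "real \<Rightarrow> real"
  assumes "strongly_convex m V"
  shows "strongly_convex m (\<lambda>x. V (- x))"
  unfolding strongly_convex_def
proof (intro allI impI)
  fix x y t :: real assume "0 \<le> t" "t \<le> 1"
  from strongly_convexD[OF assms this, of "- x" "- y"]
  show "V (- ((1 - t) *\<^sub>R x + t *\<^sub>R y)) + m / 2 * (t * (1 - t)) * (norm (x - y))\<^sup>2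
      \<le> (1 - t) * V (- x) + t * V (- y)"
    by (simp add: power2_commute)
qed

text \<open>Writing 0 as a convex combination of -1 and \<open>x\<close> bounds V(x) from below by
  the secant through -1 and 0, with a quadratic gain. This takes the place of a tangent
  line.\<close>

lemma strongly_convex_lower_bound_right:
  fixes V :: "real \<Rightarrow> real"
  assumes "strongly_convex m V" "0 \<le> x"
  shows "V 0 + (V 0 - V (- 1) + m / 2) * x + m / 2 * x\<^sup>2 \<le> V x"
proof -
  define t where "t = 1 / (1 + x)"
  have t: "0 \<le> t" "t \<le> 1" using assms by (auto simp: t_def)
  have eq: "t * (1 + x) = 1" using assms(2) by (simp add: t_def)
  have "(1 - t) * (-1) + t * x = 0" using eq by (simp add: algebra_simps)
  moreover have "1 - t = t * x" using eq by (simp add: algebra_simps)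
  ultimately have "V 0 + m / 2 * (t * (t * x)) * (-1 - x)\<^sup>2 \<le> t * x * V (-1) + t * V x"
    using strongly_convexD[OF assms(1) t, of "-1" x] by simp
  moreover have "m / 2 * (t * (t * x)) * (-1 - x)\<^sup>2 = m / 2 * ((t * (1 + x)) * (t * (1 + x)) * x)"
    by (simp add: power2_eq_square algebra_simps)
  ultimately have "V 0 + m / 2 * x \<le> t * x * V (-1) + t * V x"
    by (simp only: eq mult_1_left)
  then have "(1 + x) * (V 0 + m / 2 * x) \<le> (1 + x) * (t * x * V (-1) + t * V x)"
    using assms(2) by (intro mult_left_mono) auto
  also have "\<dots> = (t * (1 + x)) * (x * V (-1) + V x)" by (simp add: algebra_simps)
  finally show ?thesis unfolding eq by (simp add: power2_eq_square field_simps)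
qed

lemma strongly_convex_lower_bound:
  fixes V :: "real \<Rightarrow> real"
  assumes "strongly_convex m V"
  obtains c where "\<And>x. V 0 - c * \<bar>x\<bar> + m / 2 * x\<^sup>2 \<le> V x"
proof
  define c where "c = \<bar>V 0 - V (- 1) + m / 2\<bar> + \<bar>V 0 - V 1 + m / 2\<bar>"
  fix x :: real
  show "V 0 - c * \<bar>x\<bar> + m / 2 * x\<^sup>2 \<le> V x"
  proof (cases "0 \<le> x")
    case True
    have "- c * x \<le> (V 0 - V (- 1) + m / 2) * x"
      using True unfolding c_def by (intro mult_right_mono) auto
    then show ?thesis using strongly_convex_lower_bound_right[OF assms True] True by simp
  next
    case False
    then have "- c * (- x) \<le> (V 0 - V 1 + m / 2) * (- x)"
      unfolding c_def by (intro mult_right_mono) auto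
    then show ?thesis
      using strongly_convex_lower_bound_right[OF strongly_convex_reflect[OF assms], of "- x"] False by simp
  qed
qed

lemma strongly_convex_has_minimum:
  fixes V :: "real \<Rightarrow> real"
  assumes V: "strongly_convex m V" and m: "0 < m"
  obtains \<mu> where "\<And>x. V \<mu> \<le> V x"
proof -
  obtain c where c: "\<And>x. V 0 - c * \<bar>x\<bar> + m / 2 * x\<^sup>2 \<le> V x"
    using strongly_convex_lower_bound[OF V] by blast
  define r where "r = 2 * \<bar>c\<bar> / m"
  have r: "0 \<le> r" using m by (simp add: r_def)
  have far: "V 0 \<le> V x" if "r \<le> \<bar>x\<bar>" for x
  proof -
    have "\<bar>c\<bar> \<le> m / 2 * \<bar>x\<bar>" using that m by (simp add: r_def field_simps)
    then have "0 \<le> (m / 2 * \<bar>x\<bar> - c) * \<bar>x\<bar>" by (intro mult_nonneg_nonneg) auto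
    also have "\<dots> = - c * \<bar>x\<bar> + m / 2 * x\<^sup>2" by (simp add: power2_eq_square algebra_simps)
    finally show ?thesis using c[of x] by simp
  qed
  have "continuous_on {-r..r} V"
    using strongly_convex_continuous[OF V] m by (auto intro: continuous_on_subset)
  then obtain \<mu> where \<mu>: "\<mu> \<in> {-r..r}" "\<And>x. x \<in> {-r..r} \<Longrightarrow> V \<mu> \<le> V x"
    using continuous_attains_inf[of "{-r..r}" V] r by auto
  show thesis
  proof
    fix x show "V \<mu> \<le> V x"
    proof (cases "x \<in> {-r..r}")
      case False
      then have "V 0 \<le> V x" by (intro far) auto
      then show ?thesis using \<mu>(2)[of 0] r by simp
    qed (use \<mu> in auto)
  qed
qed

lemma strongly_convex_integrable:
  fixes V :: "real \<Rightarrow> real"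
  assumes V: "strongly_convex m V" and m: "0 < m"
  shows "integrable lborel (\<lambda>x. exp (- V x))"
proof -
  obtain c where c: "\<And>x. V 0 - c * \<bar>x\<bar> + m / 2 * x\<^sup>2 \<le> V x"
    using strongly_convex_lower_bound[OF V] by blast
  \<comment> \<open>The comparison Gaussian spends m / 4 of the quadratic growth m / 2; the other m
    / 4 absorbs the linear term at the price of a factor exp (c^2 / m).\<close>
  define s where "s = sqrt (2 / m)"
  have s: "0 < s" "s\<^sup>2 = 2 / m" using m by (auto simp: s_def)
  define C where "C = exp (- V 0 + c\<^sup>2 / m) * sqrt (2 * pi * s\<^sup>2)"
  have [measurable]: "V \<in> borel_measurable borel"
    using strongly_convex_continuous[OF V] m by (intro borel_measurable_continuous_onI) auto
  have bound: "exp (- V x) \<le> C * normal_density 0 s x" for x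
  proof -
    have "0 \<le> (m / 2 * \<bar>x\<bar> - c)\<^sup>2 / m" using m by simp
    also have "\<dots> = m / 4 * x\<^sup>2 - c * \<bar>x\<bar> + c\<^sup>2 / m"
      using m by (simp add: power2_eq_square field_simps)
    finally have "0 \<le> m / 4 * x\<^sup>2 - c * \<bar>x\<bar> + c\<^sup>2 / m" .
    moreover have "x\<^sup>2 / (2 * s\<^sup>2) = m / 4 * x\<^sup>2" using m by (simp add: s(2))
    ultimately have "- V x \<le> (- V 0 + c\<^sup>2 / m) + - (x\<^sup>2 / (2 * s\<^sup>2))"
      using c[of x] by linarith
    then have "exp (- V x) \<le> exp (- V 0 + c\<^sup>2 / m) * exp (- (x\<^sup>2 / (2 * s\<^sup>2)))"
      by (simp add: exp_add[symmetric])
    also have "\<dots> = C * normal_density 0 s x"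
      using s(1) by (simp add: C_def normal_density_def)
    finally show ?thesis .
  qed
  show ?thesis
  proof (rule Bochner_Integration.integrable_bound)
    show "integrable lborel (\<lambda>x. C * normal_density 0 s x)"
      using s(1) by (intro integrable_mult_right integrable_normal_density)
    show "AE x in lborel. norm (exp (- V x)) \<le> norm (C * normal_density 0 s x)"
      using bound by (auto simp: C_def)
  qed simp
qed

text \<open>The chord inequality at the midpoint of \<mu> and \<open>x\<close>, where the value is
  still at least V(\<mu>), yields the constant m / 4.\<close>

lemma strongly_convex_quadratic_growth:
  fixes V :: "real \<Rightarrow> real"
  assumes V: "strongly_convex m V" and min: "\<And>x. V \<mu> \<le> V x"
  shows "m / 4 * (x - \<mu>)\<^sup>2 \<le> V x - V \<mu>"
  using strongly_convexD[OF V, of "1/2" \<mu> x] min[of "(1 - 1/2) *\<^sub>R \<mu> + (1/2) *\<^sub>R x"]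
  by (simp add: power2_commute)

text \<open>The scale \<open>a\<close> plays the role of a standard deviation: it is where \<open>V\<close> has risen by 16 on the
  wider of the two sides of the mode.\<close>

lemma convex_scale_exists:
  fixes V :: "real \<Rightarrow> real"
  assumes V: "strongly_convex m V" and L: "midpoint_smooth L V" and m: "0 < m"
    and min: "\<And>x. V \<mu> \<le> V x"
  obtains a where "0 < a" "16 \<le> L * a\<^sup>2" "m * a\<^sup>2 \<le> 64"
    "V (\<mu> + a) = V \<mu> + 16 \<or> V (\<mu> - a) = V \<mu> + 16"
    "V \<mu> + 16 \<le> V (\<mu> + a)" "V \<mu> + 16 \<le> V (\<mu> - a)"
proof -
  note quad = strongly_convex_quadratic_growth[OF V min]
  have cont: "continuous_on UNIV V" using strongly_convex_continuous[OF V] m by simp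
  have conv: "convex_on UNIV V" using strongly_convex_imp_convex_on[OF V] m by simp
  \<comment> \<open>At this distance the growth m / 4 * r^2 equals 16, so the intermediate value
    theorem finds the level on either ray.\<close>
  define r where "r = 8 / sqrt m"
  have r: "0 < r" "m * r\<^sup>2 = 64" using m by (auto simp: r_def power_divide)
  have ray: "\<exists>a. 0 < a \<and> V (\<mu> + e * a) = V \<mu> + 16" if e: "\<bar>e\<bar> = 1" for e
  proof -
    have "V (\<mu> + e * r) \<ge> V \<mu> + 16"
    proof -
      have "(e * r)\<^sup>2 = r\<^sup>2" using e by (auto simp: abs_if split: if_splits)
      then show ?thesis using quad[of "\<mu> + e * r"] r(2) by simp
    qed
    moreover have "continuous_on {0..r} (\<lambda>a. V (\<mu> + e * a))"
      by (intro continuous_on_compose2[OF cont] continuous_intros) auto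
    ultimately obtain a where "0 \<le> a" "V (\<mu> + e * a) = V \<mu> + 16"
      using IVT'[of "\<lambda>a. V (\<mu> + e * a)" 0 "V \<mu> + 16" r] r(1) by auto
    then show ?thesis by (intro exI[of _ a]) (cases "a = 0", auto)
  qed
  have mono: "V (\<mu> + e * s) \<le> V (\<mu> + e * t)" if "0 \<le> s" "s \<le> t" "0 < t" for e s t
  proof -
    have "V ((1 - s / t) *\<^sub>R \<mu> + (s / t) *\<^sub>R (\<mu> + e * t)) \<le> (1 - s / t) * V \<mu> + s / t * V (\<mu> + e * t)"
      using that by (intro convex_onD[OF conv]) auto
    also have "(1 - s / t) *\<^sub>R \<mu> + (s / t) *\<^sub>R (\<mu> + e * t) = \<mu> + e * s"
      using that by (simp add: field_simps)
    also have "(1 - s / t) * V \<mu> + s / t * V (\<mu> + e * t) \<le> (1 - s / t) * V (\<mu> + e * t) + s / t * V (\<mu> + e * t)"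
      using that min by (intro add_right_mono mult_left_mono) auto
    finally show ?thesis by (simp add: algebra_simps)
  qed
  obtain a1 where a1: "0 < a1" "V (\<mu> + a1) = V \<mu> + 16" using ray[of 1] by auto
  obtain a2 where a2: "0 < a2" "V (\<mu> - a2) = V \<mu> + 16" using ray[of "-1"] by auto
  define a where "a = max a1 a2"
  have a0: "0 < a" using a1 by (simp add: a_def)
  have eq: "V (\<mu> + a) = V \<mu> + 16 \<or> V (\<mu> - a) = V \<mu> + 16"
    using a1 a2 by (auto simp: a_def max_def)
  have up: "V \<mu> + 16 \<le> V (\<mu> + a)" "V \<mu> + 16 \<le> V (\<mu> - a)"
    using mono[of a1 a 1] mono[of a2 a "-1"] a1 a2 a0 by (auto simp: a_def)
  \<comment> \<open>The mode is the midpoint and both ends lie at least 16 higher, so the midpoint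
    inequality bounds \<open>a\<close> from below. The end that rises by exactly 16 bounds it from
    above through quadratic growth.\<close>
  have "V (\<mu> + a) + V (\<mu> - a) \<le> 2 * V ((1/2) *\<^sub>R (\<mu> + a) + (1/2) *\<^sub>R (\<mu> - a)) + L / 4 * (norm ((\<mu> + a) - (\<mu> - a)))\<^sup>2"
    using L unfolding midpoint_smooth_def by blast
  also have "(1/2) *\<^sub>R (\<mu> + a) + (1/2) *\<^sub>R (\<mu> - a) = \<mu>" by (simp add: field_simps)
  finally have "32 \<le> 2 * (L * a\<^sup>2)" using up by (simp add: power2_eq_square field_simps)
  moreover have "m * a\<^sup>2 \<le> 64" using eq quad[of "\<mu> + a"] quad[of "\<mu> - a"] by auto
  ultimately show thesis using that[of a] a0 eq up by auto
qed

text \<open>Slopes of a convex function increase: the average slope from the mode to distance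
  \<open>a\<close> is at least K / a, hence so is every slope further out. With values 1 and -1 the
  factor \<open>e\<close> selects the side.\<close>

lemma convex_slope_beyond:
  fixes V :: "real \<Rightarrow> real"
  assumes conv: "convex_on UNIV V" and a: "0 < a" "V \<mu> + K \<le> V (\<mu> + e * a)"
    and x: "a \<le> x" "0 \<le> u"
  shows "V (\<mu> + e * x) + K / a * u \<le> V (\<mu> + e * (x + u))"
proof (cases "u = 0")
  case False
  define W where "W t = V (\<mu> + e * t)" for t
  have W: "convex_on UNIV W"
  proof (rule convex_onI)
    fix t x y :: real assume t: "0 < t" "t < 1"
    have "V ((1 - t) *\<^sub>R (\<mu> + e * x) + t *\<^sub>R (\<mu> + e * y)) \<le> (1 - t) * V (\<mu> + e * x) + t * V (\<mu> + e * y)"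
      using t by (intro convex_onD[OF conv]) auto
    moreover have "(1 - t) *\<^sub>R (\<mu> + e * x) + t *\<^sub>R (\<mu> + e * y) = \<mu> + e * ((1 - t) *\<^sub>R x + t *\<^sub>R y)"
      by (simp add: algebra_simps)
    ultimately show "W ((1 - t) *\<^sub>R x + t *\<^sub>R y) \<le> (1 - t) * W x + t * W y"
      by (simp add: W_def)
  qed simp
  have WK: "W 0 + K \<le> W a" using a by (simp add: W_def)
  have x0: "0 < x" using a x by simp
  have xu: "0 < x + u" using x0 x by simp
  have 1: "W a \<le> (1 - a / x) * W 0 + a / x * W x"
    using convex_onD[OF W, of "a / x" 0 x] a x x0 by simp
  have "W 0 + K \<le> W 0 + a / x * (W x - W 0)" using 1 WK by (simp add: algebra_simps)
  then have K: "K * x \<le> a * (W x - W 0)" using x0 by (simp add: field_simps)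
  have "(1 - x / (x + u)) *\<^sub>R 0 + (x / (x + u)) *\<^sub>R (x + u) = x" using xu by simp
  then have 2: "W x \<le> (1 - x / (x + u)) * W 0 + x / (x + u) * W (x + u)"
    using convex_onD[OF W, of "x / (x + u)" 0 "x + u"] x0 x by simp
  have "(x + u) * W x \<le> u * W 0 + x * W (x + u)"
  proof -
    define r where "r = x / (x + u)"
    have r: "r * (x + u) = x" using xu by (simp add: r_def)
    have "(x + u) * W x \<le> (x + u) * ((1 - r) * W 0 + r * W (x + u))"
      using mult_left_mono[OF 2, of "x + u"] xu by (simp add: r_def)
    also have "\<dots> = (x + u - r * (x + u)) * W 0 + r * (x + u) * W (x + u)" by (simp add: algebra_simps)
    finally show ?thesis unfolding r by simp
  qed
  then have "u * (W x - W 0) \<le> x * (W (x + u) - W x)" by (simp add: algebra_simps)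
  then have "a * (u * (W x - W 0)) \<le> a * (x * (W (x + u) - W x))" using a by simp
  moreover have "u * (K * x) \<le> u * (a * (W x - W 0))" using K x by (intro mult_left_mono) auto
  ultimately have "x * (u * K) \<le> x * (a * (W (x + u) - W x))" by (simp add: algebra_simps)
  then have "u * K \<le> a * (W (x + u) - W x)" using x0 by simp
  then show ?thesis using a by (simp add: W_def field_simps)
qed simp

subsection \<open>Poincare inequality for box moves\<close>

lemma exp_minus_le_inverse:
  fixes u :: real
  assumes "0 \<le> u"
  shows "exp (- u) \<le> 1 / (1 + u)"
  using exp_ge_add_one_self[of u] assms by (simp add: exp_minus field_simps)

lemma cosh_minus_one_le:
  fixes u :: real
  assumes "\<bar>u\<bar> \<le> 1"
  shows "cosh u - 1 \<le> u\<^sup>2"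
proof -
  have *: "cosh u - 1 \<le> u\<^sup>2" if u: "0 \<le> u" "u \<le> 1" for u :: real
  proof -
    have "exp (- u) \<le> 1 / (1 + u)" using u by (intro exp_minus_le_inverse)
    also have "\<dots> = 1 - u + u\<^sup>2 / (1 + u)" using u by (simp add: field_simps power2_eq_square)
    also have "1 - u + u\<^sup>2 / (1 + u) \<le> 1 - u + u\<^sup>2"
      using u by (intro add_left_mono) (simp add: divide_le_eq mult_le_cancel_left1)
    finally have "exp u + exp (- u) \<le> 2 + 2 * u\<^sup>2" using exp_bound[OF u] by simp
    then show ?thesis by (simp add: cosh_field_def field_simps)
  qed
  show ?thesis using *[of u] *[of "- u"] assms by (cases "0 \<le> u") auto
qed

lemma sinh_ge_self:
  fixes u :: real
  assumes "0 \<le> u"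
  shows "u \<le> sinh u"
proof -
  have "sinh 0 - 0 \<le> sinh u - u"
    using assms
  proof (rule DERIV_nonneg_imp_nondecreasing)
    fix x :: real
    show "\<exists>y. ((\<lambda>u. sinh u - u) has_real_derivative y) (at x) \<and> 0 \<le> y"
      using cosh_real_ge_1[of x] by (intro exI[of _ "cosh x - 1"]) (auto intro!: derivative_eq_intros)
  qed
  then show ?thesis by simp
qed

lemma one_minus_exp_ge_half:
  fixes u :: real
  assumes "0 \<le> u" "u \<le> 1"
  shows "u / 2 \<le> 1 - exp (- u)"
proof -
  have "u / 2 \<le> u / (1 + u)" using assms by (intro divide_left_mono) auto
  also have "\<dots> = 1 - 1 / (1 + u)" using assms by (simp add: field_simps)
  finally show ?thesis using exp_minus_le_inverse[of u] assms by linarith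
qed

lemma sinh_ge_half_cosh:
  fixes x :: real
  assumes "1 \<le> x"
  shows "cosh x / 2 \<le> sinh x"
proof -
  have "exp (- x) \<le> 1 / (1 + x)" using assms by (intro exp_minus_le_inverse) auto
  also have "\<dots> \<le> 1 / 2" using assms by (intro divide_left_mono) auto
  finally have "exp (- x) \<le> 1 / 2" .
  moreover have "2 \<le> exp x" using exp_ge_add_one_self[of x] assms by linarith
  ultimately show ?thesis by (simp add: sinh_def cosh_def)
qed

text \<open>Here \<open>r\<close> is the density ratio of the outward move. By the addition formulas
  the two weighted cosh terms minus (r + 1) cosh x equal (1 + r)(cosh u - 1) cosh x - (1 - r) sinh u
  sinh x. The first part is at most 2 u^2 cosh x; decay at rate 16 gives 1 - r >= 8 u and makes the
  second at least 4 u^2 cosh x. The surplus is 2 u^2 cosh x.\<close>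

lemma cosh_drift_right_tail:
  fixes r x u :: real
  assumes x: "1 \<le> x" and u: "0 \<le> u" "u \<le> 1/16" and r: "0 \<le> r" "r \<le> exp (- (16 * u))"
  shows "r * cosh (x + u) + cosh (x - u) + 2 * u\<^sup>2 * cosh x \<le> (r + 1) * cosh x"
proof -
  have c: "0 < cosh x" by simp
  have t: "cosh x / 2 \<le> sinh x" using sinh_ge_half_cosh[OF x] .
  have u2: "cosh u - 1 \<le> u\<^sup>2" using cosh_minus_one_le[of u] u by simp
  have s: "u \<le> sinh u" using sinh_ge_self u by simp
  have r1: "8 * u \<le> 1 - r" using one_minus_exp_ge_half[of "16 * u"] u r by simp
  have r2: "r \<le> 1" using r1 u by simp
  have "8 * u * u * (cosh x / 2) \<le> (1 - r) * sinh u * sinh x"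
    using r1 s t u c r2 by (intro mult_mono) auto
  moreover have "(1 + r) * (cosh u - 1) * cosh x \<le> 2 * u\<^sup>2 * cosh x"
    using u2 r r2 c cosh_real_ge_1[of u] by (intro mult_right_mono mult_mono) auto
  ultimately show ?thesis
    by (simp add: cosh_add cosh_diff power2_eq_square algebra_simps)
qed

text \<open>In the core no decay is available: the same expansion, with 1 - r merely nonnegative,
  leaves an error of second order in \<open>u\<close>.\<close>

lemma cosh_drift_right:
  fixes r x u :: real
  assumes x: "0 \<le> x" and u: "0 \<le> u" "u \<le> 1" and r: "0 \<le> r" "r \<le> 1"
  shows "r * cosh (x + u) + cosh (x - u) \<le> (r + 1) * cosh x + 2 * u\<^sup>2 * cosh x"
proof -
  have u2: "cosh u - 1 \<le> u\<^sup>2" using cosh_minus_one_le[of u] u by simp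
  have "0 \<le> (1 - r) * sinh u * sinh x"
    using x u r by simp
  moreover have "(1 + r) * (cosh u - 1) * cosh x \<le> 2 * u\<^sup>2 * cosh x"
    using u2 r cosh_real_ge_1[of u] by (intro mult_right_mono mult_mono) auto
  ultimately show ?thesis
    by (simp add: cosh_add cosh_diff power2_eq_square algebra_simps)
qed

lemma cosh_le_near_zero:
  fixes x y h :: real
  assumes "\<bar>y\<bar> \<le> 2 * h" "2 * h \<le> 1"
  shows "cosh y \<le> (1 + 4 * h\<^sup>2) * cosh x"
proof -
  have h: "0 \<le> h" using assms by linarith
  have "cosh y - 1 \<le> y\<^sup>2" using assms by (intro cosh_minus_one_le) auto
  also have "y\<^sup>2 \<le> (2 * h)\<^sup>2" using assms by (rule_tac abs_le_square_iff[THEN iffD1]) auto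
  finally have "cosh y \<le> 1 + 4 * h\<^sup>2" by simp
  also have "\<dots> \<le> (1 + 4 * h\<^sup>2) * cosh x" using mult_left_mono[OF cosh_real_ge_1[of x], of "1 + 4 * h\<^sup>2"] by simp
  finally show ?thesis .
qed

text \<open>Mode 0 and scale 1, to which \<open>box_poincare\<close> reduces by an affine change of variables.\<close>

locale standard_unimodal =
  fixes q :: "real \<Rightarrow> real"
  assumes q_measurable [measurable]: "q \<in> borel_measurable borel"
    and q_pos: "0 < q x"
    and q_mode: "q x \<le> q 0"
    and q_quasiconcave: "0 \<le> t \<Longrightarrow> t \<le> 1 \<Longrightarrow> min (q x) (q y) \<le> q ((1 - t) * x + t * y)"
    and q_decay_right: "1 \<le> x \<Longrightarrow> 0 \<le> u \<Longrightarrow> q (x + u) \<le> q x * exp (- (16 * u))"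
    and q_decay_left: "1 \<le> x \<Longrightarrow> 0 \<le> u \<Longrightarrow> q (- (x + u)) \<le> q (- x) * exp (- (16 * u))"
    and q_core: "ennreal (q 0) \<le> 48 * (\<integral>\<^sup>+x\<in>{-1..1}. ennreal (q x) \<partial>lborel)"
    and q_integrable: "(\<integral>\<^sup>+x. ennreal (q x) \<partial>lborel) < \<infinity>"
begin

lemma reflect: "standard_unimodal (\<lambda>x. q (- x))"
proof
  show "(\<lambda>x. q (- x)) \<in> borel_measurable borel" by measurable
  show "min (q (- x)) (q (- y)) \<le> q (- ((1 - t) * x + t * y))" if "0 \<le> t" "t \<le> 1" for t x y
    using q_quasiconcave[OF that, of "- x" "- y"] by (simp add: algebra_simps)
  show "ennreal (q (- 0)) \<le> 48 * (\<integral>\<^sup>+x\<in>{-1..1}. ennreal (q (- x)) \<partial>lborel)"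
    using q_core by (subst (asm) nn_integral_real_affine[where c="-1" and t=0])
      (simp_all add: indicator_def conj_commute)
  show "(\<integral>\<^sup>+x. ennreal (q (- x)) \<partial>lborel) < \<infinity>"
    using q_integrable by (subst (asm) nn_integral_real_affine[where c="-1" and t=0]) auto
  show "q (- (x + u)) \<le> q (- x) * exp (- (16 * u))" if "1 \<le> x" "0 \<le> u" for x u
    using q_decay_left[OF that] .
  show "q (- (- (x + u))) \<le> q (- (- x)) * exp (- (16 * u))" if "1 \<le> x" "0 \<le> u" for x u
    using q_decay_right[OF that] by (simp only: minus_minus)
qed (use q_pos q_mode in auto)

lemma antimono_right:
  assumes "0 \<le> x" "x \<le> y" shows "q y \<le> q x"
proof (cases "y = 0")
  case False
  then have "min (q 0) (q y) \<le> q x"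
    using q_quasiconcave[of "x / y" 0 y] assms by simp
  then show ?thesis using q_mode[of y] by (cases "q 0 = q y") (auto simp: min_def)
qed (use assms in auto)

text \<open>The moves +u and -u are paired so that first-order terms cancel up to the density ratio.
  Beyond distance 1 the decay gives a genuine negative drift. In the core the error is at most 4 u^2
  if the inward move stays on the same side of the mode, and 4 + 4 + 2 times h^2 if it crosses;
  hence the factor 10.\<close>

lemma drift_right:
  assumes h: "0 < h" "h \<le> 1/16" and u: "0 \<le> u" "u \<le> h" and x: "0 \<le> x"
  shows "min (q x) (q (x + u)) * cosh (x + u) + min (q x) (q (x - u)) * cosh (x - u) + 2 * u\<^sup>2 * (q x * cosh x)
    \<le> (min (q x) (q (x + u)) + min (q x) (q (x - u))) * cosh x
      + (if \<bar>x\<bar> \<le> 1 then 10 * h\<^sup>2 * (q x * cosh x) else 0)"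
proof -
  define r where "r = q (x + u) / q x"
  have q0: "0 < q x" by (rule q_pos)
  have qr: "q (x + u) = q x * r" using q0 by (simp add: r_def)
  have r0: "0 \<le> r" using q_pos[of "x + u"] q0 by (simp add: r_def)
  have r1: "r \<le> 1" using antimono_right[OF x, of "x + u"] u q0 by (simp add: r_def)
  have m1: "min (q x) (q (x + u)) = q x * r"
    using antimono_right[OF x, of "x + u"] u unfolding qr by (simp add: min_def)
  have u2: "2 * u\<^sup>2 \<le> 2 * h\<^sup>2" using u by (simp add: power_mono)
  show ?thesis
  proof (cases "u \<le> x")
    case True
    then have m2: "min (q x) (q (x - u)) = q x"
      using antimono_right[of "x - u" x] u by (simp add: min_def)
    show ?thesis
    proof (cases "1 < x")
      case True
      have "r \<le> exp (- (16 * u))" using q_decay_right[of x u] True u q0 by (simp add: r_def field_simps)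
      then have "r * cosh (x + u) + cosh (x - u) + 2 * u\<^sup>2 * cosh x \<le> (r + 1) * cosh x"
        using True u h r0 by (intro cosh_drift_right_tail) auto
      from mult_left_mono[OF this, of "q x"] q0 show ?thesis
        unfolding m1 m2 using True by (simp add: algebra_simps)
    next
      case False
      have "r * cosh (x + u) + cosh (x - u) \<le> (r + 1) * cosh x + 2 * u\<^sup>2 * cosh x"
        using x u h r0 r1 by (intro cosh_drift_right) auto
      moreover have "4 * u\<^sup>2 * cosh x \<le> 10 * h\<^sup>2 * cosh x"
        using u2 zero_le_power2[of h] by (intro mult_right_mono) (linarith | simp)+
      ultimately have "r * cosh (x + u) + cosh (x - u) + 2 * u\<^sup>2 * cosh x \<le> (r + 1) * cosh x + 10 * h\<^sup>2 * cosh x"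
        by linarith
      from mult_left_mono[OF this, of "q x"] q0 show ?thesis
        unfolding m1 m2 using False x by (simp add: algebra_simps)
    qed
  next
    case False
    \<comment> \<open>The inward move crosses the mode, so \<open>x + u\<close> and
      \<open>x - u\<close> lie within 2 h of 0, where cosh is at most 1 + 4 h^2.\<close>
    let ?k = "min (q x) (q (x - u))"
    have k: "0 \<le> ?k" "?k \<le> q x" using q_pos[of x] q_pos[of "x - u"] by auto
    have 1: "cosh (x + u) \<le> (1 + 4 * h\<^sup>2) * cosh x" "cosh (x - u) \<le> (1 + 4 * h\<^sup>2) * cosh x"
      using False x u h by (auto intro!: cosh_le_near_zero)
    define P where "P = h\<^sup>2 * (q x * cosh x)"
    have "q x * r * cosh (x + u) \<le> q x * r * ((1 + 4 * h\<^sup>2) * cosh x)"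
      using 1 q0 r0 by (intro mult_left_mono) auto
    also have "\<dots> = q x * r * cosh x + r * (4 * P)" by (simp add: P_def algebra_simps)
    also have "r * (4 * P) \<le> 1 * (4 * P)" using r1 q0 by (intro mult_right_mono) (auto simp: P_def)
    finally have A: "q x * r * cosh (x + u) \<le> q x * r * cosh x + 4 * P" by simp
    have "?k * cosh (x - u) \<le> ?k * ((1 + 4 * h\<^sup>2) * cosh x)"
      using 1 k by (intro mult_left_mono) auto
    also have "\<dots> = ?k * cosh x + ?k * (4 * h\<^sup>2 * cosh x)" by (simp add: algebra_simps)
    also have "?k * (4 * h\<^sup>2 * cosh x) \<le> q x * (4 * h\<^sup>2 * cosh x)"
      using k by (intro mult_right_mono) auto
    also have "q x * (4 * h\<^sup>2 * cosh x) = 4 * P" by (simp add: P_def)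
    finally have B: "?k * cosh (x - u) \<le> ?k * cosh x + 4 * P" by simp
    have "2 * u\<^sup>2 * (q x * cosh x) \<le> 2 * h\<^sup>2 * (q x * cosh x)"
      using u2 q0 by (intro mult_right_mono) auto
    also have "\<dots> = 2 * P" by (simp add: P_def)
    finally have "2 * u\<^sup>2 * (q x * cosh x) \<le> 2 * P" .
    with A B have "q x * r * cosh (x + u) + ?k * cosh (x - u) + 2 * u\<^sup>2 * (q x * cosh x)
       \<le> (q x * r + ?k) * cosh x + 10 * P"
      unfolding distrib_right by linarith
    then have "q x * r * cosh (x + u) + ?k * cosh (x - u) + 2 * u\<^sup>2 * (q x * cosh x)
       \<le> (q x * r + ?k) * cosh x + 10 * h\<^sup>2 * (q x * cosh x)"
      by (simp add: P_def)
    then show ?thesis unfolding m1 using False x u h by simp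
  qed
qed

lemma drift:
  assumes h: "0 < h" "h \<le> 1/16" and u: "\<bar>u\<bar> \<le> h"
  shows "min (q x) (q (x + u)) * cosh (x + u) + min (q x) (q (x - u)) * cosh (x - u) + 2 * u\<^sup>2 * (q x * cosh x)
    \<le> (min (q x) (q (x + u)) + min (q x) (q (x - u))) * cosh x
      + (if \<bar>x\<bar> \<le> 1 then 10 * h\<^sup>2 * (q x * cosh x) else 0)"
proof -
  interpret r: standard_unimodal "\<lambda>x. q (- x)" by (rule reflect)
  have eqs: "- (- x) = x" "- (- x + u) = x - u" "- (- x - u) = x + u" "x + - u = x - u" "x - - u = x + u"
    "- x + - u = - x - u" "- x - - u = - x + u" "(- u)\<^sup>2 = u\<^sup>2" "\<bar>- x\<bar> = \<bar>x\<bar>"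
    "cosh (- x) = cosh x" "cosh (- x + u) = cosh (x - u)" "cosh (- x - u) = cosh (x + u)"
    using cosh_minus[of "x - u"] cosh_minus[of "x + u"] by simp_all
  consider "0 \<le> u" "0 \<le> x" | "0 \<le> u" "x < 0" | "u < 0" "0 \<le> x" | "u < 0" "x < 0" by linarith
  then show ?thesis
  proof cases
    case 1 then show ?thesis using drift_right[OF h, of u x] u by simp
  next
    case 2
    then show ?thesis using r.drift_right[OF h, of u "- x"] u unfolding eqs distrib_right by linarith
  next
    case 3
    then show ?thesis using drift_right[OF h, of "- u" x] u unfolding eqs distrib_right by linarith
  next
    case 4
    then show ?thesis using r.drift_right[OF h, of "- u" "- x"] u unfolding eqs distrib_right by linarith
  qed
qed

end

text \<open>Twice the Dirichlet form of Metropolis moves with an unnormalised uniform proposal on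
  [-h, h]. Extended nonnegative values keep it defined for all measurable \<open>g\<close> and make
  Fubini unconditional.\<close>

definition box_form :: "(real \<Rightarrow> real) \<Rightarrow> real \<Rightarrow> (real \<Rightarrow> real) \<Rightarrow> ennreal" where
  "box_form q h g = (\<integral>\<^sup>+u\<in>{-h..h}. (\<integral>\<^sup>+x. ennreal (min (q x) (q (x + u)) * (g x - g (x + u))\<^sup>2) \<partial>lborel) \<partial>lborel)"

text \<open>Integral over pairs of points at distance at most \<open>h\<close>, written as base point and displacement.\<close>

definition strip_integral :: "real \<Rightarrow> (real \<Rightarrow> real \<Rightarrow> real) \<Rightarrow> ennreal" where
  "strip_integral h F = (\<integral>\<^sup>+u\<in>{-h..h}. (\<integral>\<^sup>+x. ennreal (F x u) \<partial>lborel) \<partial>lborel)"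

lemma box_form_eq_strip: "box_form q h g = strip_integral h (\<lambda>x u. min (q x) (q (x + u)) * (g x - g (x + u))\<^sup>2)"
  by (simp add: box_form_def strip_integral_def)

lemma strip_integral_mono:
  assumes "\<And>x u. \<bar>u\<bar> \<le> h \<Longrightarrow> F x u \<le> G x u"
  shows "strip_integral h F \<le> strip_integral h G"
  unfolding strip_integral_def using assms
  by (intro nn_integral_mono) (auto simp: indicator_def intro!: nn_integral_mono ennreal_leI)

lemma strip_integral_add:
  assumes [measurable]: "(\<lambda>(x, u). F x u) \<in> borel_measurable (borel \<Otimes>\<^sub>M borel)"
    "(\<lambda>(x, u). G x u) \<in> borel_measurable (borel \<Otimes>\<^sub>M borel)"
    and "\<And>x u. 0 \<le> F x u" "\<And>x u. 0 \<le> G x u"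
  shows "strip_integral h (\<lambda>x u. F x u + G x u) = strip_integral h F + strip_integral h G"
proof -
  have "(\<integral>\<^sup>+x. ennreal (F x u + G x u) \<partial>lborel) = (\<integral>\<^sup>+x. ennreal (F x u) \<partial>lborel) + (\<integral>\<^sup>+x. ennreal (G x u) \<partial>lborel)" for u
    using assms(3,4) by (subst nn_integral_add[symmetric]) auto
  then show ?thesis unfolding strip_integral_def
    by (subst nn_integral_add[symmetric]) (auto simp: distrib_right)
qed

lemma strip_integral_reflect:
  assumes [measurable]: "(\<lambda>(x, u). F x u) \<in> borel_measurable (borel \<Otimes>\<^sub>M borel)"
  shows "strip_integral h (\<lambda>x u. F x (- u)) = strip_integral h F"
proof -
  have "strip_integral h F = (\<integral>\<^sup>+u. (\<integral>\<^sup>+x. ennreal (F x (0 + -1 * u)) \<partial>lborel) * indicator {-h..h} (0 + -1 * u) \<partial>lborel)"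
    unfolding strip_integral_def by (subst nn_integral_real_affine[where c="-1" and t=0]) auto
  also have "\<dots> = strip_integral h (\<lambda>x u. F x (- u))"
    unfolding strip_integral_def by (intro nn_integral_cong) (auto simp: indicator_def)
  finally show ?thesis by simp
qed

text \<open>Exchanging the endpoints of a move maps (x, u) to (x + u, -u) and preserves the strip;
  this is reversibility of the box moves.\<close>

lemma strip_integral_swap:
  assumes [measurable]: "(\<lambda>(x, u). F x u) \<in> borel_measurable (borel \<Otimes>\<^sub>M borel)"
  shows "strip_integral h (\<lambda>x u. F (x + u) (- u)) = strip_integral h F"
proof -
  have "(\<integral>\<^sup>+x. ennreal (F x (- u)) \<partial>lborel) = (\<integral>\<^sup>+x. ennreal (F (x + u) (- u)) \<partial>lborel)" for u
    by (subst nn_integral_real_affine[where c=1 and t=u]) (auto simp: add.commute)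
  then have "strip_integral h (\<lambda>x u. F (x + u) (- u)) = strip_integral h (\<lambda>x u. F x (- u))"
    unfolding strip_integral_def by simp
  then show ?thesis by (simp add: strip_integral_reflect)
qed

lemma strip_integral_times:
  assumes [measurable]: "f \<in> borel_measurable borel" and k: "k \<in> borel_measurable borel" "\<And>u. 0 \<le> k u" "\<And>x. 0 \<le> f x"
  shows "strip_integral h (\<lambda>x u. k u * f x) = (\<integral>\<^sup>+u\<in>{-h..h}. ennreal (k u) \<partial>lborel) * (\<integral>\<^sup>+x. ennreal (f x) \<partial>lborel)"
proof -
  have "(\<integral>\<^sup>+x. ennreal (k u * f x) \<partial>lborel) = ennreal (k u) * (\<integral>\<^sup>+x. ennreal (f x) \<partial>lborel)" for u
    using k(2,3) by (subst nn_integral_cmult[symmetric]) (auto simp: ennreal_mult)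
  then have "strip_integral h (\<lambda>x u. k u * f x)
      = (\<integral>\<^sup>+u. (ennreal (k u) * indicator {-h..h} u) * (\<integral>\<^sup>+x. ennreal (f x) \<partial>lborel) \<partial>lborel)"
    unfolding strip_integral_def by (simp add: mult_ac)
  also have "\<dots> = (\<integral>\<^sup>+u\<in>{-h..h}. ennreal (k u) \<partial>lborel) * (\<integral>\<^sup>+x. ennreal (f x) \<partial>lborel)"
    using k(1) by (intro nn_integral_multc) auto
  finally show ?thesis .
qed

lemma nn_integral_square_Icc:
  assumes "0 \<le> h"
  shows "(\<integral>\<^sup>+u\<in>{-h..h}. ennreal (2 * u\<^sup>2) \<partial>lborel) = ennreal (4 / 3 * h ^ 3)"
proof -
  have "((\<lambda>u. 2 * u\<^sup>2) has_integral (2 / 3 * h ^ 3 - 2 / 3 * (- h) ^ 3)) {-h..h}"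
    using assms
    by (intro fundamental_theorem_of_calculus)
       (auto intro!: derivative_eq_intros simp: has_real_derivative_iff_has_vector_derivative[symmetric])
  then have "(\<integral>\<^sup>+u. ennreal (2 * u\<^sup>2) * indicator {-h..h} u \<partial>lborel) = ennreal (2 / 3 * h ^ 3 - 2 / 3 * (- h) ^ 3)"
    by (intro nn_integral_has_integral_lebesgue') auto
  then show ?thesis by (simp add: power3_eq_cube mult_ac)
qed

lemma nn_integral_const_Icc:
  assumes "0 \<le> h" "0 \<le> c"
  shows "(\<integral>\<^sup>+u\<in>{-h..h}. ennreal c \<partial>lborel) = ennreal (2 * h * c)"
  using assms by (simp add: nn_integral_cmult_indicator ennreal_mult[symmetric] mult_ac)

lemma strip_integral_const_times:
  assumes "f \<in> borel_measurable borel" "\<And>x. 0 \<le> f x" "0 \<le> h" "0 \<le> c"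
  shows "strip_integral h (\<lambda>x u. c * f x) = ennreal (2 * h * c) * (\<integral>\<^sup>+x. ennreal (f x) \<partial>lborel)"
  using assms strip_integral_times[of f "\<lambda>_. c" h] by (simp add: nn_integral_const_Icc)

text \<open>Barta's trick: a positive test function turns a pointwise drift bound into an integral bound,
  since \<open>2 g(x) g(y)\<close> is at most \<open>g(x)\<^sup>2 W(y) / W(x) + g(y)\<^sup>2 W(x) / W(y)\<close>.\<close>

lemma weighted_square_difference:
  fixes v w a b :: real
  assumes "0 < v" "0 < w"
  shows "a\<^sup>2 + b\<^sup>2 \<le> (a - b)\<^sup>2 + a\<^sup>2 * (w / v) + b\<^sup>2 * (v / w)"
proof -
  have "0 \<le> (a * w - b * v)\<^sup>2 / (v * w)" using assms by simp
  also have "\<dots> = a\<^sup>2 * (w / v) + b\<^sup>2 * (v / w) - 2 * a * b"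
    using assms by (simp add: power2_eq_square field_simps)
  finally show ?thesis by (simp add: power2_eq_square algebra_simps)
qed

context standard_unimodal
begin

text \<open>With the test function cosh, the weighted square inequality gives 2 S <= D + 2 T, and
  the drift bound summed over u and -u gives 2 T + A <= 2 S + B. Eliminating S and T leaves A <= D +
  B. Integrating 2 u^2 over [-h, h] yields 4/3 h^3 in A, and 10 h^2 over the same interval yields 20
  h^3 in B.\<close>

lemma barta:
  assumes [measurable]: "g \<in> borel_measurable borel" and h: "0 < h" "h \<le> 1/16"
    and fin: "(\<integral>\<^sup>+x. ennreal (q x * (g x)\<^sup>2) \<partial>lborel) < \<infinity>"
  shows "ennreal (4 / 3 * h ^ 3) * (\<integral>\<^sup>+x. ennreal (q x * (g x)\<^sup>2) \<partial>lborel)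
    \<le> box_form q h g + ennreal (20 * h ^ 3) * (\<integral>\<^sup>+x\<in>{-1..1}. ennreal (q x * (g x)\<^sup>2) \<partial>lborel)"
proof -
  let ?I = "strip_integral h"
  let ?Q = "\<integral>\<^sup>+x. ennreal (q x * (g x)\<^sup>2) \<partial>lborel"
  define k where "k x u = min (q x) (q (x + u))" for x u
  have [measurable]: "(\<lambda>x. cosh x) \<in> borel_measurable (borel :: real measure)"
    by (intro borel_measurable_continuous_onI continuous_intros)
  have k: "0 \<le> k x u" "k x u \<le> q x" for x u using q_pos[of x] q_pos[of "x + u"] by (auto simp: k_def)
  have ksw: "k (x + u) (- u) = k x u" for x u by (simp add: k_def min.commute)
  have k_meas [measurable]: "(\<lambda>(x, u). k x u) \<in> borel_measurable (borel \<Otimes>\<^sub>M borel)" unfolding k_def by measurable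
  define S where "S x u = k x u * (g x)\<^sup>2" for x u
  define T where "T x u = k x u * (g x)\<^sup>2 * (cosh (x + u) / cosh x)" for x u
  define A where "A x u = 2 * u\<^sup>2 * (q x * (g x)\<^sup>2)" for x u
  define B where "B x u = (10 * h\<^sup>2) * (q x * (g x)\<^sup>2 * indicator {-1..1} x)" for x u :: real
  define D where "D x u = k x u * (g x - g (x + u))\<^sup>2" for x u
  have m [measurable]: "(\<lambda>(x, u). S x u) \<in> borel_measurable (borel \<Otimes>\<^sub>M borel)"
    "(\<lambda>(x, u). T x u) \<in> borel_measurable (borel \<Otimes>\<^sub>M borel)"
    "(\<lambda>(x, u). A x u) \<in> borel_measurable (borel \<Otimes>\<^sub>M borel)"
    "(\<lambda>(x, u). B x u) \<in> borel_measurable (borel \<Otimes>\<^sub>M borel)"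
    "(\<lambda>(x, u). D x u) \<in> borel_measurable (borel \<Otimes>\<^sub>M borel)"
    unfolding S_def T_def A_def B_def D_def by measurable
  have nn: "0 \<le> S x u" "0 \<le> T x u" "0 \<le> A x u" "0 \<le> B x u" "0 \<le> D x u" for x u
    using k[of x u] q_pos[of x] by (simp_all add: S_def T_def A_def B_def D_def)
  have S: "?I (\<lambda>x u. S x u + S (x + u) (- u)) = ?I S + ?I S"
    "?I (\<lambda>x u. S x u + S x (- u)) = ?I S + ?I S"
    by (subst strip_integral_add; simp add: nn strip_integral_swap strip_integral_reflect)+
  have T: "?I (\<lambda>x u. T x u + T (x + u) (- u)) = ?I T + ?I T"
    "?I (\<lambda>x u. T x u + T x (- u)) = ?I T + ?I T"
    by (subst strip_integral_add; simp add: nn strip_integral_swap strip_integral_reflect)+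
  have "?I (\<lambda>x u. S x u + S (x + u) (- u)) \<le> ?I (\<lambda>x u. D x u + (T x u + T (x + u) (- u)))"
  proof (rule strip_integral_mono)
    fix x u :: real
    have "(g x)\<^sup>2 + (g (x + u))\<^sup>2 \<le> (g x - g (x + u))\<^sup>2 + (g x)\<^sup>2 * (cosh (x + u) / cosh x)
        + (g (x + u))\<^sup>2 * (cosh x / cosh (x + u))"
      by (rule weighted_square_difference) auto
    from mult_left_mono[OF this k(1)[of x u]]
    show "S x u + S (x + u) (- u) \<le> D x u + (T x u + T (x + u) (- u))"
      by (simp add: S_def T_def D_def ksw distrib_left mult_ac)
  qed
  also have "\<dots> = ?I D + ?I (\<lambda>x u. T x u + T (x + u) (- u))"
    by (rule strip_integral_add) (auto simp: nn)
  finally have 1: "?I S + ?I S \<le> ?I D + (?I T + ?I T)" unfolding S T .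
  have "?I (\<lambda>x u. (T x u + T x (- u)) + A x u) \<le> ?I (\<lambda>x u. (S x u + S x (- u)) + B x u)"
  proof (rule strip_integral_mono)
    fix x u :: real assume u: "\<bar>u\<bar> \<le> h"
    define c where "c = (g x)\<^sup>2 / cosh x"
    have c: "0 \<le> c" "c * cosh x = (g x)\<^sup>2" by (simp_all add: c_def)
    have "T x u + T x (- u) + A x u = c * (k x u * cosh (x + u) + k x (- u) * cosh (x - u) + 2 * u\<^sup>2 * (q x * cosh x))"
      by (simp add: T_def A_def c_def field_simps)
    also have "\<dots> \<le> c * ((k x u + k x (- u)) * cosh x + (if \<bar>x\<bar> \<le> 1 then 10 * h\<^sup>2 * (q x * cosh x) else 0))"
      using drift[OF h u, of x] c(1) unfolding k_def by (intro mult_left_mono) simp_all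
    also have "\<dots> = S x u + S x (- u) + B x u"
      by (cases "\<bar>x\<bar> \<le> 1") (auto simp: S_def B_def c(2)[symmetric] indicator_def algebra_simps)
    finally show "T x u + T x (- u) + A x u \<le> S x u + S x (- u) + B x u" .
  qed
  also have "?I (\<lambda>x u. (T x u + T x (- u)) + A x u) = ?I (\<lambda>x u. T x u + T x (- u)) + ?I A"
    by (rule strip_integral_add) (auto simp: nn)
  also have "?I (\<lambda>x u. (S x u + S x (- u)) + B x u) = ?I (\<lambda>x u. S x u + S x (- u)) + ?I B"
    by (rule strip_integral_add) (auto simp: nn)
  finally have 2: "(?I T + ?I T) + ?I A \<le> (?I S + ?I S) + ?I B" unfolding S T .
  \<comment> \<open>T must be finite before it can be cancelled from both sides; the ratio of the
    cosh values is at most exp |u| <= 2.\<close>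
  have "?I T \<le> ?I (\<lambda>x u. 2 * (q x * (g x)\<^sup>2))"
  proof (rule strip_integral_mono)
    fix x u :: real assume u: "\<bar>u\<bar> \<le> h"
    have "cosh (x + u) \<le> exp \<bar>u\<bar> * cosh x"
    proof -
      have "exp (x + u) \<le> exp \<bar>u\<bar> * exp x" "exp (- (x + u)) \<le> exp \<bar>u\<bar> * exp (- x)"
        by (simp_all add: exp_add[symmetric])
      then show ?thesis unfolding cosh_field_def by (simp add: algebra_simps)
    qed
    also have "exp \<bar>u\<bar> \<le> 2"
      using exp_bound[of "\<bar>u\<bar>"] u h power_mono[of "\<bar>u\<bar>" "1/16" 2] by (simp add: power2_eq_square)
    finally have "cosh (x + u) / cosh x \<le> 2" by (simp add: field_simps)
    then have "k x u * (g x)\<^sup>2 * (cosh (x + u) / cosh x) \<le> q x * (g x)\<^sup>2 * 2"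
      using k[of x u] by (intro mult_mono) auto
    then show "T x u \<le> 2 * (q x * (g x)\<^sup>2)" by (simp add: T_def mult_ac)
  qed
  also have "\<dots> = ennreal (2 * h * 2) * ?Q"
    using h q_pos by (subst strip_integral_const_times) (auto simp: less_imp_le)
  also have "\<dots> < \<infinity>" using fin by (simp add: ennreal_mult_less_top)
  finally have fT: "?I T + ?I T \<noteq> \<infinity>" by simp
  have "(?I T + ?I T) + ?I A \<le> (?I T + ?I T) + (?I D + ?I B)"
    using order_trans[OF 2 add_right_mono[OF 1, of "?I B"]] by (simp only: ac_simps)
  then have 3: "?I A \<le> ?I D + ?I B"
    using fT by (simp add: ennreal_add_left_cancel_le)
  have "?I A = ennreal (4 / 3 * h ^ 3) * ?Q"
    unfolding A_def using h q_pos
    by (subst strip_integral_times) (auto simp: nn_integral_square_Icc less_imp_le)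
  moreover have "?I B = ennreal (20 * h ^ 3) * (\<integral>\<^sup>+x. ennreal (q x * (g x)\<^sup>2 * indicator {-1..1} x) \<partial>lborel)"
    unfolding B_def using h q_pos
    by (subst strip_integral_const_times) (auto simp: less_imp_le power2_eq_square[of h] power3_eq_cube mult.assoc)
  moreover have "(\<integral>\<^sup>+x. ennreal (q x * (g x)\<^sup>2 * indicator {-1..1} x) \<partial>lborel)
     = (\<integral>\<^sup>+x\<in>{-1..1}. ennreal (q x * (g x)\<^sup>2) \<partial>lborel)"
    by (intro nn_integral_cong) (auto simp: indicator_def)
  moreover have "?I D = box_form q h g"
    unfolding box_form_eq_strip D_def[abs_def] k_def ..
  ultimately show ?thesis using 3 by simp
qed

end

section \<open>Variance in the core\<close>

lemma sum_telescope_square_le: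
  fixes f :: "nat \<Rightarrow> real"
  shows "(f 0 - f n)\<^sup>2 \<le> real n * (\<Sum>i<n. (f i - f (Suc i))\<^sup>2)"
proof -
  have "f 0 - f n = (\<Sum>i<n. f i - f (Suc i))" by (induction n) auto
  then have "(f 0 - f n)\<^sup>2 = (\<Sum>i<n. 1 * (f i - f (Suc i)))\<^sup>2" by simp
  also have "\<dots> \<le> (\<Sum>i<n. 1\<^sup>2) * (\<Sum>i<n. (f i - f (Suc i))\<^sup>2)"
    by (rule Cauchy_Schwarz_ineq_sum)
  finally show ?thesis by simp
qed

text \<open>Some point of the core has a value no larger than the weighted average. Otherwise the
  excess over the average would be positive on the whole core and have integral 0, and the core
  would be a null set.\<close>

lemma nn_integral_average_le:
  fixes F :: "real \<Rightarrow> ennreal"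
  assumes [measurable]: "r \<in> borel_measurable borel" "F \<in> borel_measurable borel"
    and pos: "\<And>y. 0 < r y" and C: "(\<integral>\<^sup>+y\<in>{-1..1}. ennreal (r y) \<partial>lborel) < \<infinity>"
    and M: "(\<integral>\<^sup>+y\<in>{-1..1}. ennreal (r y) * F y \<partial>lborel) \<le> M"
  shows "\<exists>y\<in>{-1..1}. (\<integral>\<^sup>+y\<in>{-1..1}. ennreal (r y) \<partial>lborel) * F y \<le> M"
proof -
  let ?C = "\<integral>\<^sup>+y\<in>{-1..1}. ennreal (r y) \<partial>lborel"
  show ?thesis
  proof (rule ccontr)
    assume "\<not> ?thesis"
    then have big: "M < ?C * F y" if "y \<in> {-1..1}" for y using that by force
    have "0 < ?C"
    proof (rule ccontr)
      assume "\<not> 0 < ?C"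
      then show False using big[of 0] by simp
    qed
    have Mfin: "M < \<infinity>" using big[of 0] by (metis atLeastAtMost_iff infinity_ennreal_def le_minus_one_simps(1) not_less_zero order_less_le_trans top.extremum zero_le_one)
    define c where "c = M / ?C"
    have "c < F y" if "y \<in> {-1..1}" for y
      using big[OF that] \<open>0 < ?C\<close> C unfolding c_def
      by (metis divide_less_ennreal infinity_ennreal_def mult.commute neq_iff)
    then have 1: "0 < F y - c" if "y \<in> {-1..1}" for y using that by (simp add: diff_gr0_ennreal)
    have cC: "c * ?C = M" unfolding c_def using \<open>0 < ?C\<close> C
      by (simp add: ennreal_divide_times divide_eq_1_ennreal mult_divide_eq_ennreal)
    have cfin: "c < \<infinity>" unfolding c_def using Mfin \<open>0 < ?C\<close> by (auto simp: ennreal_divide_eq_top_iff less_top[symmetric])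
    have "(\<integral>\<^sup>+y\<in>{-1..1}. ennreal (r y) * F y \<partial>lborel)
       = (\<integral>\<^sup>+y. c * (ennreal (r y) * indicator {-1..1} y) + ennreal (r y) * (F y - c) * indicator {-1..1} y \<partial>lborel)"
    proof (intro nn_integral_cong)
      fix y
      show "ennreal (r y) * F y * indicator {-1..1} y
        = c * (ennreal (r y) * indicator {-1..1} y) + ennreal (r y) * (F y - c) * indicator {-1..1} y"
      proof (cases "y \<in> {-1..1}")
        case True
        have "F y = c + (F y - c)" using \<open>y \<in> {-1..1} \<Longrightarrow> c < F y\<close>[OF True] cfin
          by (metis add.commute diff_add_cancel_ennreal less_imp_le)
        then have "ennreal (r y) * F y = ennreal (r y) * c + ennreal (r y) * (F y - c)"
          by (metis distrib_left)
        then show ?thesis using True by (simp add: mult.commute)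
      qed simp
    qed
    also have "\<dots> = c * ?C + (\<integral>\<^sup>+y\<in>{-1..1}. ennreal (r y) * (F y - c) \<partial>lborel)"
      by (subst nn_integral_add) (auto simp: nn_integral_cmult)
    finally have "M + (\<integral>\<^sup>+y\<in>{-1..1}. ennreal (r y) * (F y - c) \<partial>lborel) \<le> M + 0"
      using M cC by simp
    then have "(\<integral>\<^sup>+y\<in>{-1..1}. ennreal (r y) * (F y - c) \<partial>lborel) = 0"
      using Mfin by (auto simp: ennreal_add_left_cancel_le)
    then have "AE y in lborel. ennreal (r y) * (F y - c) * indicator {-1..1} y = 0"
      by (subst (asm) nn_integral_0_iff_AE) auto
    then have "AE y in lborel. y \<notin> {-1..1::real}"
    proof eventually_elim
      case (elim y)
      show ?case
      proof
        assume y: "y \<in> {-1..1}"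
        then have "F y - c \<noteq> 0" "ennreal (r y) \<noteq> 0" using 1[OF y] pos[of y] by auto
        then show False using elim y by simp
      qed
    qed
    then have "emeasure lborel {-1..1::real} = 0"
      by (subst (asm) AE_iff_measurable[of "{-1..1}"]) auto
    then show False by simp
  qed
qed

context standard_unimodal
begin

text \<open>A displacement \<open>w\<close> of length at most 2 is cut into \<open>n\<close> equal
  steps of length at most \<open>h\<close>. Cauchy-Schwarz costs a factor n, the number of steps
  another, and the substitution w / n a third. Quasiconcavity keeps the density at each intermediate
  point above the smaller of the two end values.\<close>

lemma local_poincare:
  fixes n :: nat
  assumes [measurable]: "g \<in> borel_measurable borel" and h: "0 < h" and n: "2 \<le> real n * h"
  shows "(\<integral>\<^sup>+w. (\<integral>\<^sup>+x. ennreal (min (q x) (q (x + w)) * (g x - g (x + w))\<^sup>2 * indicator {-1..1} x * indicator {-1..1} (x + w)) \<partial>lborel) \<partial>lborel)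
    \<le> ennreal (real n ^ 3) * box_form q h g"
proof -
  let ?D = "\<lambda>x w. ennreal (min (q x) (q (x + w)) * (g x - g (x + w))\<^sup>2 * indicator {-1..1} x * indicator {-1..1} (x + w))"
  have n0: "0 < real n" using n h by (cases n) auto
  define F where "F x u = ennreal (min (q x) (q (x + u)) * (g x - g (x + u))\<^sup>2) * indicator {-h..h} u" for x u
  have [measurable]: "(\<lambda>(x, u). F x u) \<in> borel_measurable (borel \<Otimes>\<^sub>M borel)" unfolding F_def by measurable
  have Fw [measurable]: "(\<lambda>(w, x). F (x + real i * (w / real n)) (w / real n)) \<in> borel_measurable (borel \<Otimes>\<^sub>M borel)" for i
    unfolding F_def by measurable
  have [measurable]: "(\<lambda>(w, x). F x (w / real n)) \<in> borel_measurable (borel \<Otimes>\<^sub>M borel)"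
    "(\<lambda>(w, x). F x w) \<in> borel_measurable (borel \<Otimes>\<^sub>M borel)"
    unfolding F_def by measurable
  have F: "(\<integral>\<^sup>+w. (\<integral>\<^sup>+x. F x w \<partial>lborel) \<partial>lborel) = box_form q h g"
    unfolding F_def box_form_def by (simp add: nn_integral_multc)
  have pw: "?D x w
      \<le> ennreal (real n) * (\<Sum>i<n. F (x + real i * (w / real n)) (w / real n))" for x w
  proof (cases "x \<in> {-1..1} \<and> x + w \<in> {-1..1}")
    case True
    define z where "z i = x + real i * (w / real n)" for i
    have z0: "z 0 = x" and zn: "z n = x + w" using n0 by (simp_all add: z_def)
    have zS: "z (Suc i) = z i + w / real n" for i by (simp add: z_def algebra_simps add_divide_distrib)
    have "\<bar>w\<bar> \<le> 2" using True by (auto simp: abs_le_iff)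
    then have w: "\<bar>w / real n\<bar> \<le> h" using n n0 by (simp add: field_simps)
    let ?m = "min (q x) (q (x + w))"
    have m0: "0 \<le> ?m" using q_pos[of x] q_pos[of "x + w"] by auto
    have mz: "?m \<le> q (z i)" if "i \<le> n" for i
    proof -
      have "min (q x) (q (x + w)) \<le> q ((1 - real i / real n) * x + (real i / real n) * (x + w))"
        using that n0 by (intro q_quasiconcave) auto
      also have "(1 - real i / real n) * x + (real i / real n) * (x + w) = z i"
        using n0 by (simp add: z_def field_simps)
      finally show ?thesis .
    qed
    have "?m * (g x - g (x + w))\<^sup>2 \<le> ?m * (real n * (\<Sum>i<n. (g (z i) - g (z (Suc i)))\<^sup>2))"
      using sum_telescope_square_le[of "\<lambda>i. g (z i)" n] m0 unfolding z0 zn by (intro mult_left_mono)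
    also have "\<dots> = real n * (\<Sum>i<n. ?m * (g (z i) - g (z (Suc i)))\<^sup>2)"
      by (simp add: sum_distrib_left mult_ac)
    also have "\<dots> \<le> real n * (\<Sum>i<n. min (q (z i)) (q (z (Suc i))) * (g (z i) - g (z (Suc i)))\<^sup>2)"
      using mz by (intro mult_left_mono sum_mono mult_right_mono) auto
    finally have "ennreal (?m * (g x - g (x + w))\<^sup>2)
        \<le> ennreal (real n * (\<Sum>i<n. min (q (z i)) (q (z (Suc i))) * (g (z i) - g (z (Suc i)))\<^sup>2))"
      by (rule ennreal_leI)
    also have "\<dots> = ennreal (real n) * (\<Sum>i<n. ennreal (min (q (z i)) (q (z (Suc i))) * (g (z i) - g (z (Suc i)))\<^sup>2))"
      using q_pos by (subst sum_ennreal) (auto simp: ennreal_mult sum_nonneg less_imp_le)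
    also have "\<dots> = ennreal (real n) * (\<Sum>i<n. F (x + real i * (w / real n)) (w / real n))"
    proof -
      have "F (z i) (w / real n) = ennreal (min (q (z i)) (q (z (Suc i))) * (g (z i) - g (z (Suc i)))\<^sup>2)" for i
        using abs_le_D1[OF w] abs_le_D2[OF w] unfolding F_def zS by (simp add: indicator_def)
      then show ?thesis by (simp only: z_def[symmetric])
    qed
    finally show ?thesis using True by simp
  qed (auto simp: indicator_def)
  have shift: "(\<integral>\<^sup>+w. (\<integral>\<^sup>+x. F (x + real i * (w / real n)) (w / real n) \<partial>lborel) \<partial>lborel) = ennreal (real n) * box_form q h g" for i
  proof -
    have "(\<integral>\<^sup>+x. F (x + real i * (w / real n)) (w / real n) \<partial>lborel) = (\<integral>\<^sup>+x. F x (w / real n) \<partial>lborel)" for w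
      by (subst nn_integral_real_affine[where c=1 and t="real i * (w / real n)" and f="\<lambda>x. F x (w / real n)"])
         (auto simp: add.commute)
    then have "(\<integral>\<^sup>+w. (\<integral>\<^sup>+x. F (x + real i * (w / real n)) (w / real n) \<partial>lborel) \<partial>lborel)
       = (\<integral>\<^sup>+w. (\<integral>\<^sup>+x. F x (w / real n) \<partial>lborel) \<partial>lborel)" by simp
    also have "\<dots> = ennreal (real n) * (\<integral>\<^sup>+w. (\<integral>\<^sup>+x. F x w \<partial>lborel) \<partial>lborel)"
      using n0 by (subst nn_integral_real_affine[where c="real n" and t=0]) auto
    finally show ?thesis unfolding F .
  qed
  have "(\<integral>\<^sup>+w. (\<integral>\<^sup>+x. ?D x w \<partial>lborel) \<partial>lborel)
    \<le> (\<integral>\<^sup>+w. (\<integral>\<^sup>+x. ennreal (real n) * (\<Sum>i<n. F (x + real i * (w / real n)) (w / real n)) \<partial>lborel) \<partial>lborel)"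
    by (intro nn_integral_mono pw)
  also have "\<dots> = ennreal (real n) * (\<Sum>i<n. \<integral>\<^sup>+w. (\<integral>\<^sup>+x. F (x + real i * (w / real n)) (w / real n) \<partial>lborel) \<partial>lborel)"
    by (simp add: nn_integral_cmult nn_integral_sum)
  also have "\<dots> = ennreal (real n ^ 3) * box_form q h g"
    unfolding shift
    by (simp add: ennreal_of_nat_eq_real_of_nat[symmetric] ennreal_mult power3_eq_cube mult_ac)
  finally show ?thesis .
qed

text \<open>The reference constant \<open>c\<close> is a value of \<open>g\<close> at a well-chosen point of the core \<open>[-1, 1]\<close>;
  Barta's bound controls the tails and \<open>local_poincare\<close> the core.\<close>

lemma core_variance:
  assumes [measurable]: "g \<in> borel_measurable borel" and h: "0 < h" "h \<le> 1/16"
  shows "\<exists>c. (\<integral>\<^sup>+x\<in>{-1..1}. ennreal (q x * (g x - c)\<^sup>2) \<partial>lborel) \<le> ennreal (432 / h ^ 3) * box_form q h g"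
proof -
  let ?D = "\<lambda>x w. ennreal (min (q x) (q (x + w)) * (g x - g (x + w))\<^sup>2 * indicator {-1..1} x * indicator {-1..1} (x + w))"
  let ?B = "\<lambda>x w. ennreal (q (x + w) * q x * (g x - g (x + w))\<^sup>2 * indicator {-1..1} x * indicator {-1..1} (x + w))"
  define n where "n = nat \<lceil>2 / h\<rceil>"
  have n1: "2 / h \<le> real n" unfolding n_def by (simp add: real_nat_ceiling_ge)
  have n2: "real n \<le> 2 / h + 1"
  proof -
    have "0 < 2 / h" using h by simp
    then have "0 \<le> \<lceil>2 / h\<rceil>" by linarith
    then have "real n = real_of_int \<lceil>2 / h\<rceil>" by (simp add: n_def)
    then show ?thesis using ceiling_correct[of "2 / h"] by linarith
  qed
  \<comment> \<open>Since h <= 1/16, rounding up costs at most 1 / (16 h), so n <= (33/16) / h; the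
    cube of 33/16 is below 9.\<close>
  have "1 \<le> 1 / 16 / h" using h by (simp add: field_simps)
  then have "real n \<le> 33 / 16 / h" using n2 by (simp add: field_simps)
  then have "real n ^ 3 \<le> (33 / 16 / h) ^ 3" by (intro power_mono) auto
  also have "\<dots> \<le> 9 / h ^ 3" using h by (simp add: power_divide divide_simps)
  finally have n3: "real n ^ 3 \<le> 9 / h ^ 3" .
  let ?E = "box_form q h g"
  let ?C = "\<integral>\<^sup>+y\<in>{-1..1}. ennreal (q y) \<partial>lborel"
  define F where "F y = (\<integral>\<^sup>+x\<in>{-1..1}. ennreal (q x * (g x - g y)\<^sup>2) \<partial>lborel)" for y
  have [measurable]: "F \<in> borel_measurable borel" unfolding F_def by measurable
  have Cfin: "?C < \<infinity>"
  proof -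
    have "?C \<le> (\<integral>\<^sup>+x. ennreal (q x) \<partial>lborel)" by (intro nn_integral_mono) (auto simp: indicator_def)
    then show ?thesis using q_integrable by (rule le_less_trans)
  qed
  have "(\<integral>\<^sup>+y\<in>{-1..1}. ennreal (q y) * F y \<partial>lborel)
     = (\<integral>\<^sup>+y. (\<integral>\<^sup>+x. ennreal (q y * q x * (g x - g y)\<^sup>2 * indicator {-1..1} x * indicator {-1..1} y) \<partial>lborel) \<partial>lborel)"
    unfolding F_def
    by (intro nn_integral_cong, subst nn_integral_cmult[symmetric])
       (auto simp: indicator_def ennreal_mult[symmetric] q_pos less_imp_le mult_ac intro!: nn_integral_cong)
  also have "\<dots> = (\<integral>\<^sup>+x. (\<integral>\<^sup>+y. ennreal (q y * q x * (g x - g y)\<^sup>2 * indicator {-1..1} x * indicator {-1..1} y) \<partial>lborel) \<partial>lborel)"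
    by (rule lborel_pair.Fubini') measurable
  also have "\<dots> = (\<integral>\<^sup>+x. (\<integral>\<^sup>+w. ?B x w \<partial>lborel) \<partial>lborel)"
  proof (rule nn_integral_cong)
    fix x :: real
    let ?f = "\<lambda>y. ennreal (q y * q x * (g x - g y)\<^sup>2 * indicator {-1..1} x * indicator {-1..1} y)"
    have "(\<integral>\<^sup>+y. ?f y \<partial>lborel) = (\<integral>\<^sup>+w. ?f (x + 1 * w) \<partial>lborel)"
      by (subst nn_integral_real_affine[where c=1 and t=x]) auto
    then show "(\<integral>\<^sup>+y. ?f y \<partial>lborel) = (\<integral>\<^sup>+w. ?B x w \<partial>lborel)"
      by simp
  qed
  also have "\<dots> = (\<integral>\<^sup>+w. (\<integral>\<^sup>+x. ?B x w \<partial>lborel) \<partial>lborel)"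
    by (rule lborel_pair.Fubini') measurable
  also have "\<dots> \<le> (\<integral>\<^sup>+w. (\<integral>\<^sup>+x. ennreal (q 0) * ?D x w \<partial>lborel) \<partial>lborel)"
  proof (intro nn_integral_mono)
    fix x w
    \<comment> \<open>One of the two densities is bounded by the mode value, which
      \<open>q_core\<close> then trades for the mass of the core; that mass cancels at the end, and
      48 * 9 = 432.\<close>
    have "q (x + w) * q x \<le> q 0 * min (q x) (q (x + w))"
      using q_mode[of x] q_mode[of "x + w"] q_pos[of x] q_pos[of "x + w"]
      by (auto simp: min_def mult.commute intro: mult_mono)
    then have "q (x + w) * q x * ((g x - g (x + w))\<^sup>2 * indicator {-1..1} x * indicator {-1..1} (x + w))
       \<le> q 0 * min (q x) (q (x + w)) * ((g x - g (x + w))\<^sup>2 * indicator {-1..1} x * indicator {-1..1} (x + w))"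
      by (intro mult_right_mono) auto
    then show "?B x w
       \<le> ennreal (q 0) * ?D x w"
      using q_pos[of 0] q_pos[of x] q_pos[of "x + w"]
      by (subst ennreal_mult[symmetric]) (auto simp: mult.assoc intro!: ennreal_leI)
  qed
  also have "\<dots> = ennreal (q 0) * (\<integral>\<^sup>+w. (\<integral>\<^sup>+x. ?D x w \<partial>lborel) \<partial>lborel)"
    by (simp add: nn_integral_cmult)
  also have "\<dots> \<le> ennreal (q 0) * (ennreal (real n ^ 3) * ?E)"
    using n1 h by (intro mult_left_mono local_poincare) (auto simp: field_simps)
  also have "\<dots> \<le> ennreal (q 0) * (ennreal (9 / h ^ 3) * ?E)"
    using n3 by (intro mult_left_mono mult_right_mono ennreal_leI) auto
  also have "\<dots> \<le> (48 * ?C) * (ennreal (9 / h ^ 3) * ?E)"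
    using q_core by (intro mult_right_mono) auto
  also have "\<dots> = ?C * ((48 * ennreal (9 / h ^ 3)) * ?E)" by (simp add: mult_ac)
  also have "48 * ennreal (9 / h ^ 3) = ennreal (432 / h ^ 3)"
    using h by (subst ennreal_numeral[symmetric], subst ennreal_mult[symmetric]) auto
  finally obtain y where "?C * F y \<le> ?C * (ennreal (432 / h ^ 3) * ?E)"
    using nn_integral_average_le[of q F, OF _ _ q_pos Cfin] by auto
  moreover have "0 < ?C"
  proof (rule ccontr)
    assume "\<not> 0 < ?C" then have "ennreal (q 0) \<le> 0" using q_core by simp
    then show False using q_pos[of 0] by simp
  qed
  ultimately have "F y \<le> ennreal (432 / h ^ 3) * ?E"
    using Cfin by (simp add: ennreal_mult_le_mult_iff)
  then show ?thesis unfolding F_def by auto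
qed

text \<open>Barta's bound for g - c leaves only the core term, and the core variance bounds it by 20
  * 432 = 8640 times the box form. Dividing 8641 by 4/3 h^3 gives slightly less than 6500 /
  h^3.\<close>

lemma box_poincare_standard:
  assumes [measurable]: "g \<in> borel_measurable borel" and h: "0 < h" "h \<le> 1/16"
    and fin: "(\<integral>\<^sup>+x. ennreal (q x * (g x)\<^sup>2) \<partial>lborel) < \<infinity>"
  shows "\<exists>c. (\<integral>\<^sup>+x. ennreal (q x * (g x - c)\<^sup>2) \<partial>lborel) \<le> ennreal (6500 / h ^ 3) * box_form q h g"
proof -
  let ?E = "box_form q h g"
  obtain c where c: "(\<integral>\<^sup>+x\<in>{-1..1}. ennreal (q x * (g x - c)\<^sup>2) \<partial>lborel) \<le> ennreal (432 / h ^ 3) * ?E"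
    using core_variance[OF assms(1) h] by auto
  let ?Q = "\<integral>\<^sup>+x. ennreal (q x * (g x - c)\<^sup>2) \<partial>lborel"
  have "?Q \<le> (\<integral>\<^sup>+x. 2 * ennreal (q x * (g x)\<^sup>2) + ennreal (2 * c\<^sup>2) * ennreal (q x) \<partial>lborel)"
  proof (intro nn_integral_mono)
    fix x
    have "(g x - c)\<^sup>2 \<le> 2 * (g x)\<^sup>2 + 2 * c\<^sup>2"
      using zero_le_power2[of "g x + c"] by (simp add: power2_eq_square algebra_simps)
    from mult_left_mono[OF this less_imp_le[OF q_pos[of x]]]
    have "q x * (g x - c)\<^sup>2 \<le> 2 * (q x * (g x)\<^sup>2) + 2 * c\<^sup>2 * q x" by (simp add: algebra_simps)
    then have "ennreal (q x * (g x - c)\<^sup>2) \<le> ennreal (2 * (q x * (g x)\<^sup>2) + 2 * c\<^sup>2 * q x)" by (rule ennreal_leI)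
    also have "\<dots> = 2 * ennreal (q x * (g x)\<^sup>2) + ennreal (2 * c\<^sup>2) * ennreal (q x)"
      using q_pos[of x] by (simp add: ennreal_mult ennreal_plus[symmetric] del: ennreal_plus) (simp add: ennreal_mult)
    finally show "ennreal (q x * (g x - c)\<^sup>2) \<le> \<dots>" .
  qed
  also have "\<dots> = 2 * (\<integral>\<^sup>+x. ennreal (q x * (g x)\<^sup>2) \<partial>lborel) + ennreal (2 * c\<^sup>2) * (\<integral>\<^sup>+x. ennreal (q x) \<partial>lborel)"
    by (simp add: nn_integral_add nn_integral_cmult)
  also have "\<dots> < \<infinity>" using fin q_integrable by (simp add: ennreal_mult_less_top ennreal_add_eq_top less_top)
  finally have fin': "?Q < \<infinity>" .
  have Ec: "box_form q h (\<lambda>x. g x - c) = ?E" by (simp add: box_form_def)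
  have "ennreal (4 / 3 * h ^ 3) * ?Q
    \<le> ?E + ennreal (20 * h ^ 3) * (\<integral>\<^sup>+x\<in>{-1..1}. ennreal (q x * (g x - c)\<^sup>2) \<partial>lborel)"
    using barta[of "\<lambda>x. g x - c", OF _ h fin'] unfolding Ec by simp
  also have "\<dots> \<le> ?E + ennreal (20 * h ^ 3) * (ennreal (432 / h ^ 3) * ?E)"
    using c by (intro add_left_mono mult_left_mono) auto
  also have "\<dots> = ennreal 8641 * ?E"
  proof -
    have "ennreal (20 * h ^ 3) * (ennreal (432 / h ^ 3) * ?E) = ennreal 8640 * ?E"
      using h by (simp add: mult.assoc[symmetric] ennreal_mult[symmetric])
    moreover have "?E + ennreal 8640 * ?E = (ennreal 1 + ennreal 8640) * ?E"
      unfolding distrib_right by simp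
    moreover have "ennreal 1 + ennreal 8640 = ennreal 8641"
      by (subst ennreal_plus[symmetric]) auto
    ultimately show ?thesis by metis
  qed
  finally have "ennreal (3 / (4 * h ^ 3)) * (ennreal (4 / 3 * h ^ 3) * ?Q) \<le> ennreal (3 / (4 * h ^ 3)) * (ennreal 8641 * ?E)"
    by (intro mult_left_mono) auto
  also have "ennreal (3 / (4 * h ^ 3)) * (ennreal (4 / 3 * h ^ 3) * ?Q) = ?Q"
    using h by (simp add: mult.assoc[symmetric] ennreal_mult[symmetric])
  also have "ennreal (3 / (4 * h ^ 3)) * (ennreal 8641 * ?E) = ennreal (3 / (4 * h ^ 3) * 8641) * ?E"
    using h by (subst ennreal_mult) (auto simp: mult.assoc)
  also have "\<dots> \<le> ennreal (6500 / h ^ 3) * ?E"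
    using h by (intro mult_right_mono ennreal_leI) (auto simp: field_simps)
  finally show ?thesis by auto
qed

end

section \<open>Transfer to general potentials\<close>

lemma standard_unimodal_rescaled:
  fixes V :: "real \<Rightarrow> real"
  assumes V: "strongly_convex m V" and m: "0 < m" and min: "\<And>x. V \<mu> \<le> V x"
    and a: "0 < a" "V (\<mu> + a) = V \<mu> + 16 \<or> V (\<mu> - a) = V \<mu> + 16"
      "V \<mu> + 16 \<le> V (\<mu> + a)" "V \<mu> + 16 \<le> V (\<mu> - a)"
  shows "standard_unimodal (\<lambda>x. exp (- V (\<mu> + a * x)))"
proof -
  define q where "q x = exp (- V (\<mu> + a * x))" for x
  have conv: "convex_on UNIV V" using strongly_convex_imp_convex_on[OF V] m by simp
  have [measurable]: "V \<in> borel_measurable borel"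
    using strongly_convex_continuous[OF V] m by (intro borel_measurable_continuous_onI) auto
  \<comment> \<open>On the side where the potential rises by exactly 16, convexity limits the rise
    over the first 1/16 of the way to 1. The density there is at least q(0) / e >= q(0) / 3, on a
    set of length 1/16; hence 48.\<close>
  have core: "ennreal (q 0) \<le> 48 * (\<integral>\<^sup>+x\<in>{-1..1}. ennreal (q x) \<partial>lborel)"
  proof -
    obtain e where e: "e = 1 \<or> e = -1" "V (\<mu> + e * a) = V \<mu> + 16"
      using a(2) by (cases "V (\<mu> + a) = V \<mu> + 16") (auto intro: that[of 1] that[of "-1"])
    define S where "S = (if e = 1 then {0..1/16} else {-1/16..0::real})"
    have S: "emeasure lborel S = ennreal (1/16)" "S \<subseteq> {-1..1}" "S \<in> sets lborel" by (auto simp: S_def)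
    have "q 0 / 3 \<le> q x" if "x \<in> S" for x
    proof -
      define t where "t = e * x"
      have t: "0 \<le> t" "t \<le> 1/16" "x = e * t" using that e(1) by (auto simp: S_def t_def)
      have "V ((1 - t) *\<^sub>R \<mu> + t *\<^sub>R (\<mu> + e * a)) \<le> (1 - t) * V \<mu> + t * V (\<mu> + e * a)"
        using t by (intro convex_onD[OF conv]) auto
      also have "(1 - t) *\<^sub>R \<mu> + t *\<^sub>R (\<mu> + e * a) = \<mu> + a * x" by (simp add: t(3) algebra_simps)
      also have "(1 - t) * V \<mu> + t * V (\<mu> + e * a) = V \<mu> + 16 * t" unfolding e(2) by (simp add: algebra_simps)
      finally have 1: "exp (- V \<mu> - 1) \<le> q x" using t by (simp add: q_def)
      have "exp (- V \<mu>) / 3 \<le> exp (- V \<mu> - 1)"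
        unfolding exp_diff using exp_le by (intro divide_left_mono) auto
      then have "exp (- V \<mu>) / 3 \<le> q x" using 1 by (rule order_trans)
      then show ?thesis by (simp add: q_def)
    qed
    then have "(\<integral>\<^sup>+x. ennreal (q 0 / 3) * indicator S x \<partial>lborel) \<le> (\<integral>\<^sup>+x\<in>{-1..1}. ennreal (q x) \<partial>lborel)"
      using S(2) by (intro nn_integral_mono) (auto simp: indicator_def intro!: ennreal_leI)
    then have "ennreal (q 0 / 3) * ennreal (1/16) \<le> (\<integral>\<^sup>+x\<in>{-1..1}. ennreal (q x) \<partial>lborel)"
      using S by (simp add: nn_integral_cmult_indicator)
    then have "ennreal 48 * (ennreal (q 0 / 3) * ennreal (1/16)) \<le> ennreal 48 * (\<integral>\<^sup>+x\<in>{-1..1}. ennreal (q x) \<partial>lborel)"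
      by (intro mult_left_mono) auto
    also have "ennreal 48 * (ennreal (q 0 / 3) * ennreal (1/16)) = ennreal (48 * (q 0 / 3 * (1 / 16)))"
      by (subst ennreal_mult, simp, simp add: q_def, subst ennreal_mult) (auto simp: q_def)
    finally show ?thesis by simp
  qed
  have "standard_unimodal q"
  proof
    show "q \<in> borel_measurable borel" unfolding q_def by measurable
    show "min (q x) (q y) \<le> q ((1 - t) * x + t * y)" if t: "0 \<le> t" "t \<le> 1" for t x y
    proof -
      have "V ((1 - t) *\<^sub>R (\<mu> + a * x) + t *\<^sub>R (\<mu> + a * y)) \<le> (1 - t) * V (\<mu> + a * x) + t * V (\<mu> + a * y)"
        using t by (intro convex_onD[OF conv]) auto
      also have "(1 - t) *\<^sub>R (\<mu> + a * x) + t *\<^sub>R (\<mu> + a * y) = \<mu> + a * ((1 - t) * x + t * y)"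
        by (simp add: algebra_simps)
      also have "(1 - t) * V (\<mu> + a * x) + t * V (\<mu> + a * y)
          \<le> (1 - t) * max (V (\<mu> + a * x)) (V (\<mu> + a * y)) + t * max (V (\<mu> + a * x)) (V (\<mu> + a * y))"
        using t by (intro add_mono mult_left_mono) auto
      finally have "V (\<mu> + a * ((1 - t) * x + t * y)) \<le> max (V (\<mu> + a * x)) (V (\<mu> + a * y))"
        by (simp add: algebra_simps)
      then show ?thesis by (auto simp: q_def max_def split: if_splits)
    qed
    show "q (x + u) \<le> q x * exp (- (16 * u))" if "1 \<le> x" "0 \<le> u" for x u
      using convex_slope_beyond[OF conv a(1), of \<mu> 16 1 "a * x" "a * u"] a that
      by (simp add: q_def exp_add[symmetric] algebra_simps)
    show "q (- (x + u)) \<le> q (- x) * exp (- (16 * u))" if "1 \<le> x" "0 \<le> u" for x u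
      using convex_slope_beyond[OF conv a(1), of \<mu> 16 "-1" "a * x" "a * u"] a that
      by (simp add: q_def exp_add[symmetric] algebra_simps)
    show "(\<integral>\<^sup>+x. ennreal (q x) \<partial>lborel) < \<infinity>"
      using lborel_integrable_real_affine[OF strongly_convex_integrable[OF V m], of a \<mu>] a(1)
      by (simp add: q_def integrable_iff_bounded)
  qed (use core min in \<open>auto simp: q_def\<close>)
  then show ?thesis unfolding q_def[abs_def] .
qed

lemma box_form_rescale:
  assumes [measurable]: "q \<in> borel_measurable borel" "g \<in> borel_measurable borel" and a: "0 < a"
  shows "box_form q h g = ennreal (a\<^sup>2) * box_form (\<lambda>x. q (\<mu> + a * x)) (h / a) (\<lambda>x. g (\<mu> + a * x))"
proof -
  let ?F = "\<lambda>x u. ennreal (min (q x) (q (x + u)) * (g x - g (x + u))\<^sup>2)"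
  have in1: "(\<integral>\<^sup>+x. ?F x (a * u) \<partial>lborel) = ennreal a * (\<integral>\<^sup>+x. ?F (\<mu> + a * x) (a * u) \<partial>lborel)" for u
    using a by (subst nn_integral_real_affine[where c=a and t=\<mu>]) auto
  have [measurable]: "(\<lambda>u. \<integral>\<^sup>+x. ?F x u \<partial>lborel) \<in> borel_measurable borel" by measurable
  have "box_form q h g = ennreal a * (\<integral>\<^sup>+u. (\<integral>\<^sup>+x. ?F x (0 + a * u) \<partial>lborel) * indicator {-h..h} (0 + a * u) \<partial>lborel)"
    unfolding box_form_def using a by (subst nn_integral_real_affine[where c=a and t=0]) auto
  also have "(\<integral>\<^sup>+u. (\<integral>\<^sup>+x. ?F x (0 + a * u) \<partial>lborel) * indicator {-h..h} (0 + a * u) \<partial>lborel)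
     = (\<integral>\<^sup>+u. ennreal a * ((\<integral>\<^sup>+x. ?F (\<mu> + a * x) (a * u) \<partial>lborel) * indicator {-(h / a)..h / a} u) \<partial>lborel)"
  proof (rule nn_integral_cong)
    fix u
    have "indicator {-h..h} (0 + a * u) = (indicator {-(h / a)..h / a} u :: ennreal)"
      using a by (auto simp: indicator_def field_simps)
    then show "(\<integral>\<^sup>+x. ?F x (0 + a * u) \<partial>lborel) * indicator {-h..h} (0 + a * u)
        = ennreal a * ((\<integral>\<^sup>+x. ?F (\<mu> + a * x) (a * u) \<partial>lborel) * indicator {-(h / a)..h / a} u)"
      by (simp only: in1 add_0 mult.assoc)
  qed
  also have "\<dots> = ennreal a * (\<integral>\<^sup>+u\<in>{-(h / a)..h / a}. (\<integral>\<^sup>+x. ?F (\<mu> + a * x) (a * u) \<partial>lborel) \<partial>lborel)"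
    by (rule nn_integral_cmult) measurable
  also have "(\<integral>\<^sup>+u\<in>{-(h / a)..h / a}. (\<integral>\<^sup>+x. ?F (\<mu> + a * x) (a * u) \<partial>lborel) \<partial>lborel)
      = box_form (\<lambda>x. q (\<mu> + a * x)) (h / a) (\<lambda>x. g (\<mu> + a * x))"
    unfolding box_form_def by (simp add: algebra_simps)
  finally show ?thesis using a
    by (simp add: power2_eq_square ennreal_mult mult.assoc)
qed

text \<open>The diffusive factor (a / h)^2 is multiplied by 1 / h because the displacement measure
  of \<open>box_form\<close> has mass 2 h instead of 1. The centring constant \<open>c\<close> is
  left free; replacing it by the mean only lowers the left side.\<close>

definition poincare_scale :: "(real \<Rightarrow> real) \<Rightarrow> real \<Rightarrow> bool" where
  "poincare_scale q a \<longleftrightarrow> (\<forall>h g. 0 < h \<longrightarrow> h \<le> a / 16 \<longrightarrow> g \<in> borel_measurable borel \<longrightarrow>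
     (\<integral>\<^sup>+x. ennreal (q x * (g x)\<^sup>2) \<partial>lborel) < \<infinity> \<longrightarrow>
     (\<exists>c. (\<integral>\<^sup>+x. ennreal (q x * (g x - c)\<^sup>2) \<partial>lborel) \<le> ennreal (6500 * a\<^sup>2 / h ^ 3) * box_form q h g))"

lemma poincare_scaleD:
  assumes "poincare_scale q a" "0 < h" "h \<le> a / 16" "g \<in> borel_measurable borel"
    "(\<integral>\<^sup>+x. ennreal (q x * (g x)\<^sup>2) \<partial>lborel) < \<infinity>"
  obtains c where "(\<integral>\<^sup>+x. ennreal (q x * (g x - c)\<^sup>2) \<partial>lborel) \<le> ennreal (6500 * a\<^sup>2 / h ^ 3) * box_form q h g"
  using assms unfolding poincare_scale_def by blast

text \<open>An affine change of variables sends the mode to 0 and \<open>a\<close> to 1. The two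
  bounds on \<open>a\<close> matter as much as the inequality itself: they confine the width to the
  range covered by the proposal scales.\<close>

theorem box_poincare:
  fixes V :: "real \<Rightarrow> real"
  assumes V: "strongly_convex m V" and L: "midpoint_smooth L V" and m: "0 < m"
  obtains a where "0 < a" "16 \<le> L * a\<^sup>2" "m * a\<^sup>2 \<le> 64" "poincare_scale (\<lambda>x. exp (- V x)) a"
proof -
  obtain \<mu> where min: "\<And>x. V \<mu> \<le> V x" using strongly_convex_has_minimum[OF V m] by blast
  obtain a where a: "0 < a" "16 \<le> L * a\<^sup>2" "m * a\<^sup>2 \<le> 64"
    "V (\<mu> + a) = V \<mu> + 16 \<or> V (\<mu> - a) = V \<mu> + 16"
    "V \<mu> + 16 \<le> V (\<mu> + a)" "V \<mu> + 16 \<le> V (\<mu> - a)"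
    using convex_scale_exists[OF V L m min] by blast
  interpret standard_unimodal "\<lambda>x. exp (- V (\<mu> + a * x))"
    by (rule standard_unimodal_rescaled[OF V m min a(1,4,5,6)])
  have [measurable]: "V \<in> borel_measurable borel"
    using strongly_convex_continuous[OF V] m by (intro borel_measurable_continuous_onI) auto
  show thesis
  proof (rule that[OF a(1-3)], unfold poincare_scale_def, intro allI impI)
    fix h :: real and g :: "real \<Rightarrow> real"
    assume h: "0 < h" "h \<le> a / 16" and [measurable]: "g \<in> borel_measurable borel"
      and fin: "(\<integral>\<^sup>+x. ennreal (exp (- V x) * (g x)\<^sup>2) \<partial>lborel) < \<infinity>"
    have aff: "(\<integral>\<^sup>+x. f x \<partial>lborel) = ennreal a * (\<integral>\<^sup>+x. f (\<mu> + a * x) \<partial>lborel)"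
      if "f \<in> borel_measurable borel" for f :: "real \<Rightarrow> ennreal"
      using a(1) that by (subst nn_integral_real_affine[where c=a and t=\<mu>]) auto
    let ?G = "\<lambda>x. g (\<mu> + a * x)" and ?Q = "\<lambda>x. exp (- V (\<mu> + a * x))"
    have "(\<integral>\<^sup>+x. ennreal (?Q x * (?G x)\<^sup>2) \<partial>lborel) < \<infinity>"
      using fin a(1) by (subst (asm) aff) (auto simp: ennreal_mult_less_top)
    then obtain c where c: "(\<integral>\<^sup>+x. ennreal (?Q x * (?G x - c)\<^sup>2) \<partial>lborel)
        \<le> ennreal (6500 / (h / a) ^ 3) * box_form ?Q (h / a) ?G"
      using box_poincare_standard[of ?G "h / a"] h a(1) by (auto simp: field_simps)
    have "(\<integral>\<^sup>+x. ennreal (exp (- V x) * (g x - c)\<^sup>2) \<partial>lborel)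
        = ennreal a * (\<integral>\<^sup>+x. ennreal (?Q x * (?G x - c)\<^sup>2) \<partial>lborel)"
      by (rule aff) measurable
    also have "\<dots> \<le> ennreal a * (ennreal (6500 / (h / a) ^ 3) * box_form ?Q (h / a) ?G)"
      using c by (intro mult_left_mono) auto
    also have "\<dots> = ennreal (6500 * a\<^sup>2 / h ^ 3) * (ennreal (a\<^sup>2) * box_form ?Q (h / a) ?G)"
    proof -
      have "a * (6500 / (h / a) ^ 3) = 6500 * a\<^sup>2 / h ^ 3 * a\<^sup>2"
        by (simp add: power_divide power2_eq_square power3_eq_cube)
      then have "ennreal a * ennreal (6500 / (h / a) ^ 3) = ennreal (6500 * a\<^sup>2 / h ^ 3) * ennreal (a\<^sup>2)"
        using a(1) h by (simp add: ennreal_mult[symmetric])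
      then show ?thesis by (simp only: mult.assoc[symmetric])
    qed
    also have "ennreal (a\<^sup>2) * box_form ?Q (h / a) ?G = box_form (\<lambda>x. exp (- V x)) h g"
      by (rule box_form_rescale[symmetric]) (use a(1) in auto)
    finally show "\<exists>c. (\<integral>\<^sup>+x. ennreal (exp (- V x) * (g x - c)\<^sup>2) \<partial>lborel)
         \<le> ennreal (6500 * a\<^sup>2 / h ^ 3) * box_form (\<lambda>x. exp (- V x)) h g" by blast
  qed
qed

subsection \<open>Marginals of strongly log-concave densities\<close>

lemma strongly_convex_integral_pos:
  fixes V :: "real \<Rightarrow> real"
  assumes "strongly_convex m V" "0 < m"
  shows "0 < (\<integral>z. exp (- V z) \<partial>lborel)"
proof -
  have int: "integrable lborel (\<lambda>z. exp (- V z))" by (rule strongly_convex_integrable[OF assms])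
  have "(\<integral>z. exp (- V z) \<partial>lborel) \<noteq> 0"
  proof
    assume "(\<integral>z. exp (- V z) \<partial>lborel) = 0"
    then have "AE z in lborel. (z::real) \<noteq> z" using int by (subst (asm) integral_nonneg_eq_0_iff_AE) auto
    then obtain N :: "real set" where "{x \<in> space lborel. \<not> x \<noteq> x} \<subseteq> N" "emeasure lborel N = 0" "N \<in> sets lborel"
      by (rule AE_E)
    then have "emeasure lborel (UNIV :: real set) = 0" by (simp add: top.extremum_unique)
    then show False by simp
  qed
  then show ?thesis by (simp add: less_le)
qed

section \<open>Intervals and the one-dimensional Prekopa-Leindler inequality\<close>

lemma interval_affine_mem:
  fixes S :: "real set"
  assumes S: "is_interval S" "S \<noteq> {}" "bdd_above S" "bdd_below S" and r: "0 < r" "r < 1"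
  shows "Inf S + r * (Sup S - Inf S) \<in> S"
proof (cases "Inf S < Sup S")
  case True
  let ?s = "Inf S + r * (Sup S - Inf S)"
  have "Inf S < ?s" using True r by simp
  then obtain x where x: "x \<in> S" "x < ?s" using cInf_lessD[OF S(2), of ?s] by blast
  have "r * (Sup S - Inf S) < 1 * (Sup S - Inf S)" using True r by (intro mult_strict_right_mono) auto
  then have "?s < Sup S" by simp
  then obtain y where y: "y \<in> S" "?s < y" using less_cSupD[OF S(2), of ?s] by blast
  show ?thesis using mem_is_interval_1_I[OF S(1) x(1) y(1)] x y by simp
next
  case False
  obtain x where x: "x \<in> S" using S(2) by auto
  have "Inf S \<le> x" "x \<le> Sup S" using x S by (auto intro: cInf_lower cSup_upper)
  then have "Inf S = x" "Sup S = x" using False by auto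
  then show ?thesis using x by simp
qed

lemma emeasure_interval_le:
  fixes S :: "real set"
  assumes S: "S \<noteq> {}" "bdd_above S" "bdd_below S"
  shows "emeasure lborel S \<le> ennreal (Sup S - Inf S)"
proof -
  have le: "Inf S \<le> Sup S" using S by (meson cInf_le_cSup)
  have "S \<subseteq> {Inf S..Sup S}" using S by (auto intro: cInf_lower cSup_upper)
  then have "emeasure lborel S \<le> emeasure lborel {Inf S..Sup S}" by (intro emeasure_mono) auto
  then show ?thesis using le by simp
qed

text \<open>Points at the same relative position \<open>r\<close> in both intervals combine to the
  point at position \<open>r\<close> between the combined endpoints. Restricting to 0 < r < 1 avoids
  the question which endpoints belong to the sets.\<close>

lemma emeasure_interval_combination:
  fixes A B C :: "real set"
  assumes A: "is_interval A" "A \<noteq> {}" "bdd_above A" "bdd_below A"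
    and B: "is_interval B" "B \<noteq> {}" "bdd_above B" "bdd_below B"
    and t: "0 \<le> t" "t \<le> 1" and C: "C \<in> sets lborel"
    and comb: "\<And>x y. x \<in> A \<Longrightarrow> y \<in> B \<Longrightarrow> (1 - t) * x + t * y \<in> C"
  shows "ennreal (1 - t) * emeasure lborel A + ennreal t * emeasure lborel B \<le> emeasure lborel C"
proof -
  have le: "Inf A \<le> Sup A" "Inf B \<le> Sup B" using A B by (meson cInf_le_cSup)+
  define l u where "l = (1 - t) * Inf A + t * Inf B" and "u = (1 - t) * Sup A + t * Sup B"
  have lu: "u - l = (1 - t) * (Sup A - Inf A) + t * (Sup B - Inf B)" by (simp add: l_def u_def algebra_simps)
  have lu0: "l \<le> u" using t le by (auto simp: l_def u_def intro!: add_mono mult_left_mono)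
  have sub: "{l<..<u} \<subseteq> C"
  proof
    fix w assume w: "w \<in> {l<..<u}"
    define r where "r = (w - l) / (u - l)"
    have r: "0 < r" "r < 1" "w = l + r * (u - l)" using w by (auto simp: r_def field_simps)
    have "w = (1 - t) * (Inf A + r * (Sup A - Inf A)) + t * (Inf B + r * (Sup B - Inf B))"
      unfolding r(3) lu by (simp add: l_def algebra_simps)
    then show "w \<in> C" using comb[OF interval_affine_mem[OF A r(1,2)] interval_affine_mem[OF B r(1,2)]] by simp
  qed
  have "ennreal (1 - t) * emeasure lborel A + ennreal t * emeasure lborel B
      \<le> ennreal (1 - t) * ennreal (Sup A - Inf A) + ennreal t * ennreal (Sup B - Inf B)"
    using A B by (intro add_mono mult_left_mono emeasure_interval_le) auto
  also have "\<dots> = ennreal (u - l)" unfolding lu using t le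
    by (simp add: ennreal_mult ennreal_plus)
  also have "\<dots> = emeasure lborel {l<..<u}" using lu0 by simp
  also have "\<dots> \<le> emeasure lborel C" using sub C by (intro emeasure_mono)
  finally show ?thesis .
qed

lemma layer_cake:
  fixes f :: "real \<Rightarrow> real"
  assumes [measurable]: "f \<in> borel_measurable borel" and pos: "\<And>x. 0 \<le> f x"
  shows "(\<integral>\<^sup>+x. ennreal (f x) \<partial>lborel) = (\<integral>\<^sup>+t\<in>{0<..}. emeasure lborel {x. t < f x} \<partial>lborel)"
proof -
  have "ennreal (f x) = (\<integral>\<^sup>+t. indicator {0<..<f x} t \<partial>lborel)" for x using pos[of x] by simp
  then have "(\<integral>\<^sup>+x. ennreal (f x) \<partial>lborel) = (\<integral>\<^sup>+x. (\<integral>\<^sup>+t. indicator {0<..<f x} t \<partial>lborel) \<partial>lborel)" by simp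
  also have "\<dots> = (\<integral>\<^sup>+x. (\<integral>\<^sup>+t. (if 0 < t \<and> t < f x then 1 else 0) \<partial>lborel) \<partial>lborel)"
    by (intro nn_integral_cong) (auto simp: indicator_def)
  also have "\<dots> = (\<integral>\<^sup>+t. (\<integral>\<^sup>+x. (if 0 < t \<and> t < f x then 1 else 0) \<partial>lborel) \<partial>lborel)"
    by (rule lborel_pair.Fubini') measurable
  also have "\<dots> = (\<integral>\<^sup>+t. (\<integral>\<^sup>+x. indicator {0<..} t * indicator {x. t < f x} x \<partial>lborel) \<partial>lborel)"
    by (intro nn_integral_cong) (auto simp: indicator_def)
  also have "\<dots> = (\<integral>\<^sup>+t\<in>{0<..}. emeasure lborel {x. t < f x} \<partial>lborel)"
    by (subst nn_integral_cmult) (auto simp: mult.commute)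
  finally show ?thesis .
qed

text \<open>After both functions are normalised to have maximum 1, their superlevel sets are nonempty intervals, for
  which the Brunn--Minkowski inequality is elementary.\<close>

lemma prekopa_leindler:
  fixes A B H :: "real \<Rightarrow> real"
  assumes A: "strongly_convex m A" and B: "strongly_convex m B" and H: "strongly_convex m H" and m: "0 < m"
    and t: "0 \<le> t" "t \<le> 1"
    and comb: "\<And>x y. H ((1 - t) * x + t * y) + E \<le> (1 - t) * A x + t * B y"
  shows "E + (1 - t) * ln (\<integral>x. exp (- A x) \<partial>lborel) + t * ln (\<integral>x. exp (- B x) \<partial>lborel)
    \<le> ln (\<integral>x. exp (- H x) \<partial>lborel)"
proof -
  have meas: "V \<in> borel_measurable borel" if "strongly_convex m V" for V :: "real \<Rightarrow> real"
    using strongly_convex_continuous[OF that] m by (intro borel_measurable_continuous_onI) auto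
  have [measurable]: "A \<in> borel_measurable borel" "B \<in> borel_measurable borel" "H \<in> borel_measurable borel"
    using meas A B H by auto
  obtain x0 where x0: "\<And>x. A x0 \<le> A x" using strongly_convex_has_minimum[OF A m] by blast
  obtain y0 where y0: "\<And>x. B y0 \<le> B x" using strongly_convex_has_minimum[OF B m] by blast
  \<comment> \<open>The normalising level for \<open>H\<close>: with it, convex combinations of
    points from the s-level sets of the normalised \<open>A\<close> and \<open>B\<close> fall into
    the s-level set for \<open>H\<close>.\<close>
  define \<gamma> where "\<gamma> = (1 - t) * A x0 + t * B y0 - E"
  have level: "is_interval {x. s < exp (v - V x)}" "{x. s < exp (v - V x)} \<noteq> {}"
     "bdd_above {x. s < exp (v - V x)}" "bdd_below {x. s < exp (v - V x)}"
    if V: "strongly_convex m V" "\<And>x. V \<mu> \<le> V x" "v = V \<mu>" and s: "0 < s" "s < 1" for V :: "real \<Rightarrow> real" and v \<mu> s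
  proof -
    have eq: "{x. s < exp (v - V x)} = {x. V x < V \<mu> - ln s}"
    proof -
      have "s < exp (v - V x) \<longleftrightarrow> ln s < v - V x" for x
        using s by (metis exp_less_cancel_iff exp_ln)
      then have "s < exp (v - V x) \<longleftrightarrow> V x < V \<mu> - ln s" for x
        unfolding V(3) by (simp add: less_diff_eq add.commute)
      then show ?thesis by simp
    qed
    have conv: "convex_on UNIV V" using strongly_convex_imp_convex_on[OF V(1)] m by simp
    have "convex {x. V x < V \<mu> - ln s}"
      unfolding convex_alt
    proof (intro ballI allI impI)
      fix x y u assume xy: "x \<in> {x. V x < V \<mu> - ln s}" "y \<in> {x. V x < V \<mu> - ln s}" and u: "0 \<le> u \<and> u \<le> (1::real)"
      have "V ((1 - u) *\<^sub>R x + u *\<^sub>R y) \<le> (1 - u) * V x + u * V y"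
        using u by (intro convex_onD[OF conv]) auto
      also have "\<dots> \<le> (1 - u) * max (V x) (V y) + u * max (V x) (V y)"
        using u by (intro add_mono mult_left_mono) auto
      also have "\<dots> = max (V x) (V y)" by (simp add: algebra_simps)
      finally show "(1 - u) *\<^sub>R x + u *\<^sub>R y \<in> {x. V x < V \<mu> - ln s}" using xy by auto
    qed
    then show "is_interval {x. s < exp (v - V x)}" unfolding eq by (simp add: is_interval_convex_1)
    have "ln s < 0" using s by simp
    then show "{x. s < exp (v - V x)} \<noteq> {}" unfolding eq by (auto intro: exI[of _ \<mu>])
    have "\<bar>x - \<mu>\<bar> \<le> sqrt (- ln s * 4 / m)" if "V x < V \<mu> - ln s" for x
    proof -
      have "(x - \<mu>)\<^sup>2 \<le> - ln s * 4 / m"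
        using strongly_convex_quadratic_growth[OF V(1,2), of x] that m by (simp add: field_simps)
      then show ?thesis by (metis real_sqrt_abs real_sqrt_le_iff)
    qed
    then have bd: "\<mu> - sqrt (- ln s * 4 / m) \<le> x \<and> x \<le> \<mu> + sqrt (- ln s * 4 / m)" if "V x < V \<mu> - ln s" for x
      using that unfolding abs_le_iff by (metis add.commute diff_le_eq minus_diff_eq)
    show "bdd_above {x. s < exp (v - V x)}"
      unfolding eq using bd by (intro bdd_aboveI[of _ "\<mu> + sqrt (- ln s * 4 / m)"]) auto
    show "bdd_below {x. s < exp (v - V x)}"
      unfolding eq using bd by (intro bdd_belowI[of _ "\<mu> - sqrt (- ln s * 4 / m)"]) auto
  qed
  \<comment> \<open>From level 1 on, the normalised superlevel sets of \<open>A\<close> and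
    \<open>B\<close> are empty, so intervals need comparing only for 0 < s < 1.\<close>
  have less1: "emeasure lborel {x. s < exp (v - V x)} = 0" if "\<And>x. v \<le> V x" "1 \<le> s" for s v and V :: "real \<Rightarrow> real"
  proof -
    have le: "exp (v - V x) \<le> 1" for x using that(1)[of x] by simp
    have "\<not> s < exp (v - V x)" for x using le[of x] that(2) by linarith
    then have "{x. s < exp (v - V x)} = {}" by simp
    then show ?thesis by simp
  qed
  let ?N = "\<lambda>V v. \<integral>\<^sup>+x. ennreal (exp (v - V x)) \<partial>lborel"
  let ?mu = "\<lambda>V v s. emeasure lborel {x. s < exp (v - V x)}"
  have cake: "?N V v = (\<integral>\<^sup>+s\<in>{0<..}. ?mu V v s \<partial>lborel)" if "V \<in> borel_measurable borel" for V :: "real \<Rightarrow> real" and v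
    using that by (intro layer_cake) auto
  have mm: "(\<lambda>s. ?mu V v s) \<in> borel_measurable borel" if [measurable]: "V \<in> borel_measurable borel" for V :: "real \<Rightarrow> real" and v
    by measurable
  have [measurable]: "(\<lambda>s. ?mu A (A x0) s) \<in> borel_measurable borel" "(\<lambda>s. ?mu B (B y0) s) \<in> borel_measurable borel"
    by (rule mm; measurable)+
  have "ennreal (1 - t) * ?N A (A x0) + ennreal t * ?N B (B y0)
     = (\<integral>\<^sup>+s. ennreal (1 - t) * (?mu A (A x0) s * indicator {0<..} s) + ennreal t * (?mu B (B y0) s * indicator {0<..} s) \<partial>lborel)"
    by (simp add: cake nn_integral_add nn_integral_cmult)
  also have "\<dots> \<le> (\<integral>\<^sup>+s\<in>{0<..}. ?mu H \<gamma> s \<partial>lborel)"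
  proof (intro nn_integral_mono)
    fix s :: real
    consider "s \<le> 0" | "1 \<le> s" | "0 < s" "s < 1" by linarith
    then show "ennreal (1 - t) * (?mu A (A x0) s * indicator {0<..} s) + ennreal t * (?mu B (B y0) s * indicator {0<..} s)
        \<le> ?mu H \<gamma> s * indicator {0<..} s"
    proof cases
      case 3
      then have lnl: "s < exp y \<longleftrightarrow> ln s < y" for y by (metis exp_less_cancel_iff exp_ln)
      have "ennreal (1 - t) * ?mu A (A x0) s + ennreal t * ?mu B (B y0) s \<le> ?mu H \<gamma> s"
      proof (rule emeasure_interval_combination[OF level[OF A x0 refl 3] level[OF B y0 refl 3] t])
        fix x y assume "x \<in> {x. s < exp (A x0 - A x)}" "y \<in> {x. s < exp (B y0 - B x)}"
        then have "ln s < A x0 - A x" "ln s < B y0 - B y"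
          by (auto simp: lnl)
        then have "(1 - t) * ln s + t * ln s < (1 - t) * (A x0 - A x) + t * (B y0 - B y)"
          using t by (cases "t = 0"; cases "t = 1"; simp) (intro add_strict_mono mult_strict_left_mono; simp)
        then have "ln s < (1 - t) * (A x0 - A x) + t * (B y0 - B y)" by (simp add: algebra_simps)
        also have "\<dots> \<le> \<gamma> - H ((1 - t) * x + t * y)" using comb[of x y] by (simp add: \<gamma>_def algebra_simps)
        finally show "(1 - t) * x + t * y \<in> {x. s < exp (\<gamma> - H x)}"
          by (simp add: lnl)
      qed measurable
      then show ?thesis using 3 by simp
    qed (use less1[OF x0] less1[OF y0] in auto)
  qed
  also have "\<dots> = ?N H \<gamma>" by (simp add: cake)
  finally have main: "ennreal (1 - t) * ?N A (A x0) + ennreal t * ?N B (B y0) \<le> ?N H \<gamma>" .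
  define Z where "Z V = (\<integral>x. exp (- V x) \<partial>lborel)" for V :: "real \<Rightarrow> real"
  have Z: "?N V v = ennreal (exp v * Z V)" "0 < Z V" if V: "strongly_convex m V" for V v
  proof -
    note [measurable] = meas[OF V]
    have int: "integrable lborel (\<lambda>x. exp (- V x))" by (rule strongly_convex_integrable[OF V m])
    have "?N V v = (\<integral>\<^sup>+x. ennreal (exp v) * ennreal (exp (- V x)) \<partial>lborel)"
      by (simp add: ennreal_mult[symmetric] exp_add[symmetric])
    also have "\<dots> = ennreal (exp v) * (\<integral>\<^sup>+x. ennreal (exp (- V x)) \<partial>lborel)" by (rule nn_integral_cmult) measurable
    also have "(\<integral>\<^sup>+x. ennreal (exp (- V x)) \<partial>lborel) = ennreal (Z V)"
      unfolding Z_def by (rule nn_integral_eq_integral[OF int]) auto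
    finally show "?N V v = ennreal (exp v * Z V)" by (simp add: ennreal_mult Z_def)
    show "0 < Z V" unfolding Z_def by (rule strongly_convex_integral_pos[OF V m])
  qed
  have "ennreal ((1 - t) * (exp (A x0) * Z A) + t * (exp (B y0) * Z B)) \<le> ennreal (exp \<gamma> * Z H)"
    using main t Z(2)[OF A] Z(2)[OF B] unfolding Z(1)[OF A] Z(1)[OF B] Z(1)[OF H]
    by (simp add: ennreal_mult[symmetric] ennreal_plus[symmetric] del: ennreal_plus)
  then have le: "(1 - t) * (exp (A x0) * Z A) + t * (exp (B y0) * Z B) \<le> exp \<gamma> * Z H"
    using Z(2)[OF H] by (subst (asm) ennreal_le_iff) auto
  have pos: "0 < exp (A x0) * Z A" "0 < exp (B y0) * Z B" using Z(2)[OF A] Z(2)[OF B] by auto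
  \<comment> \<open>Normalisation produced an inequality with the arithmetic mean, stronger than
    needed; concavity of the logarithm passes to the geometric mean.\<close>
  have "(1 - t) * ln (exp (A x0) * Z A) + t * ln (exp (B y0) * Z B)
      \<le> ln ((1 - t) *\<^sub>R (exp (A x0) * Z A) + t *\<^sub>R (exp (B y0) * Z B))"
    using concave_onD[OF ln_concave, of t "exp (A x0) * Z A" "exp (B y0) * Z B"] t pos by auto
  also have "\<dots> \<le> ln (exp \<gamma> * Z H)"
  proof -
    have "0 < (1 - t) * (exp (A x0) * Z A) + t * (exp (B y0) * Z B)"
      using t pos by (cases "t = 0") (auto intro: add_nonneg_pos)
    then show ?thesis using le by simp
  qed
  finally show ?thesis
    using Z(2)[OF A] Z(2)[OF B] Z(2)[OF H]
    by (simp add: ln_mult \<gamma>_def Z_def[symmetric] algebra_simps)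
qed

definition marginal_potential :: "(real \<times> real \<Rightarrow> real) \<Rightarrow> real \<Rightarrow> real" where
  "marginal_potential U x = - ln (\<integral>z. exp (- U (x, z)) \<partial>lborel)"

lemma exp_marginal_potential:
  assumes "strongly_convex m U" "0 < m"
  shows "exp (- marginal_potential U x) = (\<integral>z. exp (- U (x, z)) \<partial>lborel)"
  using strongly_convex_integral_pos[OF strongly_convex_slices(2)[OF assms(1)] assms(2)]
  by (simp add: marginal_potential_def)

text \<open>Of the strong convexity of \<open>U\<close>, the part in the retained coordinate becomes
  the constant \<open>E\<close> of Prekopa-Leindler, and the part in the integrated coordinate is
  dropped.\<close>

lemma strongly_convex_marginal:
  assumes U: "strongly_convex m U" and m: "0 < m"
  shows "strongly_convex m (marginal_potential U)"
  unfolding strongly_convex_def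
proof (intro allI impI)
  fix x y t :: real assume t: "0 \<le> t" "t \<le> 1"
  let ?xy = "(1 - t) *\<^sub>R x + t *\<^sub>R y"
  have "m / 2 * (t * (1 - t)) * (x - y)\<^sup>2 + (1 - t) * ln (\<integral>z. exp (- U (x, z)) \<partial>lborel)
      + t * ln (\<integral>z. exp (- U (y, z)) \<partial>lborel) \<le> ln (\<integral>z. exp (- U (?xy, z)) \<partial>lborel)"
  proof (rule prekopa_leindler[OF strongly_convex_slices(2)[OF U] strongly_convex_slices(2)[OF U]
        strongly_convex_slices(2)[OF U] m t])
    fix v w :: real
    have "0 \<le> m / 2 * (t * (1 - t)) * (v - w)\<^sup>2" using m t by simp
    moreover have "(norm ((x, v) - (y, w)))\<^sup>2 = (x - y)\<^sup>2 + (v - w)\<^sup>2" by (simp add: norm_prod_def)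
    ultimately show "U (?xy, (1 - t) * v + t * w) + m / 2 * (t * (1 - t)) * (x - y)\<^sup>2 \<le> (1 - t) * U (x, v) + t * U (y, w)"
      using strongly_convexD[OF U t, of "(x, v)" "(y, w)"] by (simp add: distrib_left)
  qed
  then show "marginal_potential U ?xy + m / 2 * (t * (1 - t)) * (norm (x - y))\<^sup>2
      \<le> (1 - t) * marginal_potential U x + t * marginal_potential U y"
    by (simp add: marginal_potential_def)
qed

lemma geometric_mean_ge_midpoint:
  assumes L: "midpoint_smooth L U"
  shows "exp (- U ((x + y) / 2, z)) * exp (- (L / 8 * (x - y)\<^sup>2)) \<le> sqrt (exp (- U (x, z)) * exp (- U (y, z)))"
proof -
  have "(1/2) *\<^sub>R (x, z) + (1/2) *\<^sub>R (y, z) = ((x + y) / 2, z)" by (simp add: scaleR_left.add[symmetric] add_divide_distrib)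
  then have "U (x, z) + U (y, z) \<le> 2 * U ((x + y) / 2, z) + L / 4 * (x - y)\<^sup>2"
    using L[unfolded midpoint_smooth_def, rule_format, of "(x, z)" "(y, z)"]
    by (simp add: norm_prod_def add_divide_distrib)
  then have "- U ((x + y) / 2, z) - L / 8 * (x - y)\<^sup>2 \<le> (- U (x, z) - U (y, z)) / 2"
    by (simp add: field_simps)
  then have "exp (- U ((x + y) / 2, z) - L / 8 * (x - y)\<^sup>2) \<le> exp ((- U (x, z) - U (y, z)) / 2)" by simp
  also have "\<dots> = sqrt (exp (- U (x, z)) * exp (- U (y, z)))"
    by (rule real_sqrt_unique[symmetric]) (simp_all add: power2_eq_square exp_add[symmetric])
  finally show ?thesis by (simp add: exp_add[symmetric])
qed

lemma nn_integral_geometric_mean: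
  fixes f g :: "real \<Rightarrow> real"
  assumes f: "integrable lborel f" "\<And>x. 0 \<le> f x" and g: "integrable lborel g" "\<And>x. 0 \<le> g x"
  shows "(\<integral>\<^sup>+x. ennreal (sqrt (f x * g x)) \<partial>lborel)\<^sup>2 \<le> ennreal ((\<integral>x. f x \<partial>lborel) * (\<integral>x. g x \<partial>lborel))"
proof -
  have [measurable]: "f \<in> borel_measurable borel" "g \<in> borel_measurable borel" using f g by auto
  have "(\<integral>\<^sup>+x. ennreal (sqrt (f x * g x)) \<partial>lborel) = (\<integral>\<^sup>+x. ennreal (sqrt (f x)) * ennreal (sqrt (g x)) \<partial>lborel)"
    using f g by (simp add: ennreal_mult[symmetric] real_sqrt_mult)
  also have "\<dots>\<^sup>2 \<le> (\<integral>\<^sup>+x. ennreal (sqrt (f x)) ^ 2 \<partial>lborel) * (\<integral>\<^sup>+x. ennreal (sqrt (g x)) ^ 2 \<partial>lborel)"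
    by (rule Cauchy_Schwarz_nn_integral) auto
  also have "\<dots> = (\<integral>\<^sup>+x. ennreal (f x) \<partial>lborel) * (\<integral>\<^sup>+x. ennreal (g x) \<partial>lborel)"
    using f g by (simp add: ennreal_power)
  also have "\<dots> = ennreal ((\<integral>x. f x \<partial>lborel) * (\<integral>x. g x \<partial>lborel))"
    using f g by (simp add: nn_integral_eq_integral ennreal_mult)
  finally show ?thesis .
qed

lemma nn_integral_slice:
  assumes "strongly_convex m U" "0 < m"
  shows "(\<integral>\<^sup>+z. ennreal (exp (- U (x, z))) \<partial>lborel) = ennreal (exp (- marginal_potential U x))"
  unfolding exp_marginal_potential[OF assms]
  using strongly_convex_integrable[OF strongly_convex_slices(2)[OF assms(1)] assms(2)]
  by (intro nn_integral_eq_integral) auto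

text \<open>The right side is the unnormalised Hellinger affinity of the two slices. This bound
  serves both the smoothness of the marginal and the overlap of nearby conditional
  densities.\<close>

lemma midpoint_le_geometric_mean_integral:
  assumes U: "strongly_convex m U" and m: "0 < m" and L: "midpoint_smooth L U"
  shows "ennreal (exp (- marginal_potential U ((x + y) / 2) - L / 8 * (x - y)\<^sup>2))
     \<le> (\<integral>\<^sup>+z. ennreal (sqrt (exp (- U (x, z)) * exp (- U (y, z)))) \<partial>lborel)"
proof -
  have [measurable]: "(\<lambda>z. U (w, z)) \<in> borel_measurable borel" for w
    using strongly_convex_continuous[OF strongly_convex_slices(2)[OF U]] m
    by (intro borel_measurable_continuous_onI) auto
  have "ennreal (exp (- marginal_potential U ((x + y) / 2) - L / 8 * (x - y)\<^sup>2))
     = (\<integral>\<^sup>+z. ennreal (exp (- U ((x + y) / 2, z))) \<partial>lborel) * ennreal (exp (- (L / 8 * (x - y)\<^sup>2)))"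
    unfolding nn_integral_slice[OF U m] by (simp add: ennreal_mult[symmetric] exp_add[symmetric])
  also have "\<dots> = (\<integral>\<^sup>+z. ennreal (exp (- U ((x + y) / 2, z))) * ennreal (exp (- (L / 8 * (x - y)\<^sup>2))) \<partial>lborel)"
    by (rule nn_integral_multc[symmetric]) measurable
  also have "\<dots> \<le> (\<integral>\<^sup>+z. ennreal (sqrt (exp (- U (x, z)) * exp (- U (y, z)))) \<partial>lborel)"
    using geometric_mean_ge_midpoint[OF L]
    by (intro nn_integral_mono) (simp add: ennreal_mult[symmetric] ennreal_leI)
  finally show ?thesis .
qed

text \<open>The affinity of two slices is at most the geometric mean of their masses by
  Cauchy-Schwarz and at least the midpoint mass times a Gaussian factor.\<close>

lemma midpoint_smooth_marginal:
  assumes U: "strongly_convex m U" and m: "0 < m" and L: "midpoint_smooth L U"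
  shows "midpoint_smooth L (marginal_potential U)"
  unfolding midpoint_smooth_def
proof (intro allI)
  fix x y :: real
  let ?W = "marginal_potential U"
  note int = strongly_convex_integrable[OF strongly_convex_slices(2)[OF U] m]
  have "(ennreal (exp (- ?W ((x + y) / 2) - L / 8 * (x - y)\<^sup>2)))\<^sup>2
      \<le> (\<integral>\<^sup>+z. ennreal (sqrt (exp (- U (x, z)) * exp (- U (y, z)))) \<partial>lborel)\<^sup>2"
    by (intro power_mono midpoint_le_geometric_mean_integral[OF assms]) auto
  also have "\<dots> \<le> ennreal (exp (- ?W x) * exp (- ?W y))"
    unfolding exp_marginal_potential[OF U m] by (rule nn_integral_geometric_mean) (auto intro: int)
  finally have "(exp (- ?W ((x + y) / 2) - L / 8 * (x - y)\<^sup>2))\<^sup>2 \<le> exp (- ?W x) * exp (- ?W y)"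
    by (simp add: ennreal_power)
  then have "exp (2 * (- ?W ((x + y) / 2) - L / 8 * (x - y)\<^sup>2)) \<le> exp (- ?W x - ?W y)"
    unfolding exp_double by (simp add: exp_add[symmetric])
  then have "?W x + ?W y \<le> 2 * ?W ((x + y) / 2) + L / 4 * (x - y)\<^sup>2" by (simp add: algebra_simps)
  then show "?W x + ?W y \<le> 2 * ?W ((1/2) *\<^sub>R x + (1/2) *\<^sub>R y) + L / 4 * (norm (x - y))\<^sup>2"
    by (simp add: add_divide_distrib)
qed

text \<open>Nearby conditional densities overlap: Cauchy--Schwarz for \<open>sqrt (f g) = sqrt (min f g) * sqrt (max f g)\<close>
  bounds the overlap from below by the Hellinger affinity, and that one by the value at the midpoint.\<close>

lemma overlap_lower_bound:
  assumes U: "strongly_convex m U" and m: "0 < m" and L: "midpoint_smooth L U" and xy: "L * (x - y)\<^sup>2 \<le> 1"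
  shows "ennreal (min (exp (- marginal_potential U x)) (exp (- marginal_potential U y)) / 4)
    \<le> (\<integral>\<^sup>+z. ennreal (min (exp (- U (x, z))) (exp (- U (y, z)))) \<partial>lborel)"
proof -
  let ?W = "marginal_potential U"
  note int [intro, simp] = strongly_convex_integrable[OF strongly_convex_slices(2)[OF U] m]
  define f g where "f z = exp (- U (x, z))" and "g z = exp (- U (y, z))" for z
  have fg: "integrable lborel f" "integrable lborel g" "\<And>z. 0 < f z" "\<And>z. 0 < g z"
    by (simp_all add: f_def[abs_def] g_def[abs_def])
  define M where "M = (\<integral>z. min (f z) (g z) \<partial>lborel)"
  define a b where "a = exp (- ?W x)" and "b = exp (- ?W y)"
  have ab: "0 < a" "0 < b" "a = (\<integral>z. f z \<partial>lborel)" "b = (\<integral>z. g z \<partial>lborel)"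
    unfolding a_def b_def f_def g_def exp_marginal_potential[OF U m, symmetric] by simp_all
  have imin: "integrable lborel (\<lambda>z. min (f z) (g z))" and imax: "integrable lborel (\<lambda>z. max (f z) (g z))"
    using fg by (auto intro: integrable_min integrable_max)
  have max_le: "(\<integral>z. max (f z) (g z) \<partial>lborel) \<le> a + b"
  proof -
    have "(\<integral>z. max (f z) (g z) \<partial>lborel) \<le> (\<integral>z. f z + g z \<partial>lborel)"
      using fg imax by (intro integral_mono) (auto simp: less_imp_le max_def)
    then show ?thesis using fg by (simp add: ab)
  qed
  have M0: "0 \<le> M" unfolding M_def using fg by (intro integral_nonneg_AE) (auto simp: less_imp_le)
  have "strongly_convex m ?W" by (rule strongly_convex_marginal[OF U m])
  then have "convex_on UNIV ?W" using m by (intro strongly_convex_imp_convex_on) auto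
  from convex_onD[OF this, of "1/2" x y] have "?W ((x + y) / 2) \<le> (?W x + ?W y) / 2" by (simp add: field_simps)
  then have "(- ?W x - ?W y) / 2 - 1/8 \<le> - ?W ((x + y) / 2) - L / 8 * (x - y)\<^sup>2" using xy by (simp add: field_simps)
  then have "ennreal (exp ((- ?W x - ?W y) / 2 - 1/8)) \<le> ennreal (exp (- ?W ((x + y) / 2) - L / 8 * (x - y)\<^sup>2))"
    by (intro ennreal_leI) simp
  also have "\<dots> \<le> (\<integral>\<^sup>+z. ennreal (sqrt (min (f z) (g z) * max (f z) (g z))) \<partial>lborel)"
    using midpoint_le_geometric_mean_integral[OF U m L, of x y]
    by (simp add: f_def g_def min_def max_def mult.commute if_distrib cong: if_cong)
  finally have "(ennreal (exp ((- ?W x - ?W y) / 2 - 1/8)))\<^sup>2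
      \<le> (\<integral>\<^sup>+z. ennreal (sqrt (min (f z) (g z) * max (f z) (g z))) \<partial>lborel)\<^sup>2" by (rule power_mono) simp
  also have "\<dots> \<le> ennreal (M * (\<integral>z. max (f z) (g z) \<partial>lborel))"
    unfolding M_def using fg by (intro nn_integral_geometric_mean imin imax) (auto simp: less_imp_le le_max_iff_disj)
  also have "\<dots> \<le> ennreal (M * (a + b))" using M0 max_le by (intro ennreal_leI mult_left_mono)
  finally have "(exp ((- ?W x - ?W y) / 2 - 1/8))\<^sup>2 \<le> M * (a + b)"
    using M0 ab by (simp add: ennreal_power)
  also have "(exp ((- ?W x - ?W y) / 2 - 1/8))\<^sup>2 = exp (- (1/4)) * (a * b)"
    unfolding a_def b_def exp_double[symmetric] by (simp add: exp_add[symmetric] field_simps)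
  finally have key: "exp (- (1/4)) * (a * b) \<le> M * (a + b)" .
  \<comment> \<open>The quarter is the product of this 1/2 and of the 1/2 in ab / (a + b) >= min a b
    / 2.\<close>
  have "1/2 \<le> exp (- (1/4) :: real)" using exp_ge_add_one_self[of "- (1/4) :: real"] by simp
  then have "1/2 * (a * b) \<le> M * (a + b)" using key ab by (meson mult_right_mono mult_nonneg_nonneg less_imp_le order_trans)
  moreover have "min a b * (a + b) \<le> 2 * (a * b)"
    using ab by (auto simp: min_def algebra_simps intro: mult_left_mono mult_right_mono)
  ultimately have "min a b / 4 * (a + b) \<le> M * (a + b)" by simp
  then have "min a b / 4 \<le> M" using ab by (simp add: mult_le_cancel_right)
  then have "ennreal (min a b / 4) \<le> ennreal M" by (rule ennreal_leI)
  also have "ennreal M = (\<integral>\<^sup>+z. ennreal (min (f z) (g z)) \<partial>lborel)"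
    unfolding M_def using imin fg by (intro nn_integral_eq_integral[symmetric]) (auto simp: less_imp_le)
  finally show ?thesis unfolding a_def b_def f_def g_def .
qed

text \<open>Both ends of a move are compared with \<open>c\<close>. Each contributes 2 times the
  squared deviation, and by endpoint exchange they contribute equally over displacements of total
  length 2 h: 2 * 2 * 2 h = 8 h.\<close>

lemma box_form_le_variance:
  assumes [measurable]: "q \<in> borel_measurable borel" "g \<in> borel_measurable borel"
    and q: "\<And>x. 0 \<le> q x" and h: "0 \<le> h"
  shows "box_form q h g \<le> ennreal (8 * h) * (\<integral>\<^sup>+x. ennreal (q x * (g x - c)\<^sup>2) \<partial>lborel)"
proof -
  let ?F = "\<lambda>x u :: real. 2 * (q x * (g x - c)\<^sup>2)"
  let ?G = "\<lambda>x u. ?F (x + u) (- u)"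
  have F [measurable]: "(\<lambda>(x, u). ?F x u) \<in> borel_measurable (borel \<Otimes>\<^sub>M borel)"
    "(\<lambda>(x, u). ?G x u) \<in> borel_measurable (borel \<Otimes>\<^sub>M borel)" by measurable
  have "box_form q h g \<le> strip_integral h (\<lambda>x u. ?F x u + ?G x u)"
    unfolding box_form_eq_strip
  proof (rule strip_integral_mono)
    fix x u :: real
    have "(g x - g (x + u))\<^sup>2 \<le> 2 * (g x - c)\<^sup>2 + 2 * (g (x + u) - c)\<^sup>2"
      using zero_le_power2[of "(g x - c) + (g (x + u) - c)"] by (simp add: power2_eq_square algebra_simps)
    then have "min (q x) (q (x + u)) * (g x - g (x + u))\<^sup>2
        \<le> min (q x) (q (x + u)) * (2 * (g x - c)\<^sup>2 + 2 * (g (x + u) - c)\<^sup>2)"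
      using q by (intro mult_left_mono) auto
    also have "\<dots> = min (q x) (q (x + u)) * (2 * (g x - c)\<^sup>2) + min (q x) (q (x + u)) * (2 * (g (x + u) - c)\<^sup>2)"
      by (simp add: distrib_left)
    also have "\<dots> \<le> q x * (2 * (g x - c)\<^sup>2) + q (x + u) * (2 * (g (x + u) - c)\<^sup>2)"
      by (intro add_mono mult_right_mono) auto
    finally show "min (q x) (q (x + u)) * (g x - g (x + u))\<^sup>2 \<le> ?F x u + ?G x u" by simp
  qed
  also have "\<dots> = strip_integral h ?F + strip_integral h ?G"
    using q by (intro strip_integral_add F) auto
  also have "strip_integral h ?G = strip_integral h ?F" by (rule strip_integral_swap) measurable
  also have "strip_integral h ?F = ennreal (2 * h * 2) * (\<integral>\<^sup>+x. ennreal (q x * (g x - c)\<^sup>2) \<partial>lborel)"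
    using q h by (intro strip_integral_const_times) auto
  finally show ?thesis using h
    by (simp add: distrib_right[symmetric] ennreal_plus[symmetric] del: ennreal_plus)
qed

text \<open>Among nearby points the marginal weight of a move is at most 4 times the integral over z
  of the joint weights. The box form of the marginal is thus dominated by box forms along horizontal
  lines, and on each line by the squared distance to the constant c(z), which may vary freely with
  the line.\<close>

lemma marginal_variance_le:
  fixes U :: "real \<times> real \<Rightarrow> real"
  assumes U: "strongly_convex m U" and m: "0 < m" and L: "midpoint_smooth L U" and L0: "0 < L"
    and [measurable]: "g \<in> borel_measurable borel" "c \<in> borel_measurable borel"
    and fin: "(\<integral>\<^sup>+x. ennreal (exp (- marginal_potential U x) * (g x)\<^sup>2) \<partial>lborel) < \<infinity>"
  shows "\<exists>e. (\<integral>\<^sup>+x. ennreal (exp (- marginal_potential U x) * (g x - e)\<^sup>2) \<partial>lborel)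
    \<le> ennreal (213000000 * L / m) * (\<integral>\<^sup>+z. (\<integral>\<^sup>+x. ennreal (exp (- U (x, z)) * (g x - c z)\<^sup>2) \<partial>lborel) \<partial>lborel)"
proof -
  let ?R = "\<lambda>z. \<integral>\<^sup>+x. ennreal (exp (- U (x, z)) * (g x - c z)\<^sup>2) \<partial>lborel"
  let ?RR = "\<integral>\<^sup>+z. ?R z \<partial>lborel"
  let ?W = "marginal_potential U"
  have W: "strongly_convex m ?W" "midpoint_smooth L ?W"
    by (rule strongly_convex_marginal[OF U m] midpoint_smooth_marginal[OF U m L])+
  obtain a where a: "0 < a" "16 \<le> L * a\<^sup>2" "m * a\<^sup>2 \<le> 64" "poincare_scale (\<lambda>x. exp (- ?W x)) a"
    by (rule box_poincare[OF W m])
  \<comment> \<open>Small enough for the overlap bound, since L h^2 = 1/16, and at most a / 16,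
    since 16 <= L a^2.\<close>
  define h where "h = 1 / (4 * sqrt L)"
  have h: "0 < h" "L * h\<^sup>2 = 1/16" using L0 by (auto simp: h_def power_divide power_mult_distrib)
  have "h \<le> a / 16"
  proof (rule power2_le_imp_le)
    have "16 * (L * h\<^sup>2) \<le> 16 * (L * (a / 16)\<^sup>2)" using h a by (simp add: power_divide)
    then show "h\<^sup>2 \<le> (a / 16)\<^sup>2" using L0 by simp
  qed (use a in auto)
  from poincare_scaleD[OF a(4) h(1) this _ fin] obtain e where e:
    "(\<integral>\<^sup>+x. ennreal (exp (- ?W x) * (g x - e)\<^sup>2) \<partial>lborel)
       \<le> ennreal (6500 * a\<^sup>2 / h ^ 3) * box_form (\<lambda>x. exp (- ?W x)) h g" by auto
  have contU: "continuous_on UNIV U" using strongly_convex_continuous[OF U] m by simp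
  have "U \<in> borel_measurable borel" by (rule borel_measurable_continuous_onI[OF contU])
  then have Um [measurable]: "U \<in> borel_measurable (borel \<Otimes>\<^sub>M borel)" by (simp add: borel_prod)
  have [measurable]: "?W \<in> borel_measurable borel"
    using strongly_convex_continuous[OF W(1)] m by (intro borel_measurable_continuous_onI) auto
  let ?P = "\<lambda>x u z. ennreal (min (exp (- U (x, z))) (exp (- U (x + u, z))) * (g x - g (x + u))\<^sup>2)"
  have "box_form (\<lambda>x. exp (- ?W x)) h g \<le> (\<integral>\<^sup>+u\<in>{-h..h}. (\<integral>\<^sup>+x. 4 * (\<integral>\<^sup>+z. ?P x u z \<partial>lborel) \<partial>lborel) \<partial>lborel)"
    unfolding box_form_def
  proof (intro nn_integral_mono)
    fix u :: real
    show "(\<integral>\<^sup>+x. ennreal (min (exp (- ?W x)) (exp (- ?W (x + u))) * (g x - g (x + u))\<^sup>2) \<partial>lborel) * indicator {-h..h} u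
       \<le> (\<integral>\<^sup>+x. 4 * (\<integral>\<^sup>+z. ?P x u z \<partial>lborel) \<partial>lborel) * indicator {-h..h} u"
    proof (cases "u \<in> {-h..h}")
      case True
      have "u\<^sup>2 \<le> h\<^sup>2" using True h by (intro abs_le_square_iff[THEN iffD1]) auto
      then have "L * u\<^sup>2 \<le> L * h\<^sup>2" using L0 by simp
      then have Lu: "L * (x - (x + u))\<^sup>2 \<le> 1" for x using h by simp
      have "ennreal (min (exp (- ?W x)) (exp (- ?W (x + u))) * (g x - g (x + u))\<^sup>2) \<le> 4 * (\<integral>\<^sup>+z. ?P x u z \<partial>lborel)" for x
      proof -
        let ?m = "min (exp (- ?W x)) (exp (- ?W (x + u)))"
        have "ennreal (?m * (g x - g (x + u))\<^sup>2) = ennreal (4 * (?m / 4) * (g x - g (x + u))\<^sup>2)" by simp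
        also have "\<dots> = ennreal 4 * ennreal (?m / 4) * ennreal ((g x - g (x + u))\<^sup>2)"
          by (subst ennreal_mult, simp add: min_def, simp, subst ennreal_mult) (auto simp: min_def)
        also have "\<dots> \<le> ennreal 4 * (\<integral>\<^sup>+z. ennreal (min (exp (- U (x, z))) (exp (- U (x + u, z)))) \<partial>lborel) * ennreal ((g x - g (x + u))\<^sup>2)"
          by (intro mult_right_mono mult_left_mono overlap_lower_bound[OF U m L Lu]) auto
        also have "\<dots> = ennreal 4 * (\<integral>\<^sup>+z. ennreal (min (exp (- U (x, z))) (exp (- U (x + u, z)))) * ennreal ((g x - g (x + u))\<^sup>2) \<partial>lborel)"
          by (subst nn_integral_multc) (auto simp: mult.assoc)
        finally show ?thesis by (simp add: ennreal_mult)
      qed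
      then show ?thesis by (intro mult_right_mono nn_integral_mono) auto
    qed simp
  qed
  also have "\<dots> = (\<integral>\<^sup>+u. (\<integral>\<^sup>+x. (\<integral>\<^sup>+z. 4 * ?P x u z * indicator {-h..h} u \<partial>lborel) \<partial>lborel) \<partial>lborel)"
    by (simp add: nn_integral_cmult nn_integral_multc)
  also have "\<dots> = (\<integral>\<^sup>+u. (\<integral>\<^sup>+z. (\<integral>\<^sup>+x. 4 * ?P x u z * indicator {-h..h} u \<partial>lborel) \<partial>lborel) \<partial>lborel)"
    by (rule nn_integral_cong, rule lborel_pair.Fubini') measurable
  also have "\<dots> = (\<integral>\<^sup>+z. (\<integral>\<^sup>+u. (\<integral>\<^sup>+x. 4 * ?P x u z * indicator {-h..h} u \<partial>lborel) \<partial>lborel) \<partial>lborel)"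
    by (rule lborel_pair.Fubini') measurable
  also have "\<dots> = (\<integral>\<^sup>+z. 4 * box_form (\<lambda>x. exp (- U (x, z))) h g \<partial>lborel)"
    unfolding box_form_def by (simp add: nn_integral_cmult nn_integral_multc mult.assoc)
  also have "\<dots> \<le> (\<integral>\<^sup>+z. ennreal (32 * h) * ?R z \<partial>lborel)"
  proof (intro nn_integral_mono)
    fix z
    have "box_form (\<lambda>x. exp (- U (x, z))) h g \<le> ennreal (8 * h) * ?R z"
      using h by (intro box_form_le_variance) auto
    then have "ennreal 4 * box_form (\<lambda>x. exp (- U (x, z))) h g
      \<le> ennreal 4 * (ennreal (8 * h) * ?R z)"
      by (intro mult_left_mono) auto
    also have "\<dots> = ennreal (4 * (8 * h)) * ?R z"
      using h by (subst ennreal_mult) (auto simp: mult.assoc)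
    finally show "4 * box_form (\<lambda>x. exp (- U (x, z))) h g
      \<le> ennreal (32 * h) * ?R z" by simp
  qed
  also have "\<dots> = ennreal (32 * h) * ?RR"
    by (rule nn_integral_cmult) measurable
  finally have "ennreal (6500 * a\<^sup>2 / h ^ 3) * box_form (\<lambda>x. exp (- ?W x)) h g
    \<le> ennreal (6500 * a\<^sup>2 / h ^ 3) * (ennreal (32 * h) * ?RR)"
    by (rule mult_left_mono) simp
  also have "\<dots> = ennreal (6500 * a\<^sup>2 / h ^ 3 * (32 * h)) * ?RR"
    using h by (subst ennreal_mult) (auto simp: mult.assoc)
  also have "\<dots> \<le> ennreal (213000000 * L / m) * ?RR"
  proof (intro mult_right_mono ennreal_leI)
    \<comment> \<open>The constant is 6500 * 32 * 16 * 64 = 212992000, rounded up.\<close>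
    have "1 / h\<^sup>2 = 16 * L" using h L0 by (simp add: field_simps)
    have "6500 * a\<^sup>2 / h ^ 3 * (32 * h) = 208000 * a\<^sup>2 * (1 / h\<^sup>2)"
      using h by (simp add: power2_eq_square power3_eq_cube)
    also have "\<dots> = 3328000 * L * a\<^sup>2" unfolding \<open>1 / h\<^sup>2 = 16 * L\<close> by simp
    also have "\<dots> \<le> 3328000 * L * (64 / m)"
      using a(3) m L0 by (intro mult_left_mono) (auto simp: field_simps)
    also have "\<dots> \<le> 213000000 * L / m" using m L0 by (simp add: field_simps)
    finally show "6500 * a\<^sup>2 / h ^ 3 * (32 * h) \<le> 213000000 * L / m" .
  qed simp
  finally show ?thesis using e by (intro exI[of _ e]) (rule order_trans)
qed

subsection \<open>Positive reversible jump operators\<close>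

text \<open>A class of test functions preserved by the Markov operators and integrable against every
  finite measure, so that forms can be expanded freely; general square-integrable functions enter
  only through a final limit.\<close>

definition bounded_borel :: "('a::topological_space \<Rightarrow> real) \<Rightarrow> bool" where
  "bounded_borel g \<longleftrightarrow> g \<in> borel_measurable borel \<and> (\<exists>C. \<forall>x. \<bar>g x\<bar> \<le> C)"

lemma bounded_borelI: "g \<in> borel_measurable borel \<Longrightarrow> (\<And>x. \<bar>g x\<bar> \<le> C) \<Longrightarrow> bounded_borel g"
  by (auto simp: bounded_borel_def)

lemma bounded_borel_measurable: "bounded_borel g \<Longrightarrow> g \<in> borel_measurable borel"
  by (simp add: bounded_borel_def)

lemma bounded_borelE:
  assumes "bounded_borel g"
  obtains C where "0 \<le> C" "\<And>x. \<bar>g x\<bar> \<le> C"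
  using assms unfolding bounded_borel_def by (meson abs_ge_zero order_trans)

lemma bounded_borel_const: "bounded_borel (\<lambda>x. c)"
  by (rule bounded_borelI[where C="\<bar>c\<bar>"]) auto

lemma bounded_borel_diff:
  assumes "bounded_borel f" "bounded_borel g"
  shows "bounded_borel (\<lambda>x. f x - g x)"
proof -
  obtain C D where "\<And>x. \<bar>f x\<bar> \<le> C" "\<And>x. \<bar>g x\<bar> \<le> D"
    using bounded_borelE[OF assms(1)] bounded_borelE[OF assms(2)] by metis
  then have "\<bar>f x - g x\<bar> \<le> C + D" for x by (meson abs_triangle_ineq4 add_mono order_trans)
  with assms show ?thesis by (auto intro!: bounded_borelI[where C="C + D"] dest!: bounded_borel_measurable)
qed

lemma bounded_borel_add:
  assumes "bounded_borel f" "bounded_borel g"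
  shows "bounded_borel (\<lambda>x. f x + g x)"
  using bounded_borel_diff[OF assms(1) bounded_borel_diff[OF bounded_borel_const[of 0] assms(2)]] by simp

lemma bounded_borel_mult:
  assumes "bounded_borel f" "bounded_borel g"
  shows "bounded_borel (\<lambda>x. f x * g x)"
proof -
  obtain C D where CD: "0 \<le> C" "\<And>x. \<bar>f x\<bar> \<le> C" "\<And>x. \<bar>g x\<bar> \<le> D"
    using bounded_borelE[OF assms(1)] bounded_borelE[OF assms(2)] by metis
  then have "\<bar>f x * g x\<bar> \<le> C * D" for x unfolding abs_mult by (intro mult_mono) auto
  with assms show ?thesis by (auto intro!: bounded_borelI[where C="C * D"] dest!: bounded_borel_measurable)
qed

lemma bounded_borel_square: "bounded_borel g \<Longrightarrow> bounded_borel (\<lambda>x. (g x)\<^sup>2)"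
  using bounded_borel_mult[of g g] by (simp add: power2_eq_square)

lemma integrable_times_bounded_borel:
  assumes f: "integrable M f" and g: "g \<in> borel_measurable M" "\<And>x. \<bar>g x\<bar> \<le> C"
  shows "integrable M (\<lambda>x. f x * g x :: real)"
proof (rule Bochner_Integration.integrable_bound)
  show "integrable M (\<lambda>x. C * f x)" using f by simp
  show "(\<lambda>x. f x * g x) \<in> borel_measurable M" using f g by auto
  show "AE x in M. norm (f x * g x) \<le> norm (C * f x)"
  proof (rule AE_I2)
    fix x
    have "\<bar>f x\<bar> * \<bar>g x\<bar> \<le> \<bar>f x\<bar> * C" using g by (intro mult_left_mono) auto
    also have "\<dots> \<le> \<bar>C * f x\<bar>" by (simp add: abs_mult mult.commute mult_right_mono)
    finally show "norm (f x * g x) \<le> norm (C * f x)" by (simp add: abs_mult)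
  qed
qed

text \<open>A symmetric jump density \<open>k\<close> with total outgoing rate at most \<open>d\<close> is a Markov kernel reversible with
  respect to \<open>d\<close> once the missing mass is put on the diagonal.\<close>

locale reversible_jump =
  fixes d :: "real \<Rightarrow> real" and k :: "real \<Rightarrow> real \<Rightarrow> real"
  assumes d_measurable [measurable]: "d \<in> borel_measurable borel"
    and k_measurable [measurable]: "(\<lambda>(x, y). k x y) \<in> borel_measurable (borel \<Otimes>\<^sub>M borel)"
    and d_pos: "0 < d x" and d_integrable: "integrable lborel d"
    and k_nonneg: "0 \<le> k x y" and k_sym: "k x y = k y x"
    and k_le: "(\<integral>\<^sup>+y. ennreal (k x y) \<partial>lborel) \<le> ennreal (d x)"
    and k_psd: "bounded_borel u \<Longrightarrow> 0 \<le> (\<integral>p. k (fst p) (snd p) * (u (fst p) * u (snd p)) \<partial>(lborel \<Otimes>\<^sub>M lborel))"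
begin

text \<open>The holding rate weighted by \<open>d\<close>: the probability of staying at
  \<open>x\<close> is \<open>rej x / d x\<close>.\<close>

definition rej :: "real \<Rightarrow> real" where
  "rej x = d x - (\<integral>y. k x y \<partial>lborel)"

definition op :: "(real \<Rightarrow> real) \<Rightarrow> real \<Rightarrow> real" where
  "op g x = ((\<integral>y. k x y * g y \<partial>lborel) + rej x * g x) / d x"

lemma k_integrable: "integrable lborel (k x)"
  using k_le[of x] k_nonneg by (intro integrableI_bounded) (auto intro: le_less_trans)

lemma k_integral_le: "(\<integral>y. k x y \<partial>lborel) \<le> d x"
proof -
  have "ennreal (\<integral>y. k x y \<partial>lborel) \<le> ennreal (d x)"
    using k_le[of x] k_nonneg by (subst nn_integral_eq_integral[symmetric]) (auto intro: k_integrable)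
  then show ?thesis using d_pos[of x] by (simp add: ennreal_le_iff)
qed

lemma rej_nonneg: "0 \<le> rej x" and rej_le: "rej x \<le> d x"
  using k_integral_le[of x] k_nonneg by (auto simp: rej_def intro: integral_nonneg_AE)

lemma rej_measurable [measurable]: "rej \<in> borel_measurable borel"
  unfolding rej_def by measurable

lemma rej_integrable: "integrable lborel rej"
  by (rule Bochner_Integration.integrable_bound[OF d_integrable])
     (use rej_nonneg rej_le d_pos in \<open>auto simp: less_imp_le\<close>)

lemma k_pair_integrable: "integrable (lborel \<Otimes>\<^sub>M lborel) (\<lambda>p. k (fst p) (snd p))"
proof (rule integrableI_bounded)
  show "(\<lambda>p. k (fst p) (snd p)) \<in> borel_measurable (lborel \<Otimes>\<^sub>M lborel)"
    using k_measurable by (simp add: split_beta' cong: measurable_cong_sets)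
  then have "(\<integral>\<^sup>+p. ennreal (norm (k (fst p) (snd p))) \<partial>(lborel \<Otimes>\<^sub>M lborel)) = (\<integral>\<^sup>+x. (\<integral>\<^sup>+y. ennreal (k x y) \<partial>lborel) \<partial>lborel)"
    by (subst lborel.nn_integral_fst[symmetric]) (auto simp: k_nonneg)
  also have "\<dots> \<le> (\<integral>\<^sup>+x. ennreal (d x) \<partial>lborel)" by (intro nn_integral_mono k_le)
  also have "\<dots> < \<infinity>" using d_integrable d_pos by (simp add: nn_integral_eq_integral less_imp_le)
  finally show "(\<integral>\<^sup>+p. ennreal (norm (k (fst p) (snd p))) \<partial>(lborel \<Otimes>\<^sub>M lborel)) < \<infinity>" .
qed

lemma k_pair_times_integrable:
  assumes "bounded_borel u" "bounded_borel v"
  shows "integrable (lborel \<Otimes>\<^sub>M lborel) (\<lambda>p. k (fst p) (snd p) * (u (fst p) * v (snd p)))"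
proof -
  obtain C D where CD: "0 \<le> C" "\<And>x. \<bar>u x\<bar> \<le> C" "\<And>x. \<bar>v x\<bar> \<le> D"
    using bounded_borelE[OF assms(1)] bounded_borelE[OF assms(2)] by metis
  have [measurable]: "u \<in> borel_measurable borel" "v \<in> borel_measurable borel"
    using assms by (auto dest: bounded_borel_measurable)
  show ?thesis
  proof (rule integrable_times_bounded_borel[OF k_pair_integrable])
    show "\<bar>u (fst p) * v (snd p)\<bar> \<le> C * D" for p
      unfolding abs_mult using CD by (intro mult_mono) auto
  qed measurable
qed

text \<open>The inner product of \<open>u\<close> and \<open>op v\<close> in L^2(d), written so that
  symmetry and positivity can be read off the jump and holding parts separately.\<close>

definition form :: "(real \<Rightarrow> real) \<Rightarrow> (real \<Rightarrow> real) \<Rightarrow> real" where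
  "form u v = (\<integral>p. k (fst p) (snd p) * (u (fst p) * v (snd p)) \<partial>(lborel \<Otimes>\<^sub>M lborel)) + (\<integral>x. rej x * (u x * v x) \<partial>lborel)"

lemma rej_times_integrable:
  assumes "bounded_borel u"
  shows "integrable lborel (\<lambda>x. rej x * u x)"
  using assms unfolding bounded_borel_def by (auto intro!: integrable_times_bounded_borel[OF rej_integrable])

lemma d_times_integrable:
  assumes "bounded_borel u"
  shows "integrable lborel (\<lambda>x. d x * u x)"
  using assms unfolding bounded_borel_def by (auto intro!: integrable_times_bounded_borel[OF d_integrable])

lemma bounded_borel_op:
  assumes g: "bounded_borel g"
  shows "bounded_borel (op g)"
proof -
  obtain C where C: "0 \<le> C" "\<And>x. \<bar>g x\<bar> \<le> C" using bounded_borelE[OF g] by metis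
  have [measurable]: "g \<in> borel_measurable borel" using g by (rule bounded_borel_measurable)
  have "\<bar>op g x\<bar> \<le> C" for x
  proof -
    have "\<bar>\<integral>y. k x y * g y \<partial>lborel\<bar> \<le> (\<integral>y. \<bar>k x y * g y\<bar> \<partial>lborel)" by (rule integral_abs_bound)
    also have "\<dots> \<le> (\<integral>y. k x y * C \<partial>lborel)"
      using C k_nonneg
      by (intro integral_mono_AE integrable_abs integrable_times_bounded_borel[OF k_integrable, where C=C] integrable_mult_left k_integrable)
         (auto simp: abs_mult intro!: mult_left_mono)
    finally have 1: "\<bar>\<integral>y. k x y * g y \<partial>lborel\<bar> \<le> (\<integral>y. k x y \<partial>lborel) * C" by simp
    have "\<bar>rej x * g x\<bar> \<le> rej x * C" using C rej_nonneg[of x] by (simp add: abs_mult mult_left_mono)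
    with 1 have "\<bar>(\<integral>y. k x y * g y \<partial>lborel) + rej x * g x\<bar> \<le> (\<integral>y. k x y \<partial>lborel) * C + rej x * C"
      by linarith
    also have "\<dots> = C * d x" by (simp add: rej_def algebra_simps)
    finally show ?thesis unfolding op_def abs_divide abs_of_pos[OF d_pos] pos_divide_le_eq[OF d_pos] .
  qed
  moreover have "op g \<in> borel_measurable borel" unfolding op_def[abs_def] by measurable
  ultimately show ?thesis by (intro bounded_borelI[where C=C])
qed

lemma form_eq_op:
  assumes u: "bounded_borel u" and v: "bounded_borel v"
  shows "form u v = (\<integral>x. d x * (u x * op v x) \<partial>lborel)"
proof -
  have [measurable]: "u \<in> borel_measurable borel" "v \<in> borel_measurable borel"
    using u v by (auto dest: bounded_borel_measurable)
  have i: "integrable (lborel \<Otimes>\<^sub>M lborel) (\<lambda>(x, y). k x y * (u x * v y))"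
    using k_pair_times_integrable[OF u v] by (simp add: split_beta')
  have "(\<integral>p. k (fst p) (snd p) * (u (fst p) * v (snd p)) \<partial>(lborel \<Otimes>\<^sub>M lborel))
     = (\<integral>x. (\<integral>y. k x y * (u x * v y) \<partial>lborel) \<partial>lborel)"
    using lborel_pair.integral_fst'[OF i] by (simp add: split_beta')
  moreover have "integrable lborel (\<lambda>x. (\<integral>y. k x y * (u x * v y) \<partial>lborel))"
    using lborel_pair.integrable_fst'[OF i] by simp
  moreover have "integrable lborel (\<lambda>x. rej x * (u x * v x))"
    by (intro rej_times_integrable bounded_borel_mult u v)
  ultimately have "form u v = (\<integral>x. (\<integral>y. k x y * (u x * v y) \<partial>lborel) + rej x * (u x * v x) \<partial>lborel)"
    unfolding form_def by simp
  also have "\<dots> = (\<integral>x. d x * (u x * op v x) \<partial>lborel)"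
  proof (rule Bochner_Integration.integral_cong[OF refl])
    fix x
    have "(\<integral>y. k x y * (u x * v y) \<partial>lborel) = u x * (\<integral>y. k x y * v y \<partial>lborel)"
      by (subst integral_mult_right_zero[symmetric]) (simp add: mult_ac)
    then show "(\<integral>y. k x y * (u x * v y) \<partial>lborel) + rej x * (u x * v x) = d x * (u x * op v x)"
      using d_pos[of x] by (simp add: op_def field_simps)
  qed
  finally show ?thesis .
qed

lemma form_sym:
  assumes u: "bounded_borel u" and v: "bounded_borel v"
  shows "form u v = form v u"
proof -
  have "(\<integral>(x, y). k (fst (y, x)) (snd (y, x)) * (u (fst (y, x)) * v (snd (y, x))) \<partial>(lborel \<Otimes>\<^sub>M lborel))
      = (\<integral>p. k (fst p) (snd p) * (u (fst p) * v (snd p)) \<partial>(lborel \<Otimes>\<^sub>M lborel))"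
    by (rule lborel_pair.integral_product_swap[OF borel_measurable_integrable[OF k_pair_times_integrable[OF u v]]])
  moreover have "k (snd p) (fst p) * (u (snd p) * v (fst p)) = k (fst p) (snd p) * (v (fst p) * u (snd p))" for p
    using k_sym[of "snd p" "fst p"] by simp
  ultimately show ?thesis unfolding form_def by (simp add: split_beta' mult.commute)
qed

lemma form_diff_left:
  assumes u: "bounded_borel u" and v: "bounded_borel v" and w: "bounded_borel w"
  shows "form (\<lambda>x. u x - v x) w = form u w - form v w"
proof -
  have "(\<integral>p. k (fst p) (snd p) * ((u (fst p) - v (fst p)) * w (snd p)) \<partial>(lborel \<Otimes>\<^sub>M lborel))
     = (\<integral>p. k (fst p) (snd p) * (u (fst p) * w (snd p)) - k (fst p) (snd p) * (v (fst p) * w (snd p)) \<partial>(lborel \<Otimes>\<^sub>M lborel))"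
    by (simp add: algebra_simps)
  also have "\<dots> = (\<integral>p. k (fst p) (snd p) * (u (fst p) * w (snd p)) \<partial>(lborel \<Otimes>\<^sub>M lborel))
      - (\<integral>p. k (fst p) (snd p) * (v (fst p) * w (snd p)) \<partial>(lborel \<Otimes>\<^sub>M lborel))"
    by (intro Bochner_Integration.integral_diff k_pair_times_integrable u v w)
  moreover have "(\<integral>x. rej x * ((u x - v x) * w x) \<partial>lborel) = (\<integral>x. rej x * (u x * w x) - rej x * (v x * w x) \<partial>lborel)"
    by (simp add: algebra_simps)
  moreover have "\<dots> = (\<integral>x. rej x * (u x * w x) \<partial>lborel) - (\<integral>x. rej x * (v x * w x) \<partial>lborel)"
    by (intro Bochner_Integration.integral_diff rej_times_integrable bounded_borel_mult u v w)
  ultimately show ?thesis unfolding form_def by simp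
qed

lemma k_pair_times_fst:
  assumes u: "bounded_borel u"
  shows "(\<integral>p. k (fst p) (snd p) * u (fst p) \<partial>(lborel \<Otimes>\<^sub>M lborel)) = (\<integral>x. (d x - rej x) * u x \<partial>lborel)"
    "(\<integral>p. k (fst p) (snd p) * u (snd p) \<partial>(lborel \<Otimes>\<^sub>M lborel)) = (\<integral>x. (d x - rej x) * u x \<partial>lborel)"
proof -
  have i: "integrable (lborel \<Otimes>\<^sub>M lborel) (\<lambda>(x, y). k x y * u x)"
    using k_pair_times_integrable[OF u bounded_borel_const[of 1]] by (simp add: split_beta')
  show 1: "(\<integral>p. k (fst p) (snd p) * u (fst p) \<partial>(lborel \<Otimes>\<^sub>M lborel)) = (\<integral>x. (d x - rej x) * u x \<partial>lborel)"
    using lborel_pair.integral_fst'[OF i] by (simp add: split_beta' rej_def)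
  show "(\<integral>p. k (fst p) (snd p) * u (snd p) \<partial>(lborel \<Otimes>\<^sub>M lborel)) = (\<integral>x. (d x - rej x) * u x \<partial>lborel)"
    using form_sym[OF u bounded_borel_const[of 1]] 1 by (simp add: form_def)
qed

text \<open>Expanding the square, both diagonal terms integrate to the total outgoing rate d - rej
  by symmetry of \<open>k\<close>; the holding part cancels.\<close>

lemma dirichlet_identity:
  assumes g: "bounded_borel g"
  shows "form g g = (\<integral>x. d x * (g x)\<^sup>2 \<partial>lborel)
     - (\<integral>p. k (fst p) (snd p) * (g (fst p) - g (snd p))\<^sup>2 \<partial>(lborel \<Otimes>\<^sub>M lborel)) / 2"
    and "integrable (lborel \<Otimes>\<^sub>M lborel) (\<lambda>p. k (fst p) (snd p) * (g (fst p) - g (snd p))\<^sup>2)"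
proof -
  let ?P = "lborel \<Otimes>\<^sub>M lborel :: (real \<times> real) measure"
  note g2 = bounded_borel_square[OF g]
  have i1: "integrable ?P (\<lambda>p. k (fst p) (snd p) * (g (fst p))\<^sup>2)" "integrable ?P (\<lambda>p. k (fst p) (snd p) * (g (snd p))\<^sup>2)"
    "integrable ?P (\<lambda>p. k (fst p) (snd p) * (g (fst p) * g (snd p)))"
    using k_pair_times_integrable[OF g2 bounded_borel_const[of 1]] k_pair_times_integrable[OF bounded_borel_const[of 1] g2]
      k_pair_times_integrable[OF g g] by simp_all
  have eq: "k (fst p) (snd p) * (g (fst p) - g (snd p))\<^sup>2 = k (fst p) (snd p) * (g (fst p))\<^sup>2 + k (fst p) (snd p) * (g (snd p))\<^sup>2
      - 2 * (k (fst p) (snd p) * (g (fst p) * g (snd p)))" for p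
    by (simp add: power2_eq_square algebra_simps)
  show "integrable ?P (\<lambda>p. k (fst p) (snd p) * (g (fst p) - g (snd p))\<^sup>2)"
    unfolding eq using i1 by auto
  have "(\<integral>p. k (fst p) (snd p) * (g (fst p) - g (snd p))\<^sup>2 \<partial>?P)
    = (\<integral>x. (d x - rej x) * (g x)\<^sup>2 \<partial>lborel) + (\<integral>x. (d x - rej x) * (g x)\<^sup>2 \<partial>lborel)
      - 2 * (\<integral>p. k (fst p) (snd p) * (g (fst p) * g (snd p)) \<partial>?P)"
    unfolding eq using i1 by (simp add: k_pair_times_fst[OF g2])
  also have "(\<integral>x. (d x - rej x) * (g x)\<^sup>2 \<partial>lborel) = (\<integral>x. d x * (g x)\<^sup>2 \<partial>lborel) - (\<integral>x. rej x * (g x)\<^sup>2 \<partial>lborel)"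
    using d_times_integrable[OF g2] rej_times_integrable[OF g2] by (simp add: left_diff_distrib)
  finally show "form g g = (\<integral>x. d x * (g x)\<^sup>2 \<partial>lborel)
     - (\<integral>p. k (fst p) (snd p) * (g (fst p) - g (snd p))\<^sup>2 \<partial>?P) / 2"
    unfolding form_def power2_eq_square[symmetric] by linarith
qed

lemma form_psd:
  assumes "bounded_borel u" shows "0 \<le> form u u"
proof -
  have "0 \<le> (\<integral>x. rej x * (u x * u x) \<partial>lborel)"
    using rej_nonneg by (intro integral_nonneg_AE) auto
  then show ?thesis unfolding form_def using k_psd[OF assms] by simp
qed

lemma form_le:
  assumes g: "bounded_borel g"
  shows "form g g \<le> (\<integral>x. d x * (g x)\<^sup>2 \<partial>lborel)"
proof -
  have "0 \<le> (\<integral>p. k (fst p) (snd p) * (g (fst p) - g (snd p))\<^sup>2 \<partial>(lborel \<Otimes>\<^sub>M lborel))"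
    using k_nonneg by (intro integral_nonneg_AE) auto
  then show ?thesis unfolding dirichlet_identity(1)[OF g] by simp
qed

text \<open>For a positive contraction \<open>H\<close> one has \<open>H\<^sup>2 \<le> H\<close>; here this follows by testing
  positivity with \<open>g - H g\<close>.\<close>

lemma op_norm_le_form:
  assumes g: "bounded_borel g"
  shows "(\<integral>x. d x * (op g x)\<^sup>2 \<partial>lborel) \<le> form g g"
proof -
  let ?w = "op g"
  have w: "bounded_borel ?w" by (rule bounded_borel_op[OF g])
  have gw: "bounded_borel (\<lambda>x. g x - ?w x)" by (rule bounded_borel_diff[OF g w])
  have fw: "form ?w g = (\<integral>x. d x * (?w x)\<^sup>2 \<partial>lborel)"
    unfolding form_eq_op[OF w g] by (simp add: power2_eq_square)
  have "form (\<lambda>x. g x - ?w x) (\<lambda>x. g x - ?w x) = form g (\<lambda>x. g x - ?w x) - form ?w (\<lambda>x. g x - ?w x)"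
    by (rule form_diff_left[OF g w gw])
  also have "form g (\<lambda>x. g x - ?w x) = form g g - form ?w g"
    using form_sym[OF g gw] form_diff_left[OF g w g] by simp
  also have "form ?w (\<lambda>x. g x - ?w x) = form ?w g - form ?w ?w"
    using form_sym[OF w gw] form_diff_left[OF g w w] form_sym[OF g w] by simp
  finally show ?thesis using form_psd[OF gw] form_le[OF w] unfolding fw by linarith
qed

theorem op_contraction:
  assumes g: "bounded_borel g"
  shows "(\<integral>x. d x * (op g x)\<^sup>2 \<partial>lborel) \<le> (\<integral>x. d x * (g x)\<^sup>2 \<partial>lborel)
     - (\<integral>p. k (fst p) (snd p) * (g (fst p) - g (snd p))\<^sup>2 \<partial>(lborel \<Otimes>\<^sub>M lborel)) / 2"
  using op_norm_le_form[OF g] unfolding dirichlet_identity(1)[OF g] .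

end

text \<open>Holds for every \<open>G\<close>: in the integrable case the integral is a square,
  otherwise it is 0 by default. It therefore applies to each slice of a mixture without further
  checks.\<close>

lemma integral_product_square_nonneg:
  fixes G :: "real \<Rightarrow> real"
  shows "0 \<le> (\<integral>p. G (fst p) * G (snd p) \<partial>(lborel \<Otimes>\<^sub>M lborel))"
proof (cases "integrable (lborel \<Otimes>\<^sub>M lborel) (\<lambda>p. G (fst p) * G (snd p))")
  case True
  then have i: "integrable (lborel \<Otimes>\<^sub>M lborel) (\<lambda>(x, y). G x * G y)" by (simp add: split_beta')
  have "(\<integral>p. G (fst p) * G (snd p) \<partial>(lborel \<Otimes>\<^sub>M lborel)) = (\<integral>x. G x * (\<integral>y. G y \<partial>lborel) \<partial>lborel)"
    using lborel_pair.integral_fst'[OF i] by (simp add: split_beta')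
  also have "\<dots> = (\<integral>y. G y \<partial>lborel)\<^sup>2" by (simp add: power2_eq_square)
  finally show ?thesis by simp
qed (simp add: not_integrable_integral_eq)

lemma normal_density_convolution:
  assumes "0 < s"
  shows "(\<integral>\<^sup>+z. ennreal (normal_density 0 (s / sqrt 2) (z - x) * normal_density 0 (s / sqrt 2) (z - y)) \<partial>lborel)
    = ennreal (normal_density 0 s (x - y))"
proof -
  let ?s = "s / sqrt 2"
  have s: "0 < ?s" "sqrt (?s\<^sup>2 + ?s\<^sup>2) = s" using assms by (auto simp: power_divide)
  have sym: "normal_density 0 ?s (a - b) = normal_density 0 ?s (b - a)" for a b
    by (simp add: normal_density_def power2_commute)
  have "(\<integral>\<^sup>+z. ennreal (normal_density 0 ?s (z - x) * normal_density 0 ?s (z - y)) \<partial>lborel)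
     = (\<integral>\<^sup>+w. ennreal (normal_density 0 ?s ((y + w) - x) * normal_density 0 ?s w) \<partial>lborel)"
    by (subst nn_integral_real_affine[where c=1 and t=y]) auto
  also have "\<dots> = (\<integral>\<^sup>+w. ennreal (normal_density 0 ?s ((x - y) - w) * normal_density 0 ?s w) \<partial>lborel)"
    using sym[of "y + _" x] by (simp add: algebra_simps)
  also have "\<dots> = ennreal (normal_density 0 (sqrt (?s\<^sup>2 + ?s\<^sup>2)) (x - y))"
    using fun_cong[OF conv_normal_density_zero_mean[OF s(1) s(1)], of "x - y"] by simp
  finally show ?thesis unfolding s(2) .
qed

text \<open>Both factors are mixtures of rank-one kernels: the Gaussian by splitting its variance into two halves, the
  minimum because \<open>min a b\<close> is the integral of \<open>1{t < a} 1{t < b}\<close> over \<open>t > 0\<close>.\<close>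

lemma gaussian_min_psd:
  fixes d :: "real \<Rightarrow> real"
  assumes [measurable]: "d \<in> borel_measurable borel" and d: "\<And>x. 0 < d x" "integrable lborel d" and s: "0 < s"
    and u: "bounded_borel u"
  shows "0 \<le> (\<integral>p. normal_density 0 s (fst p - snd p) * min (d (fst p)) (d (snd p)) * (u (fst p) * u (snd p)) \<partial>(lborel \<Otimes>\<^sub>M lborel))"
proof -
  define \<psi> where "\<psi> = normal_density 0 (s / sqrt 2)"
  have [measurable]: "\<psi> \<in> borel_measurable borel" unfolding \<psi>_def by measurable
  have \<psi>0: "0 \<le> \<psi> x" for x by (simp add: \<psi>_def)
  note [measurable] = bounded_borel_measurable[OF u]
  obtain C where C: "0 \<le> C" "\<And>x. \<bar>u x\<bar> \<le> C" using bounded_borelE[OF u] by metis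
  let ?P = "lborel \<Otimes>\<^sub>M lborel :: (real \<times> real) measure"
  let ?K = "\<lambda>x y w. \<psi> (snd w - x) * \<psi> (snd w - y) * (indicator {t. 0 < t \<and> t < d x} (fst w) * indicator {t. 0 < t \<and> t < d y} (fst w))"
  define G where "G t z x = \<psi> (z - x) * indicator {t. 0 < t \<and> t < d x} t * u x" for t z x
  \<comment> \<open>The latent variable w = (t, z) consists of the level \<open>t\<close> from the
    minimum and the intermediate Gaussian point \<open>z\<close>; for fixed \<open>w\<close> the
    kernel is a product of one factor in each coordinate of \<open>p\<close>.\<close>
  define F where "F p w = G (fst w) (snd w) (fst p) * G (fst w) (snd w) (snd p)" for p w :: "real \<times> real"
  interpret PP: pair_sigma_finite ?P ?P ..
  have G_meas [measurable]: "(\<lambda>(t, z, x). G t z x) \<in> borel_measurable (borel \<Otimes>\<^sub>M borel \<Otimes>\<^sub>M borel)"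
    unfolding G_def by measurable
  have F_meas [measurable]: "(\<lambda>(p, w). F p w) \<in> borel_measurable (?P \<Otimes>\<^sub>M ?P)"
    unfolding F_def G_def by measurable
  have tz: "(\<integral>\<^sup>+w. ennreal (?K x y w) \<partial>?P)
     = ennreal (normal_density 0 s (x - y) * min (d x) (d y))" for x y
  proof -
    have "(\<integral>\<^sup>+w. ennreal (?K x y w) \<partial>?P)
       = (\<integral>\<^sup>+t. (\<integral>\<^sup>+z. ennreal (\<psi> (z - x) * \<psi> (z - y)) * indicator {0<..<min (d x) (d y)} t \<partial>lborel) \<partial>lborel)"
      by (subst lborel.nn_integral_fst[symmetric]) (auto simp: indicator_def intro!: nn_integral_cong)
    also have "\<dots> = (\<integral>\<^sup>+t. ennreal (normal_density 0 s (x - y)) * indicator {0<..<min (d x) (d y)} t \<partial>lborel)"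
      using normal_density_convolution[OF s, of x y] by (simp add: nn_integral_multc \<psi>_def)
    also have "\<dots> = ennreal (normal_density 0 s (x - y)) * ennreal (min (d x) (d y))"
      using d(1)[of x] d(1)[of y] by (subst nn_integral_cmult_indicator) auto
    finally show ?thesis using d(1)[of x] d(1)[of y] by (simp add: ennreal_mult less_imp_le min_def)
  qed
  have Fnorm: "ennreal (norm (F (x, y) w)) \<le> ennreal (C * C) * ennreal (?K x y w)" for x y w
  proof -
    have "norm (F (x, y) w) = (\<bar>u x\<bar> * \<bar>u y\<bar>) * (?K x y w)"
      using \<psi>0 by (simp add: F_def G_def abs_mult indicator_def)
    also have "\<dots> \<le> (C * C) * (?K x y w)"
      using \<psi>0 C by (intro mult_right_mono mult_mono) (auto simp: indicator_def)
    finally show ?thesis using C by (subst ennreal_mult'[symmetric]) (auto intro: ennreal_leI)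
  qed
  \<comment> \<open>Absolute integrability for Fubini: bounding the minimum by d(x) and integrating
    out the Gaussian leaves C^2 times the integral of \<open>d\<close>.\<close>
  have F_int: "integrable (?P \<Otimes>\<^sub>M ?P) (\<lambda>(p, w). F p w)"
  proof (rule integrableI_bounded)
    have "(\<integral>\<^sup>+q. ennreal (norm (case q of (p, w) \<Rightarrow> F p w)) \<partial>(?P \<Otimes>\<^sub>M ?P)) = (\<integral>\<^sup>+p. (\<integral>\<^sup>+w. ennreal (norm (F p w)) \<partial>?P) \<partial>?P)"
      by (subst lborel_pair.P.nn_integral_fst[symmetric]) auto
    also have "\<dots> = (\<integral>\<^sup>+x. (\<integral>\<^sup>+y. (\<integral>\<^sup>+w. ennreal (norm (F (x, y) w)) \<partial>?P) \<partial>lborel) \<partial>lborel)"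
      by (subst lborel.nn_integral_fst[symmetric]) auto
    also have "\<dots> \<le> (\<integral>\<^sup>+x. (\<integral>\<^sup>+y. ennreal (C * C) * ennreal (normal_density 0 s (x - y) * min (d x) (d y)) \<partial>lborel) \<partial>lborel)"
    proof (intro nn_integral_mono)
      fix x y
      have "(\<integral>\<^sup>+w. ennreal (norm (F (x, y) w)) \<partial>?P) \<le> (\<integral>\<^sup>+w. ennreal (C * C) * ennreal (?K x y w) \<partial>?P)"
        by (intro nn_integral_mono Fnorm)
      also have "\<dots> = ennreal (C * C) * ennreal (normal_density 0 s (x - y) * min (d x) (d y))"
        by (subst nn_integral_cmult) (auto simp: tz)
      finally show "(\<integral>\<^sup>+w. ennreal (norm (F (x, y) w)) \<partial>?P) \<le> \<dots>" .
    qed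
    also have "\<dots> \<le> (\<integral>\<^sup>+x. (\<integral>\<^sup>+y. ennreal (C * C * d x) * ennreal (normal_density x s y) \<partial>lborel) \<partial>lborel)"
    proof (intro nn_integral_mono)
      fix x y
      have "normal_density 0 s (x - y) = normal_density x s y" by (simp add: normal_density_def power2_commute)
      then have "normal_density 0 s (x - y) * min (d x) (d y) \<le> normal_density x s y * d x"
        by (auto intro!: mult_left_mono)
      then have "C * C * (normal_density 0 s (x - y) * min (d x) (d y)) \<le> C * C * (normal_density x s y * d x)"
        using C by (intro mult_left_mono) auto
      also have "\<dots> = C * C * d x * normal_density x s y" by (simp only: mult_ac)
      finally have le: "C * C * (normal_density 0 s (x - y) * min (d x) (d y)) \<le> C * C * d x * normal_density x s y" .
      have "ennreal (C * C) * ennreal (normal_density 0 s (x - y) * min (d x) (d y))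
        = ennreal (C * C * (normal_density 0 s (x - y) * min (d x) (d y)))"
        using C by (subst ennreal_mult') auto
      also have "\<dots> \<le> ennreal (C * C * d x * normal_density x s y)" using le by (rule ennreal_leI)
      also have "\<dots> = ennreal (C * C * d x) * ennreal (normal_density x s y)"
        using C d(1)[of x] by (subst ennreal_mult) (auto simp: less_imp_le)
      finally show "ennreal (C * C) * ennreal (normal_density 0 s (x - y) * min (d x) (d y)) \<le> ennreal (C * C * d x) * ennreal (normal_density x s y)" .
    qed
    also have "\<dots> = (\<integral>\<^sup>+x. ennreal (C * C) * ennreal (d x) \<partial>lborel)"
    proof (intro nn_integral_cong)
      fix x
      have "(\<integral>\<^sup>+y. ennreal (normal_density x s y) \<partial>lborel) = 1"
        using s by (subst nn_integral_eq_integral) (auto intro: integrable_normal_density)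
      then show "(\<integral>\<^sup>+y. ennreal (C * C * d x) * ennreal (normal_density x s y) \<partial>lborel) = ennreal (C * C) * ennreal (d x)"
        using C d(1)[of x] by (simp add: nn_integral_cmult ennreal_mult less_imp_le)
    qed
    also have "\<dots> = ennreal (C * C) * (\<integral>\<^sup>+x. ennreal (d x) \<partial>lborel)" by (rule nn_integral_cmult) measurable
    also have "\<dots> < \<infinity>" using d by (simp add: nn_integral_eq_integral less_imp_le ennreal_mult_less_top)
    finally show "(\<integral>\<^sup>+q. ennreal (norm (case q of (p, w) \<Rightarrow> F p w)) \<partial>(?P \<Otimes>\<^sub>M ?P)) < \<infinity>" .
  qed measurable
  have inner: "(\<integral>w. F p w \<partial>?P) = normal_density 0 s (fst p - snd p) * min (d (fst p)) (d (snd p)) * (u (fst p) * u (snd p))" for p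
  proof -
    obtain x y where p: "p = (x, y)" by force
    have "(\<integral>w. F p w \<partial>?P) = (\<integral>w. (u x * u y) * ?K x y w \<partial>?P)"
      by (intro Bochner_Integration.integral_cong) (auto simp: F_def G_def p)
    also have "\<dots> = (u x * u y) * (\<integral>w. ?K x y w \<partial>?P)" by simp
    also have "(\<integral>w. ?K x y w \<partial>?P) = enn2real (\<integral>\<^sup>+w. ennreal (?K x y w) \<partial>?P)"
      using \<psi>0 by (intro integral_eq_nn_integral) auto
    also have "\<dots> = normal_density 0 s (x - y) * min (d x) (d y)"
      unfolding tz using d(1)[of x] d(1)[of y] by (simp add: less_imp_le min_def)
    finally show ?thesis by (simp add: p mult_ac)
  qed
  have "(\<integral>p. normal_density 0 s (fst p - snd p) * min (d (fst p)) (d (snd p)) * (u (fst p) * u (snd p)) \<partial>?P)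
    = (\<integral>p. (\<integral>w. F p w \<partial>?P) \<partial>?P)" unfolding inner ..
  also have "\<dots> = (\<integral>w. (\<integral>p. F p w \<partial>?P) \<partial>?P)"
    by (rule PP.Fubini_integral[symmetric]) (rule F_int)
  also have "0 \<le> \<dots>"
    unfolding F_def by (intro integral_nonneg_AE AE_I2 integral_product_square_nonneg)
  finally show ?thesis .
qed

subsection \<open>Random-walk Metropolis operators\<close>

definition jump_density :: "(real \<Rightarrow> real) \<Rightarrow> real \<Rightarrow> real \<Rightarrow> real \<Rightarrow> real" where
  "jump_density d s x y = 1 / s * std_normal_density ((y - x) / s) * mh_accept d x y"

definition rwm_op :: "(real \<Rightarrow> real) \<Rightarrow> real \<Rightarrow> (real \<Rightarrow> real) \<Rightarrow> real \<Rightarrow> real" where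
  "rwm_op d s g x = (\<integral>y. jump_density d s x y * g y \<partial>lborel) + (1 - (\<integral>y. jump_density d s x y \<partial>lborel)) * g x"

lemma scaled_std_normal_density:
  assumes "0 < s"
  shows "1 / s * std_normal_density (u / s) = normal_density 0 s u"
  using assms by (simp add: normal_density_def real_sqrt_mult power_divide mult.commute)

lemma jump_density_eq:
  assumes "0 < s" "0 < d x"
  shows "jump_density d s x y = normal_density 0 s (x - y) * min (d x) (d y) / d x"
proof -
  have "normal_density 0 s (y - x) = normal_density 0 s (x - y)"
    by (simp add: normal_density_def power2_commute)
  moreover have "min 1 (d y / d x) = min (d x) (d y) / d x"
    using assms by (simp add: min_divide_distrib_right)
  ultimately show ?thesis
    unfolding jump_density_def scaled_std_normal_density[OF assms(1)] mh_accept_def by simp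
qed

locale rwm =
  fixes d :: "real \<Rightarrow> real" and s :: real
  assumes d_meas [measurable]: "d \<in> borel_measurable borel" and d_gt0: "\<And>x. 0 < d x"
    and d_int: "integrable lborel d" and d_one: "(\<integral>x. d x \<partial>lborel) = 1" and s_pos: "0 < s"
begin

text \<open>Multiplying the density of accepted moves by d(x) gives the symmetric kernel; this is
  detailed balance.\<close>

sublocale reversible_jump d "\<lambda>x y. normal_density 0 s (x - y) * min (d x) (d y)"
proof
  show "(\<lambda>(x, y). normal_density 0 s (x - y) * min (d x) (d y)) \<in> borel_measurable (borel \<Otimes>\<^sub>M borel)"
    by measurable
  show "0 \<le> normal_density 0 s (x - y) * min (d x) (d y)" for x y
    using d_gt0[of x] d_gt0[of y] by (simp add: min_def less_imp_le)
  show "normal_density 0 s (x - y) * min (d x) (d y) = normal_density 0 s (y - x) * min (d y) (d x)" for x y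
    by (simp add: normal_density_def power2_commute min.commute)
  show "(\<integral>\<^sup>+y. ennreal (normal_density 0 s (x - y) * min (d x) (d y)) \<partial>lborel) \<le> ennreal (d x)" for x
  proof -
    have "(\<integral>\<^sup>+y. ennreal (normal_density 0 s (x - y) * min (d x) (d y)) \<partial>lborel)
        \<le> (\<integral>\<^sup>+y. ennreal (d x) * ennreal (normal_density x s y) \<partial>lborel)"
    proof (rule nn_integral_mono)
      fix y
      have "normal_density 0 s (x - y) = normal_density x s y" by (simp add: normal_density_def power2_commute)
      then have "normal_density 0 s (x - y) * min (d x) (d y) \<le> normal_density x s y * d x"
        by (auto intro!: mult_left_mono)
      then have "ennreal (normal_density 0 s (x - y) * min (d x) (d y)) \<le> ennreal (d x * normal_density x s y)"
        by (intro ennreal_leI) (simp add: mult.commute)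
      then show "ennreal (normal_density 0 s (x - y) * min (d x) (d y)) \<le> ennreal (d x) * ennreal (normal_density x s y)"
        using d_gt0[of x] by (simp add: ennreal_mult less_imp_le)
    qed
    also have "\<dots> = ennreal (d x) * (\<integral>\<^sup>+y. ennreal (normal_density x s y) \<partial>lborel)"
      by (rule nn_integral_cmult) measurable
    also have "(\<integral>\<^sup>+y. ennreal (normal_density x s y) \<partial>lborel) = 1"
      using s_pos by (subst nn_integral_eq_integral) (auto intro: integrable_normal_density)
    finally show ?thesis by simp
  qed
  show "0 \<le> (\<integral>p. normal_density 0 s (fst p - snd p) * min (d (fst p)) (d (snd p)) * (u (fst p) * u (snd p)) \<partial>(lborel \<Otimes>\<^sub>M lborel))"
    if "bounded_borel u" for u
    by (rule gaussian_min_psd[OF d_meas d_gt0 d_int s_pos that])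
qed (use d_gt0 d_int in auto)

lemma rwm_op_eq: "rwm_op d s g = op g"
proof
  fix x
  have "jump_density d s x y = normal_density 0 s (x - y) * min (d x) (d y) / d x" for y
    by (rule jump_density_eq) (use s_pos d_gt0 in auto)
  then have "rwm_op d s g x = (\<integral>y. (normal_density 0 s (x - y) * min (d x) (d y) * g y) / d x \<partial>lborel)
      + (1 - (\<integral>y. normal_density 0 s (x - y) * min (d x) (d y) / d x \<partial>lborel)) * g x"
    by (simp add: rwm_op_def)
  also have "\<dots> = op g x"
  proof -
    have "A / d x + (1 - B / d x) * G = (A + (d x - B) * G) / d x" for A B G
      using d_gt0[of x] by (simp add: field_simps)
    then show ?thesis by (simp only: integral_divide_zero op_def rej_def)
  qed
  finally show "rwm_op d s g x = op g x" .
qed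

lemma bounded_borel_rwm_op: "bounded_borel g \<Longrightarrow> bounded_borel (rwm_op d s g)"
  unfolding rwm_op_eq by (rule bounded_borel_op)

lemma rwm_op_diff_const:
  assumes g: "bounded_borel g"
  shows "rwm_op d s (\<lambda>x. g x - e) x = rwm_op d s g x - e"
proof -
  let ?k = "\<lambda>y. normal_density 0 s (x - y) * min (d x) (d y)"
  obtain C where C: "\<And>y. \<bar>g y\<bar> \<le> C" using bounded_borelE[OF g] by metis
  have "(\<integral>y. ?k y * (g y - e) \<partial>lborel) = (\<integral>y. ?k y * g y - ?k y * e \<partial>lborel)"
    by (simp add: right_diff_distrib)
  also have "\<dots> = (\<integral>y. ?k y * g y \<partial>lborel) - (\<integral>y. ?k y * e \<partial>lborel)"
    using bounded_borel_measurable[OF g] C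
    by (intro Bochner_Integration.integral_diff integrable_times_bounded_borel[OF k_integrable, where C=C] integrable_mult_left k_integrable) auto
  finally have "(\<integral>y. ?k y * (g y - e) \<partial>lborel) = (\<integral>y. ?k y * g y \<partial>lborel) - (\<integral>y. ?k y \<partial>lborel) * e" by simp
  then show ?thesis unfolding rwm_op_eq op_def rej_def using d_gt0[of x] by (simp add: field_simps)
qed

lemma rwm_op_norm_le:
  assumes g: "bounded_borel g"
  shows "(\<integral>x. d x * (rwm_op d s g x)\<^sup>2 \<partial>lborel) \<le> (\<integral>x. d x * (g x)\<^sup>2 \<partial>lborel)"
  unfolding rwm_op_eq using op_norm_le_form[OF g] form_le[OF g] by linarith

text \<open>The mean minimises the squared deviation, so the unspecified constant of the Poincare
  inequality can be exchanged for it.\<close>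

lemma variance_shift:
  assumes g: "bounded_borel g"
  defines "M \<equiv> \<integral>x. d x * g x \<partial>lborel"
  shows "(\<integral>x. d x * (g x - c)\<^sup>2 \<partial>lborel) = (\<integral>x. d x * (g x)\<^sup>2 \<partial>lborel) - M\<^sup>2 + (M - c)\<^sup>2"
proof -
  have "(\<integral>x. d x * (g x - c)\<^sup>2 \<partial>lborel) = (\<integral>x. d x * (g x)\<^sup>2 - (2 * c) * (d x * g x) + c\<^sup>2 * d x \<partial>lborel)"
    by (intro Bochner_Integration.integral_cong) (auto simp: power2_eq_square algebra_simps)
  also have "\<dots> = (\<integral>x. d x * (g x)\<^sup>2 \<partial>lborel) - 2 * c * M + c\<^sup>2"
    using d_times_integrable[OF g] d_times_integrable[OF bounded_borel_square[OF g]] d_int d_one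
    by (simp add: M_def)
  finally show ?thesis by (simp add: power2_eq_square algebra_simps)
qed

text \<open>A Gaussian proposal whose width matches \<open>a\<close> dominates the uniform one on
  [-a/16, a/16], so its Dirichlet form controls the box form. The Poincare constant becomes 6500 *
  16^3 * 2 = 53248000; the 1/2 in the Dirichlet form doubles it to just below 110000000.\<close>

lemma rwm_op_gap:
  assumes a: "poincare_scale d a" "a / 16 \<le> s" "s \<le> a / 4" and g: "bounded_borel g"
  shows "(\<integral>x. d x * (rwm_op d s g x)\<^sup>2 \<partial>lborel) + (\<integral>x. d x * (g x - (\<integral>x. d x * g x \<partial>lborel))\<^sup>2 \<partial>lborel) / 110000000
    \<le> (\<integral>x. d x * (g x)\<^sup>2 \<partial>lborel)"
proof -
  have a0: "0 < a" using a(3) s_pos by simp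
  define h where "h = a / 16"
  have h: "0 < h" using a0 by (simp add: h_def)
  note [measurable] = bounded_borel_measurable[OF g]
  let ?k = "\<lambda>x y. normal_density 0 s (x - y) * min (d x) (d y)"
  let ?P = "lborel \<Otimes>\<^sub>M lborel :: (real \<times> real) measure"
  let ?M = "\<integral>x. d x * g x \<partial>lborel"
  define E where "E = (\<integral>p. ?k (fst p) (snd p) * (g (fst p) - g (snd p))\<^sup>2 \<partial>?P)"
  have g2: "bounded_borel (\<lambda>x. (g x - c)\<^sup>2)" for c
    by (intro bounded_borel_square bounded_borel_diff g bounded_borel_const)
  have nn_d: "(\<integral>\<^sup>+x. ennreal (d x * (g x - c)\<^sup>2) \<partial>lborel) = ennreal (\<integral>x. d x * (g x - c)\<^sup>2 \<partial>lborel)" for c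
    using d_times_integrable[OF g2[of c]] d_gt0 by (intro nn_integral_eq_integral) (auto simp: less_imp_le)
  have "(\<integral>\<^sup>+x. ennreal (d x * (g x)\<^sup>2) \<partial>lborel) < \<infinity>" using nn_d[of 0] by simp
  then obtain c where c: "(\<integral>\<^sup>+x. ennreal (d x * (g x - c)\<^sup>2) \<partial>lborel) \<le> ennreal (6500 * a\<^sup>2 / h ^ 3) * box_form d h g"
    using poincare_scaleD[OF a(1) h, of g] by (auto simp: h_def)
  have "ennreal (1 / (2 * a)) * box_form d h g \<le> ennreal E"
  proof -
    \<comment> \<open>From h <= s the exponential is at least exp (-1/2) >= 1/2, and from s <= a / 4
      the normalisation sqrt (2 pi) s is at most 3 a / 4.\<close>
    have low: "1 / (2 * a) \<le> normal_density 0 s u" if "\<bar>u\<bar> \<le> h" for u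
    proof -
      have "u\<^sup>2 \<le> h\<^sup>2" using that h by (intro abs_le_square_iff[THEN iffD1]) auto
      also have "h\<^sup>2 \<le> s\<^sup>2" using a(2) h by (intro power_mono) (auto simp: h_def)
      finally have "u\<^sup>2 / (2 * s\<^sup>2) \<le> 1/2" using s_pos by (simp add: field_simps)
      then have "exp (- (1/2)) \<le> exp (- (u\<^sup>2 / (2 * s\<^sup>2)))" by simp
      moreover have "1/2 \<le> exp (- (1/2) :: real)" using exp_ge_add_one_self[of "- (1/2) :: real"] by simp
      ultimately have e: "1/2 \<le> exp (- (u\<^sup>2 / (2 * s\<^sup>2)))" by linarith
      have "sqrt (2 * pi * s\<^sup>2) \<le> sqrt ((a / 4 * 3)\<^sup>2)"
      proof (rule real_sqrt_le_mono)
        have "2 * pi \<le> 9" using pi_less_4 by simp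
        then have "2 * pi * s\<^sup>2 \<le> 9 * (a / 4)\<^sup>2" using s_pos a(3) by (intro mult_mono power_mono) auto
        then show "2 * pi * s\<^sup>2 \<le> (a / 4 * 3)\<^sup>2" by (simp add: power2_eq_square)
      qed
      then have r: "sqrt (2 * pi * s\<^sup>2) \<le> a" using a0 by simp
      have "1 / (2 * a) = 1 / a * (1/2)" by simp
      also have "\<dots> \<le> 1 / sqrt (2 * pi * s\<^sup>2) * exp (- (u\<^sup>2 / (2 * s\<^sup>2)))"
        using r e a0 s_pos by (intro mult_mono divide_left_mono mult_pos_pos) auto
      also have "\<dots> = normal_density 0 s u" by (simp add: normal_density_def)
      finally show ?thesis .
    qed
    have "ennreal (1 / (2 * a)) * box_form d h g
       = (\<integral>\<^sup>+u. ennreal (1 / (2 * a)) * ((\<integral>\<^sup>+x. ennreal (min (d x) (d (x + u)) * (g x - g (x + u))\<^sup>2) \<partial>lborel) * indicator {-h..h} u) \<partial>lborel)"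
      unfolding box_form_def by (rule nn_integral_cmult[symmetric]) measurable
    also have "\<dots> \<le> (\<integral>\<^sup>+u. (\<integral>\<^sup>+x. ennreal (?k x (x + u) * (g x - g (x + u))\<^sup>2) \<partial>lborel) \<partial>lborel)"
    proof (rule nn_integral_mono)
      fix u :: real
      show "ennreal (1 / (2 * a)) * ((\<integral>\<^sup>+x. ennreal (min (d x) (d (x + u)) * (g x - g (x + u))\<^sup>2) \<partial>lborel) * indicator {-h..h} u)
         \<le> (\<integral>\<^sup>+x. ennreal (?k x (x + u) * (g x - g (x + u))\<^sup>2) \<partial>lborel)"
      proof (cases "u \<in> {-h..h}")
        case True
        then have l: "1 / (2 * a) \<le> normal_density 0 s (x - (x + u))" for x
          using low[of "- u"] by (simp add: abs_le_iff)
        have "ennreal (1 / (2 * a)) * (\<integral>\<^sup>+x. ennreal (min (d x) (d (x + u)) * (g x - g (x + u))\<^sup>2) \<partial>lborel)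
          = (\<integral>\<^sup>+x. ennreal (1 / (2 * a)) * ennreal (min (d x) (d (x + u)) * (g x - g (x + u))\<^sup>2) \<partial>lborel)"
          by (rule nn_integral_cmult[symmetric]) measurable
        also have "\<dots> \<le> (\<integral>\<^sup>+x. ennreal (?k x (x + u) * (g x - g (x + u))\<^sup>2) \<partial>lborel)"
        proof (rule nn_integral_mono)
          fix x
          have mn: "0 \<le> min (d x) (d (x + u)) * (g x - g (x + u))\<^sup>2"
            using d_gt0[of x] d_gt0[of "x + u"] by (simp add: min_def less_imp_le)
          have "1 / (2 * a) * (min (d x) (d (x + u)) * (g x - g (x + u))\<^sup>2)
              \<le> normal_density 0 s (x - (x + u)) * (min (d x) (d (x + u)) * (g x - g (x + u))\<^sup>2)"
            using l mn by (rule mult_right_mono)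
          then have "ennreal (1 / (2 * a) * (min (d x) (d (x + u)) * (g x - g (x + u))\<^sup>2)) \<le> ennreal (?k x (x + u) * (g x - g (x + u))\<^sup>2)"
            by (intro ennreal_leI) (simp only: mult.assoc)
          then show "ennreal (1 / (2 * a)) * ennreal (min (d x) (d (x + u)) * (g x - g (x + u))\<^sup>2) \<le> ennreal (?k x (x + u) * (g x - g (x + u))\<^sup>2)"
            using mn a0 by (subst ennreal_mult[symmetric]) auto
        qed
        finally show ?thesis using True by simp
      qed simp
    qed
    also have "\<dots> = (\<integral>\<^sup>+x. (\<integral>\<^sup>+u. ennreal (?k x (x + u) * (g x - g (x + u))\<^sup>2) \<partial>lborel) \<partial>lborel)"
      by (rule lborel_pair.Fubini') measurable
    also have "\<dots> = (\<integral>\<^sup>+x. (\<integral>\<^sup>+y. ennreal (?k x y * (g x - g y)\<^sup>2) \<partial>lborel) \<partial>lborel)"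
    proof (rule nn_integral_cong)
      fix x :: real
      have "(\<integral>\<^sup>+y. ennreal (?k x y * (g x - g y)\<^sup>2) \<partial>lborel) = (\<integral>\<^sup>+u. ennreal (?k x (x + 1 * u) * (g x - g (x + 1 * u))\<^sup>2) \<partial>lborel)"
        by (subst nn_integral_real_affine[where c=1 and t=x]) auto
      then show "(\<integral>\<^sup>+u. ennreal (?k x (x + u) * (g x - g (x + u))\<^sup>2) \<partial>lborel) = (\<integral>\<^sup>+y. ennreal (?k x y * (g x - g y)\<^sup>2) \<partial>lborel)"
        by simp
    qed
    also have "\<dots> = (\<integral>\<^sup>+p. ennreal (?k (fst p) (snd p) * (g (fst p) - g (snd p))\<^sup>2) \<partial>?P)"
      by (subst lborel.nn_integral_fst[symmetric]) auto
    also have "\<dots> = ennreal E"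
      unfolding E_def using dirichlet_identity(2)[OF g] k_nonneg by (intro nn_integral_eq_integral) auto
    finally show ?thesis .
  qed
  then have E1: "ennreal (2 * a) * (ennreal (1 / (2 * a)) * box_form d h g) \<le> ennreal (2 * a) * ennreal E"
    by (intro mult_left_mono) auto
  have "ennreal (2 * a) * ennreal (1 / (2 * a)) = 1"
    using a0 by (simp add: ennreal_mult[symmetric])
  then have E2: "box_form d h g \<le> ennreal (2 * a * E)"
    using E1 a0 by (simp add: mult.assoc[symmetric] ennreal_mult')
  have E0: "0 \<le> E" unfolding E_def using k_nonneg by (intro integral_nonneg_AE) auto
  have "ennreal (\<integral>x. d x * (g x - c)\<^sup>2 \<partial>lborel) \<le> ennreal (6500 * a\<^sup>2 / h ^ 3) * ennreal (2 * a * E)"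
    using order_trans[OF c mult_left_mono[OF E2]] unfolding nn_d by simp
  also have "\<dots> = ennreal (6500 * a\<^sup>2 / h ^ 3 * (2 * a * E))"
    using h a0 E0 by (subst ennreal_mult) auto
  also have "6500 * a\<^sup>2 / h ^ 3 * (2 * a * E) = 53248000 * E"
    using a0 by (simp add: h_def power2_eq_square power3_eq_cube)
  finally have "(\<integral>x. d x * (g x - c)\<^sup>2 \<partial>lborel) \<le> 53248000 * E" using E0 by simp
  moreover have "(\<integral>x. d x * (g x - ?M)\<^sup>2 \<partial>lborel) \<le> (\<integral>x. d x * (g x - c)\<^sup>2 \<partial>lborel)"
    unfolding variance_shift[OF g] by simp
  ultimately have V: "(\<integral>x. d x * (g x - ?M)\<^sup>2 \<partial>lborel) \<le> 53248000 * E" by linarith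
  have "(\<integral>x. d x * (rwm_op d s g x)\<^sup>2 \<partial>lborel) \<le> (\<integral>x. d x * (g x)\<^sup>2 \<partial>lborel) - E / 2"
    unfolding rwm_op_eq E_def by (rule op_contraction[OF g])
  moreover have "(\<integral>x. d x * (g x - ?M)\<^sup>2 \<partial>lborel) / 110000000 \<le> E / 2"
    using V E0 by (simp add: field_simps)
  ultimately show ?thesis by linarith
qed

end

section \<open>Averaging over the scales\<close>

definition multiscale_op ::
    "nat \<Rightarrow> (nat \<Rightarrow> real) \<Rightarrow> (nat \<Rightarrow> real) \<Rightarrow> (real \<Rightarrow> real) \<Rightarrow> (real \<Rightarrow> real) \<Rightarrow> real \<Rightarrow> real" where
  "multiscale_op J w s d g x = (\<Sum>j\<in>{1..J}. w j * rwm_op d (s j) g x)"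

lemma weighted_sum_square_le:
  fixes w y :: "'i \<Rightarrow> real"
  assumes w: "\<And>i. i \<in> I \<Longrightarrow> 0 \<le> w i" and one: "sum w I = 1"
  shows "(\<Sum>i\<in>I. w i * y i)\<^sup>2 \<le> (\<Sum>i\<in>I. w i * (y i)\<^sup>2)"
proof -
  have "(\<Sum>i\<in>I. w i * y i)\<^sup>2 = (\<Sum>i\<in>I. sqrt (w i) * (sqrt (w i) * y i))\<^sup>2"
    using w by (auto simp: mult.assoc[symmetric] intro!: arg_cong[where f="\<lambda>z. z\<^sup>2"] sum.cong)
  also have "\<dots> \<le> (\<Sum>i\<in>I. (sqrt (w i))\<^sup>2) * (\<Sum>i\<in>I. (sqrt (w i) * y i)\<^sup>2)"
    by (rule Cauchy_Schwarz_ineq_sum)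
  also have "\<dots> = sum w I * (\<Sum>i\<in>I. w i * (y i)\<^sup>2)"
    using w by (auto simp: power_mult_distrib intro!: arg_cong2[where f="(*)"] sum.cong)
  finally show ?thesis by (simp add: one)
qed

text \<open>Below 2^N the integer part of the binary logarithm of \<open>X\<close> serves; otherwise
  N itself does, because X <= 4 * 2^N. The factor 16 allows slack for both cases.\<close>

lemma dyadic_scale_exists:
  fixes X :: real
  assumes "1 \<le> X" "X \<le> 4 * 2 ^ N"
  obtains i :: nat where "i \<le> N" "2 ^ i \<le> X" "X \<le> 16 * 2 ^ i"
proof (cases "2 ^ N \<le> X")
  case True
  then show thesis using that[of N] assms by simp
next
  case False
  then have "\<exists>k. X < 2 ^ k" by (intro exI[of _ N]) simp
  define k where "k = (LEAST k. X < 2 ^ k)"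
  have k: "X < 2 ^ k" unfolding k_def by (rule LeastI_ex) fact
  have kN: "k \<le> N" unfolding k_def using False by (intro Least_le) simp
  obtain i where i: "k = Suc i" using k assms(1) by (cases k) auto
  have "\<not> X < 2 ^ i" using i not_less_Least[of i "\<lambda>k. X < 2 ^ k"] unfolding k_def by simp
  moreover have "X \<le> 2 * 2 ^ i" using k i by simp
  moreover have "(0::real) < 2 ^ i" by simp
  ultimately have "2 ^ i \<le> X" "X \<le> 16 * 2 ^ i" by linarith+
  then show thesis using that[of i] i kN by simp
qed

text \<open>In terms of X = L a^2 / 16 the bounds on \<open>a\<close> say 1 <= X <= 4 L / m, and the
  window a / 16 <= s <= a / 4 says 2^i <= X <= 16 * 2^i for s^2 = 2^i / L.\<close>

lemma matching_scale_exists: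
  assumes mL: "0 < m" "m \<le> L" and J: "J = 1 + nat \<lceil>log 2 (L / m)\<rceil>"
    and s: "\<And>j. j \<in> {1..J} \<Longrightarrow> 0 < s j \<and> (s j)\<^sup>2 = 2 ^ (j - 1) / L"
    and a: "0 < a" "16 \<le> L * a\<^sup>2" "m * a\<^sup>2 \<le> 64"
  obtains j where "j \<in> {1..J}" "a / 16 \<le> s j" "s j \<le> a / 4"
proof -
  define N where "N = nat \<lceil>log 2 (L / m)\<rceil>"
  have "L / m = 2 powr (log 2 (L / m))" using mL by simp
  also have "\<dots> \<le> 2 powr real N" unfolding N_def by (intro powr_mono real_nat_ceiling_ge) auto
  finally have LN: "L / m \<le> 2 ^ N" by (simp add: powr_realpow)
  have "L * a\<^sup>2 / 16 \<le> L * (64 / m) / 16"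
    using a(3) mL by (intro divide_right_mono mult_left_mono) (auto simp: field_simps)
  also have "\<dots> = 4 * (L / m)" by simp
  also have "\<dots> \<le> 4 * 2 ^ N" using LN by simp
  finally obtain i where i: "i \<le> N" "2 ^ i \<le> L * a\<^sup>2 / 16" "L * a\<^sup>2 / 16 \<le> 16 * 2 ^ i"
    using dyadic_scale_exists[of "L * a\<^sup>2 / 16" N] a(2) by auto
  \<comment> \<open>Scales are numbered from 1 with exponent j - 1, so i <= N = J - 1 corresponds to
    an admissible index.\<close>
  have j: "Suc i \<in> {1..J}" using i(1) by (simp add: J N_def)
  have sj: "0 < s (Suc i)" "(s (Suc i))\<^sup>2 = 2 ^ i / L" using s[OF j] by auto
  have "a / 16 \<le> s (Suc i)"
  proof (rule power2_le_imp_le)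
    show "(a / 16)\<^sup>2 \<le> (s (Suc i))\<^sup>2" unfolding sj(2) using i(3) mL by (simp add: power_divide field_simps)
  qed (use sj in auto)
  moreover have "s (Suc i) \<le> a / 4"
  proof (rule power2_le_imp_le)
    show "(s (Suc i))\<^sup>2 \<le> (a / 4)\<^sup>2" unfolding sj(2) using i(2) mL by (simp add: power_divide field_simps)
  qed (use a in auto)
  ultimately show thesis using that j by blast
qed

text \<open>By convexity of the square the mixture is no worse than the average of its components.
  Each component is a contraction, and the matching one contributes its gap with weight 1 / J. The
  centring \<open>e\<close> is arbitrary because the operators fix constants; centring at the
  conditional mean is needed later.\<close>

theorem multiscale_op_gap:
  fixes V :: "real \<Rightarrow> real"
  assumes V: "strongly_convex m V" "midpoint_smooth L V" and mL: "0 < m" "m \<le> L"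
    and one: "(\<integral>x. exp (- V x) \<partial>lborel) = 1"
    and J: "J = 1 + nat \<lceil>log 2 (L / m)\<rceil>"
    and w: "\<And>j. j \<in> {1..J} \<Longrightarrow> w j = 1 / real J"
    and s: "\<And>j. j \<in> {1..J} \<Longrightarrow> 0 < s j \<and> (s j)\<^sup>2 = 2 ^ (j - 1) / L"
    and g: "bounded_borel g"
  defines "d \<equiv> \<lambda>x. exp (- V x)"
  shows "(\<integral>x. d x * (multiscale_op J w s d g x - e)\<^sup>2 \<partial>lborel)
      + (\<integral>x. d x * (g x - (\<integral>x. d x * g x \<partial>lborel))\<^sup>2 \<partial>lborel) / (110000000 * real J)
    \<le> (\<integral>x. d x * (g x - e)\<^sup>2 \<partial>lborel)"
proof -
  have J0: "0 < J" by (simp add: J)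
  have w0: "0 \<le> w j" if "j \<in> {1..J}" for j using w[OF that] by simp
  have w1: "sum w {1..J} = 1" using w J0 by simp
  have [measurable]: "V \<in> borel_measurable borel"
    using strongly_convex_continuous[OF V(1)] mL by (intro borel_measurable_continuous_onI) auto
  have rwm: "rwm d (s j)" if "j \<in> {1..J}" for j
    using s[OF that] one strongly_convex_integrable[OF V(1) mL(1)] by unfold_locales (auto simp: d_def)
  have one_mem: "1 \<in> {1..J}" using J0 by simp
  interpret R1: rwm d "s 1" by (rule rwm[OF one_mem])
  obtain a where a: "0 < a" "16 \<le> L * a\<^sup>2" "m * a\<^sup>2 \<le> 64" "poincare_scale d a"
    unfolding d_def by (rule box_poincare[OF V mL(1)])
  obtain i where i: "i \<in> {1..J}" "a / 16 \<le> s i" "s i \<le> a / 4"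
    by (rule matching_scale_exists[OF mL J s a(1-3)]) auto
  define G where "G x = g x - e" for x
  have G: "bounded_borel G" unfolding G_def by (intro bounded_borel_diff g bounded_borel_const)
  let ?Q = "\<lambda>f. \<integral>x. d x * (f x)\<^sup>2 \<partial>lborel"
  let ?Vr = "\<integral>x. d x * (g x - (\<integral>x. d x * g x \<partial>lborel))\<^sup>2 \<partial>lborel"
  have "(\<integral>x. d x * G x \<partial>lborel) = (\<integral>x. d x * g x - d x * e \<partial>lborel)"
    by (simp add: G_def right_diff_distrib)
  also have "\<dots> = (\<integral>x. d x * g x \<partial>lborel) - e"
    using R1.d_times_integrable[OF g] R1.d_int R1.d_one by simp
  finally have VG: "(\<integral>x. d x * (G x - (\<integral>x. d x * G x \<partial>lborel))\<^sup>2 \<partial>lborel) = ?Vr"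
    by (simp add: G_def)
  have bG: "bounded_borel (rwm_op d (s j) G)" if "j \<in> {1..J}" for j
    by (rule rwm.bounded_borel_rwm_op[OF rwm[OF that] G])
  have iG: "integrable lborel (\<lambda>x. d x * (rwm_op d (s j) G x)\<^sup>2)" if "j \<in> {1..J}" for j
    by (intro R1.d_times_integrable bounded_borel_square bG that)
  have le: "?Q (rwm_op d (s j) G) + (if j = i then ?Vr / 110000000 else 0) \<le> ?Q G" if "j \<in> {1..J}" for j
    using rwm.rwm_op_norm_le[OF rwm[OF that] G] rwm.rwm_op_gap[OF rwm[OF i(1)] a(4) i(2,3) G]
    unfolding VG by auto
  have "multiscale_op J w s d g x - e = (\<Sum>j\<in>{1..J}. w j * rwm_op d (s j) G x)" for x
  proof -
    have "(\<Sum>j\<in>{1..J}. w j * rwm_op d (s j) G x) = (\<Sum>j\<in>{1..J}. w j * rwm_op d (s j) g x - w j * e)"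
      unfolding G_def using rwm.rwm_op_diff_const[OF rwm g]
      by (intro sum.cong) (auto simp: right_diff_distrib)
    also have "\<dots> = multiscale_op J w s d g x - sum w {1..J} * e"
      by (simp add: multiscale_op_def sum_subtractf sum_distrib_right)
    finally show ?thesis using w1 by simp
  qed
  then have "(\<integral>x. d x * (multiscale_op J w s d g x - e)\<^sup>2 \<partial>lborel)
      = (\<integral>x. d x * (\<Sum>j\<in>{1..J}. w j * rwm_op d (s j) G x)\<^sup>2 \<partial>lborel)" by simp
  also have "\<dots> \<le> (\<integral>x. (\<Sum>j\<in>{1..J}. w j * (d x * (rwm_op d (s j) G x)\<^sup>2)) \<partial>lborel)"
  proof (rule integral_mono')
    show "integrable lborel (\<lambda>x. \<Sum>j\<in>{1..J}. w j * (d x * (rwm_op d (s j) G x)\<^sup>2))"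
      using iG by (intro Bochner_Integration.integrable_sum integrable_mult_right) auto
    fix x
    have "d x * (\<Sum>j\<in>{1..J}. w j * rwm_op d (s j) G x)\<^sup>2 \<le> d x * (\<Sum>j\<in>{1..J}. w j * (rwm_op d (s j) G x)\<^sup>2)"
      using w0 w1 R1.d_gt0[of x] by (intro mult_left_mono weighted_sum_square_le) auto
    then show "d x * (\<Sum>j\<in>{1..J}. w j * rwm_op d (s j) G x)\<^sup>2 \<le> (\<Sum>j\<in>{1..J}. w j * (d x * (rwm_op d (s j) G x)\<^sup>2))"
      by (simp add: sum_distrib_left mult.left_commute)
    show "0 \<le> (\<Sum>j\<in>{1..J}. w j * (d x * (rwm_op d (s j) G x)\<^sup>2))"
      using w0 R1.d_gt0[of x] by (intro sum_nonneg mult_nonneg_nonneg) auto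
  qed
  also have "\<dots> = (\<Sum>j\<in>{1..J}. w j * ?Q (rwm_op d (s j) G))"
    using iG by (subst Bochner_Integration.integral_sum) auto
  also have "\<dots> \<le> (\<Sum>j\<in>{1..J}. w j * (?Q G - (if j = i then ?Vr / 110000000 else 0)))"
    using le w0 by (intro sum_mono mult_left_mono) (auto simp: le_diff_eq)
  also have "\<dots> = sum w {1..J} * ?Q G - (\<Sum>j\<in>{1..J}. if j = i then w j * (?Vr / 110000000) else 0)"
    by (simp add: right_diff_distrib sum_subtractf sum_distrib_right if_distrib[of "\<lambda>z. w _ * z"] cong: if_cong)
  also have "\<dots> = ?Q G - w i * (?Vr / 110000000)" using i(1) w1 by simp
  also have "\<dots> = ?Q G - ?Vr / (110000000 * real J)" using w[OF i(1)] by simp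
  finally show ?thesis by (simp add: G_def)
qed

subsection \<open>Metropolis kernels as measures\<close>

text \<open>The common shape of the single-scale kernel, a density plus an atom, and of the average
  over scales; countable additivity is checked once for both.\<close>

definition mixture :: "'i set \<Rightarrow> ('i \<Rightarrow> ennreal) \<Rightarrow> ('i \<Rightarrow> 'a::topological_space measure) \<Rightarrow> 'a measure" where
  "mixture I c N = measure_of UNIV (sets borel) (\<lambda>A. \<Sum>i\<in>I. c i * emeasure (N i) A)"

lemma sigma_algebra_borel: "sigma_algebra UNIV (sets (borel :: 'a::topological_space measure))"
  by (metis sets.sigma_algebra_axioms space_borel)

lemma sets_mixture [simp, measurable_cong]: "sets (mixture I c N) = sets borel"
  unfolding mixture_def by (simp add: sigma_algebra.sets_measure_of_eq[OF sigma_algebra_borel])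

lemma space_mixture [simp]: "space (mixture I c N) = UNIV"
  unfolding mixture_def by (simp add: space_measure_of_conv)

lemma emeasure_mixture:
  fixes N :: "'i \<Rightarrow> 'a::topological_space measure"
  assumes N: "\<And>i. i \<in> I \<Longrightarrow> sets (N i) = sets borel" and A: "A \<in> sets borel"
  shows "emeasure (mixture I c N) A = (\<Sum>i\<in>I. c i * emeasure (N i) A)"
  unfolding mixture_def
proof (rule emeasure_measure_of_sigma[OF sigma_algebra_borel _ _ A])
  show "positive (sets borel) (\<lambda>A. \<Sum>i\<in>I. c i * emeasure (N i) A)"
    by (simp add: positive_def)
  show "countably_additive (sets borel) (\<lambda>A. \<Sum>i\<in>I. c i * emeasure (N i) A)"
  proof (rule countably_additiveI)
    fix B :: "nat \<Rightarrow> 'a set" assume B: "range B \<subseteq> sets borel" "disjoint_family B"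
    have "(\<Sum>n. \<Sum>i\<in>I. c i * emeasure (N i) (B n)) = (\<Sum>i\<in>I. \<Sum>n. c i * emeasure (N i) (B n))"
      by (rule suminf_sum) (rule summableI)
    also have "\<dots> = (\<Sum>i\<in>I. c i * emeasure (N i) (\<Union>n. B n))"
      using B N by (intro sum.cong) (auto simp: suminf_emeasure)
    finally show "(\<Sum>n. \<Sum>i\<in>I. c i * emeasure (N i) (B n)) = (\<Sum>i\<in>I. c i * emeasure (N i) (\<Union>n. B n))" .
  qed
qed

lemma nn_integral_mixture:
  fixes N :: "'i \<Rightarrow> 'a::topological_space measure"
  assumes N: "\<And>i. i \<in> I \<Longrightarrow> sets (N i) = sets borel" and f: "f \<in> borel_measurable borel"
  shows "(\<integral>\<^sup>+x. f x \<partial>mixture I c N) = (\<Sum>i\<in>I. c i * (\<integral>\<^sup>+x. f x \<partial>N i))"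
  using f
proof (induction rule: borel_measurable_induct)
  case (cong f g)
  have "(\<integral>\<^sup>+x. f x \<partial>M) = (\<integral>\<^sup>+x. g x \<partial>M)" for M :: "'a measure"
    using cong(3) by (intro nn_integral_cong) simp
  then show ?case using cong(4) by simp
next
  case (set A)
  then show ?case using N by (simp add: emeasure_mixture)
next
  case (mult u a)
  have "(\<integral>\<^sup>+x. a * u x \<partial>M) = a * (\<integral>\<^sup>+x. u x \<partial>M)" if "sets M = sets borel" for M :: "'a measure"
    using mult that by (intro nn_integral_cmult) (simp add: measurable_cong_sets[OF that])
  then show ?case using N mult by (simp add: sum_distrib_left mult.left_commute)
next
  case (add u v)
  have "(\<integral>\<^sup>+x. v x + u x \<partial>M) = (\<integral>\<^sup>+x. v x \<partial>M) + (\<integral>\<^sup>+x. u x \<partial>M)" if "sets M = sets borel" for M :: "'a measure"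
    using add that by (intro nn_integral_add) (simp_all add: measurable_cong_sets[OF that])
  then show ?case using N add by (simp add: sum.distrib distrib_left)
next
  case (seq U)
  have sup: "(\<integral>\<^sup>+x. (SUP n. U n) x \<partial>M) = (SUP n. \<integral>\<^sup>+x. U n x \<partial>M)" if "sets M = sets borel" for M :: "'a measure"
    unfolding SUP_apply using seq that
    by (intro nn_integral_monotone_convergence_SUP) (simp_all add: measurable_cong_sets[OF that])
  have inc: "incseq (\<lambda>n. \<integral>\<^sup>+x. U n x \<partial>M)" for M :: "'a measure"
    using seq by (intro monoI nn_integral_mono) (auto simp: incseq_def le_fun_def)
  have "(\<integral>\<^sup>+x. (SUP n. U n) x \<partial>mixture I c N) = (SUP n. \<Sum>i\<in>I. c i * (\<integral>\<^sup>+x. U n x \<partial>N i))"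
    unfolding sup[OF sets_mixture] using seq(5) by simp
  also have "\<dots> = (\<Sum>i\<in>I. SUP n. c i * (\<integral>\<^sup>+x. U n x \<partial>N i))"
    using inc by (intro ennreal_SUP_sum) (auto intro!: monoI mult_left_mono dest: incseqD)
  also have "\<dots> = (\<Sum>i\<in>I. c i * (\<integral>\<^sup>+x. (SUP n. U n) x \<partial>N i))"
  proof (intro sum.cong refl)
    fix i assume i: "i \<in> I"
    show "(SUP n. c i * (\<integral>\<^sup>+x. U n x \<partial>N i)) = c i * (\<integral>\<^sup>+x. (SUP n. U n) x \<partial>N i)"
      unfolding sup[OF N[OF i]] by (rule SUP_mult_left_ennreal[symmetric])
  qed
  finally show ?case .
qed

lemma integral_mixture:
  fixes N :: "'i \<Rightarrow> 'a::topological_space measure"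
  assumes N: "\<And>i. i \<in> I \<Longrightarrow> sets (N i) = sets borel" "\<And>i. i \<in> I \<Longrightarrow> finite_measure (N i)"
    and c: "\<And>i. i \<in> I \<Longrightarrow> 0 \<le> c i" and f: "bounded_borel f"
  shows "finite_measure (mixture I (\<lambda>i. ennreal (c i)) N)"
    "(\<integral>x. f x \<partial>mixture I (\<lambda>i. ennreal (c i)) N) = (\<Sum>i\<in>I. c i * (\<integral>x. f x \<partial>N i))"
proof -
  let ?M = "mixture I (\<lambda>i. ennreal (c i)) N"
  obtain C where C: "0 \<le> C" "\<And>x. \<bar>f x\<bar> \<le> C" using bounded_borelE[OF f] by metis
  have fm: "f \<in> borel_measurable borel" by (rule bounded_borel_measurable[OF f])
  have sp: "space (N i) = UNIV" if "i \<in> I" for i using sets_eq_imp_space_eq[OF N(1)[OF that]] by simp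
  have "emeasure (N i) UNIV < \<infinity>" if "i \<in> I" for i
    using finite_measure.emeasure_finite[OF N(2)[OF that], of UNIV] by (simp add: less_top)
  then have "(\<Sum>i\<in>I. ennreal (c i) * emeasure (N i) UNIV) < \<infinity>"
    by (cases "finite I") (auto simp: ennreal_mult_less_top ennreal_sum_less_top)
  then have fin: "emeasure ?M UNIV < \<infinity>"
    using N by (subst emeasure_mixture) auto
  then show "finite_measure ?M" by (intro finite_measureI) auto
  then interpret M: finite_measure ?M .
  have mN: "h \<in> borel_measurable (N i)" if "h \<in> borel_measurable borel" "i \<in> I" for h :: "'a \<Rightarrow> real" and i
    using that(1) unfolding measurable_cong_sets[OF N(1)[OF that(2)] refl] .
  have mM: "h \<in> borel_measurable ?M" if "h \<in> borel_measurable borel" for h :: "'a \<Rightarrow> real"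
    using that unfolding measurable_cong_sets[OF sets_mixture refl] .
  have int_pos: "(\<integral>x. g x \<partial>?M) = (\<Sum>i\<in>I. c i * (\<integral>x. g x \<partial>N i))"
    if g: "g \<in> borel_measurable borel" "\<And>x. 0 \<le> g x" "\<And>x. g x \<le> D" for g D
  proof -
    have gi: "(\<integral>\<^sup>+x. ennreal (g x) \<partial>N i) = ennreal (\<integral>x. g x \<partial>N i)" if i: "i \<in> I" for i
    proof -
      interpret Ni: finite_measure "N i" by (rule N(2)[OF i])
      have "integrable (N i) g"
        using g(2,3) by (intro Ni.integrable_const_bound[where B=D] mN[OF g(1) i]) auto
      then show ?thesis using g by (intro nn_integral_eq_integral) auto
    qed
    have "(\<integral>x. g x \<partial>?M) = enn2real (\<integral>\<^sup>+x. ennreal (g x) \<partial>?M)"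
      using g(2) by (intro integral_eq_nn_integral mM[OF g(1)]) auto
    also have "(\<integral>\<^sup>+x. ennreal (g x) \<partial>?M) = (\<Sum>i\<in>I. ennreal (c i) * ennreal (\<integral>x. g x \<partial>N i))"
      using N g by (subst nn_integral_mixture) (auto simp: gi)
    also have "\<dots> = (\<Sum>i\<in>I. ennreal (c i * (\<integral>x. g x \<partial>N i)))"
      using c g by (intro sum.cong) (auto simp: ennreal_mult)
    also have "\<dots> = ennreal (\<Sum>i\<in>I. c i * (\<integral>x. g x \<partial>N i))"
      using c g by (intro sum_ennreal) (auto intro!: mult_nonneg_nonneg integral_nonneg_AE)
    also have "enn2real \<dots> = (\<Sum>i\<in>I. c i * (\<integral>x. g x \<partial>N i))"
      using c g by (intro enn2real_ennreal sum_nonneg mult_nonneg_nonneg integral_nonneg_AE) auto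
    finally show ?thesis .
  qed
  \<comment> \<open>Shifting by the bound makes the integrand nonnegative; the shift is subtracted
    again through the constant function.\<close>
  have fC: "0 \<le> f x + C" "f x + C \<le> 2 * C" for x using C(2)[of x] by auto
  have "(\<integral>x. f x + C \<partial>?M) = (\<Sum>i\<in>I. c i * (\<integral>x. f x + C \<partial>N i))"
    by (rule int_pos[of "\<lambda>x. f x + C" "2 * C"]) (use fm fC in auto)
  moreover have "(\<integral>x. C \<partial>?M) = (\<Sum>i\<in>I. c i * (\<integral>x. C \<partial>N i))"
    by (rule int_pos[of "\<lambda>x. C" C]) (use C in auto)
  moreover have "(\<integral>x. f x + C \<partial>?M) = (\<integral>x. f x \<partial>?M) + (\<integral>x. C \<partial>?M)"
    using C by (intro Bochner_Integration.integral_add M.integrable_const_bound[where B=C] mM fm) auto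
  moreover have "(\<integral>x. f x + C \<partial>N i) = (\<integral>x. f x \<partial>N i) + (\<integral>x. C \<partial>N i)" if i: "i \<in> I" for i
  proof -
    interpret Ni: finite_measure "N i" by (rule N(2)[OF i])
    show ?thesis
      using C by (intro Bochner_Integration.integral_add Ni.integrable_const_bound[where B=C] mN fm i) auto
  qed
  ultimately show "(\<integral>x. f x \<partial>?M) = (\<Sum>i\<in>I. c i * (\<integral>x. f x \<partial>N i))"
    by (simp add: distrib_left sum.distrib)
qed

context rwm
begin

lemma jump_density_integral_le: "(\<integral>y. jump_density d s x y \<partial>lborel) \<le> 1"
  and jump_density_nonneg: "0 \<le> jump_density d s x y"
  and jump_density_integrable: "integrable lborel (jump_density d s x)"
proof -
  have eq: "jump_density d s x y = normal_density 0 s (x - y) * min (d x) (d y) / d x" for x y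
    by (rule jump_density_eq) (use s_pos d_gt0 in auto)
  show "(\<integral>y. jump_density d s x y \<partial>lborel) \<le> 1"
    unfolding eq using k_integral_le[of x] d_gt0[of x] by simp
  show "0 \<le> jump_density d s x y"
    unfolding eq using k_nonneg[of x y] d_gt0[of x] by simp
  show "integrable lborel (jump_density d s x)"
    unfolding eq using k_integrable[of x] by simp
qed

lemma rwm_kernel_mixture:
  "rwm_kernel d s x = mixture {False, True}
     (\<lambda>b. ennreal (if b then 1 else 1 - (\<integral>y. jump_density d s x y \<partial>lborel)))
     (\<lambda>b. if b then density lborel (\<lambda>y. ennreal (jump_density d s x y)) else return borel x)"
proof -
  have [measurable]: "(\<lambda>y. jump_density d s x y) \<in> borel_measurable borel"
    using borel_measurable_integrable[OF jump_density_integrable[of x]] by simp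
  show ?thesis
    unfolding rwm_kernel_def mixture_def jump_density_def[symmetric]
  proof (rule measure_of_eq)
    fix A assume "A \<in> sigma_sets UNIV (sets (borel :: real measure))"
    then have A: "A \<in> sets borel" by (metis sets.sigma_sets_eq space_borel)
    show "(\<integral>\<^sup>+y\<in>A. ennreal (jump_density d s x y) \<partial>lborel) + ennreal (1 - (\<integral>y. jump_density d s x y \<partial>lborel)) * indicator A x
      = (\<Sum>b\<in>{False, True}. ennreal (if b then 1 else 1 - (\<integral>y. jump_density d s x y \<partial>lborel)) *
          emeasure (if b then density lborel (\<lambda>y. ennreal (jump_density d s x y)) else return borel x) A)"
      using A by (simp add: emeasure_density add.commute)
  qed simp
qed

lemma sets_rwm_kernel: "sets (rwm_kernel d s x) = sets borel"
  unfolding rwm_kernel_mixture by simp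

lemma emeasure_rwm_kernel:
  assumes A: "A \<in> sets borel"
  shows "emeasure (rwm_kernel d s x) A = (\<integral>\<^sup>+y. ennreal (jump_density d s x y) * indicator A y \<partial>lborel)
     + ennreal (1 - (\<integral>y. jump_density d s x y \<partial>lborel)) * indicator A x"
proof -
  have [measurable]: "(\<lambda>y. jump_density d s x y) \<in> borel_measurable borel"
    using borel_measurable_integrable[OF jump_density_integrable[of x]] by simp
  show ?thesis unfolding rwm_kernel_mixture
    using A by (subst emeasure_mixture) (auto simp: emeasure_density add.commute)
qed

lemma prob_space_rwm_kernel: "prob_space (rwm_kernel d s x)"
proof (rule prob_spaceI)
  have sp: "space (rwm_kernel d s x) = UNIV" unfolding rwm_kernel_mixture by simp
  have "(\<integral>\<^sup>+y. ennreal (jump_density d s x y) \<partial>lborel) = ennreal (\<integral>y. jump_density d s x y \<partial>lborel)"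
    using jump_density_integrable jump_density_nonneg by (intro nn_integral_eq_integral) auto
  then show "emeasure (rwm_kernel d s x) (space (rwm_kernel d s x)) = 1"
    unfolding sp using jump_density_integral_le[of x] jump_density_nonneg[of x]
    by (subst emeasure_rwm_kernel) (auto simp: ennreal_plus[symmetric] integral_nonneg_AE simp del: ennreal_plus)
qed

lemma integral_rwm_kernel:
  assumes f: "bounded_borel f"
  shows "(\<integral>y. f y \<partial>rwm_kernel d s x) = rwm_op d s f x"
proof -
  have [measurable]: "(\<lambda>y. jump_density d s x y) \<in> borel_measurable borel"
    using borel_measurable_integrable[OF jump_density_integrable[of x]] by simp
  note [measurable] = bounded_borel_measurable[OF f]
  have fin: "finite_measure (density lborel (\<lambda>y. ennreal (jump_density d s x y)))"
  proof (rule finite_measureI)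
    have "(\<integral>\<^sup>+y. ennreal (jump_density d s x y) \<partial>lborel) = ennreal (\<integral>y. jump_density d s x y \<partial>lborel)"
      using jump_density_integrable jump_density_nonneg by (intro nn_integral_eq_integral) auto
    then show "emeasure (density lborel (\<lambda>y. ennreal (jump_density d s x y))) (space (density lborel (\<lambda>y. ennreal (jump_density d s x y)))) \<noteq> \<infinity>"
      by (simp add: emeasure_density)
  qed
  have "finite_measure (return borel x)"
    by (intro finite_measureI) simp
  with fin have "(\<integral>y. f y \<partial>rwm_kernel d s x) = (\<Sum>b\<in>{False, True}. (if b then 1 else 1 - (\<integral>y. jump_density d s x y \<partial>lborel))
      * (\<integral>y. f y \<partial>(if b then density lborel (\<lambda>y. ennreal (jump_density d s x y)) else return borel x)))"
    unfolding rwm_kernel_mixture using jump_density_integral_le[of x]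
    by (intro integral_mixture(2)) (auto simp: f)
  also have "\<dots> = rwm_op d s f x"
    using jump_density_nonneg by (simp add: integral_density integral_return rwm_op_def)
  finally show ?thesis .
qed

end

lemma multiscale_rwm_kernel_mixture:
  "multiscale_rwm_kernel J w s d x = mixture {1..J} (\<lambda>j. ennreal (w j)) (\<lambda>j. rwm_kernel d (s j) x)"
  by (simp add: multiscale_rwm_kernel_def mixture_def)

lemma sets_multiscale_rwm_kernel [simp, measurable_cong]: "sets (multiscale_rwm_kernel J w s d x) = sets borel"
  unfolding multiscale_rwm_kernel_mixture by simp

lemma integral_multiscale_rwm_kernel:
  assumes "\<And>j. j \<in> {1..J} \<Longrightarrow> rwm d (s j)" "\<And>j. j \<in> {1..J} \<Longrightarrow> 0 \<le> w j" "bounded_borel f"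
  shows "(\<integral>y. f y \<partial>multiscale_rwm_kernel J w s d x) = multiscale_op J w s d f x"
proof -
  have "(\<integral>y. f y \<partial>multiscale_rwm_kernel J w s d x) = (\<Sum>j\<in>{1..J}. w j * (\<integral>y. f y \<partial>rwm_kernel d (s j) x))"
    unfolding multiscale_rwm_kernel_mixture using assms
    by (intro integral_mixture(2)) (auto simp: rwm.sets_rwm_kernel prob_space.finite_measure rwm.prob_space_rwm_kernel)
  then show ?thesis using assms by (simp add: multiscale_op_def rwm.integral_rwm_kernel)
qed

lemma prob_space_multiscale_rwm_kernel:
  assumes "\<And>j. j \<in> {1..J} \<Longrightarrow> rwm d (s j)" "\<And>j. j \<in> {1..J} \<Longrightarrow> 0 \<le> w j" "sum w {1..J} = 1"
  shows "prob_space (multiscale_rwm_kernel J w s d x)"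
proof (rule prob_spaceI)
  have "emeasure (rwm_kernel d (s j) x) UNIV = 1" if "j \<in> {1..J}" for j
    using prob_space.emeasure_space_1[OF rwm.prob_space_rwm_kernel[OF assms(1)[OF that]]]
      sets_eq_imp_space_eq[OF rwm.sets_rwm_kernel[OF assms(1)[OF that]]] by simp
  then have "emeasure (multiscale_rwm_kernel J w s d x) UNIV = (\<Sum>j\<in>{1..J}. ennreal (w j))"
    unfolding multiscale_rwm_kernel_mixture using assms
    by (subst emeasure_mixture) (auto simp: rwm.sets_rwm_kernel)
  also have "\<dots> = 1" using assms by (subst sum_ennreal) auto
  finally show "emeasure (multiscale_rwm_kernel J w s d x) (space (multiscale_rwm_kernel J w s d x)) = 1"
    unfolding multiscale_rwm_kernel_mixture by simp
qed

section \<open>Joint measurability in the state and the conditioning coordinate\<close>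

lemma measurable_curried:
  fixes d :: "real \<Rightarrow> real \<Rightarrow> real"
  assumes "(\<lambda>(z, x). d z x) \<in> borel_measurable (borel \<Otimes>\<^sub>M borel)" "f \<in> borel_measurable M" "g \<in> borel_measurable M"
  shows "(\<lambda>x. d (f x) (g x)) \<in> borel_measurable M"
  using measurable_compose[OF measurable_Pair[OF assms(2,3)] assms(1)] by simp

lemma measurable_jump_density:
  fixes d :: "real \<Rightarrow> real \<Rightarrow> real"
  assumes d: "(\<lambda>(z, x). d z x) \<in> borel_measurable (borel \<Otimes>\<^sub>M borel)"
    and [measurable]: "f \<in> borel_measurable M" "g \<in> borel_measurable M" "k \<in> borel_measurable M"
  shows "(\<lambda>x. jump_density (d (f x)) t (g x) (k x)) \<in> borel_measurable M"
proof -
  note measurable_curried[OF d, measurable (raw)]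
  show ?thesis unfolding jump_density_def mh_accept_def by measurable
qed

lemma measurable_multiscale_rwm_kernel:
  fixes d :: "real \<Rightarrow> real \<Rightarrow> real"
  assumes rwm: "\<And>z j. j \<in> {1..J} \<Longrightarrow> rwm (d z) (s j)" and w: "\<And>j. j \<in> {1..J} \<Longrightarrow> 0 \<le> w j" "sum w {1..J} = 1"
    and d [measurable]: "(\<lambda>(z, x). d z x) \<in> borel_measurable (borel \<Otimes>\<^sub>M borel)"
  shows "(\<lambda>(z, x). multiscale_rwm_kernel J w s (d z) x) \<in> (borel \<Otimes>\<^sub>M borel) \<rightarrow>\<^sub>M subprob_algebra (borel :: real measure)"
proof (rule measurable_subprob_algebra)
  fix A :: "real set" assume A [measurable]: "A \<in> sets borel"
  note measurable_jump_density[OF d, measurable (raw)]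
  have "(\<lambda>(z, x). \<Sum>j\<in>{1..J}. ennreal (w j) * ((\<integral>\<^sup>+y. ennreal (jump_density (d z) (s j) x y) * indicator A y \<partial>lborel)
      + ennreal (1 - (\<integral>y. jump_density (d z) (s j) x y \<partial>lborel)) * indicator A x)) \<in> borel_measurable (borel \<Otimes>\<^sub>M borel)"
    by measurable
  moreover have "emeasure (multiscale_rwm_kernel J w s (d z) x) A = (\<Sum>j\<in>{1..J}. ennreal (w j) * ((\<integral>\<^sup>+y. ennreal (jump_density (d z) (s j) x y) * indicator A y \<partial>lborel)
      + ennreal (1 - (\<integral>y. jump_density (d z) (s j) x y \<partial>lborel)) * indicator A x))" for z x
    unfolding multiscale_rwm_kernel_mixture using rwm A
    by (subst emeasure_mixture) (auto simp: rwm.sets_rwm_kernel rwm.emeasure_rwm_kernel intro!: sum.cong)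
  ultimately show "(\<lambda>a. emeasure (case a of (z, x) \<Rightarrow> multiscale_rwm_kernel J w s (d z) x) A) \<in> borel_measurable (borel \<Otimes>\<^sub>M borel)"
    by (simp add: split_beta')
qed (use rwm w in \<open>auto intro!: prob_space_imp_subprob_space prob_space_multiscale_rwm_kernel\<close>)

subsection \<open>The deterministic-scan sampler\<close>

lemma abs_integral_le:
  fixes h :: "real \<Rightarrow> real"
  assumes h: "h \<in> borel_measurable borel" "\<And>x. \<bar>h x\<bar> \<le> C" and K: "prob_space K" "sets K = sets borel"
  shows "\<bar>\<integral>y. h y \<partial>K\<bar> \<le> C"
proof -
  interpret prob_space K by fact
  have hm: "h \<in> borel_measurable K" using h(1) unfolding measurable_cong_sets[OF K(2) refl] .
  have i: "integrable K h" using h(2) by (intro integrable_const_bound[where B=C] hm) auto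
  have "\<bar>\<integral>y. h y \<partial>K\<bar> \<le> (\<integral>y. \<bar>h y\<bar> \<partial>K)" by (rule integral_abs_bound)
  also have "\<dots> \<le> (\<integral>y. C \<partial>K)" using i h(2) by (intro integral_mono) auto
  finally show ?thesis by (simp add: prob_space)
qed

lemma abs_integral_density_le:
  fixes h d :: "real \<Rightarrow> real"
  assumes h: "h \<in> borel_measurable borel" "\<And>x. \<bar>h x\<bar> \<le> C"
    and d: "integrable lborel d" "\<And>x. 0 \<le> d x" "(\<integral>x. d x \<partial>lborel) = 1"
  shows "\<bar>\<integral>x. d x * h x \<partial>lborel\<bar> \<le> C"
proof -
  have i: "integrable lborel (\<lambda>x. d x * h x)" using h by (intro integrable_times_bounded_borel[OF d(1)]) auto
  have "\<bar>\<integral>x. d x * h x \<partial>lborel\<bar> \<le> (\<integral>x. \<bar>d x * h x\<bar> \<partial>lborel)" by (rule integral_abs_bound)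
  also have "\<dots> \<le> (\<integral>x. d x * C \<partial>lborel)"
  proof (rule integral_mono)
    show "integrable lborel (\<lambda>x. \<bar>d x * h x\<bar>)" using i by (rule integrable_abs)
    show "\<bar>d x * h x\<bar> \<le> d x * C" for x using d(2)[of x] h(2)[of x] by (simp add: abs_mult mult_left_mono)
  qed (use d(1) in simp)
  finally show ?thesis using d(3) by simp
qed

lemma bounded_borel_fst: "bounded_borel g \<Longrightarrow> bounded_borel (\<lambda>x :: real \<times> real. g (fst x) :: real)"
  and bounded_borel_snd: "bounded_borel g \<Longrightarrow> bounded_borel (\<lambda>x :: real \<times> real. g (snd x) :: real)"
proof -
  show "bounded_borel (\<lambda>x :: real \<times> real. g (fst x) :: real)" if g: "bounded_borel g" for g
  proof -
    obtain C where C: "\<And>x. \<bar>g x\<bar> \<le> C" using bounded_borelE[OF g] by metis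
    note [measurable] = bounded_borel_measurable[OF g]
    have "(\<lambda>x :: real \<times> real. g (fst x)) \<in> borel_measurable (borel \<Otimes>\<^sub>M borel)" by measurable
    then show ?thesis using C by (intro bounded_borelI[where C=C]) (auto simp: borel_prod)
  qed
  show "bounded_borel (\<lambda>x :: real \<times> real. g (snd x) :: real)" if g: "bounded_borel g" for g
  proof -
    obtain C where C: "\<And>x. \<bar>g x\<bar> \<le> C" using bounded_borelE[OF g] by metis
    note [measurable] = bounded_borel_measurable[OF g]
    have "(\<lambda>x :: real \<times> real. g (snd x)) \<in> borel_measurable (borel \<Otimes>\<^sub>M borel)" by measurable
    then show ?thesis using C by (intro bounded_borelI[where C=C]) (auto simp: borel_prod)
  qed
qed

locale log_concave_scan =
  fixes U :: "real \<times> real \<Rightarrow> real" and m L :: real and J :: nat and w s :: "nat \<Rightarrow> real"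
  assumes sc: "strongly_convex m U" and sm: "midpoint_smooth L U" and m: "0 < m" and mL: "m \<le> L"
    and mass: "(\<integral>\<^sup>+x. ennreal (exp (- U x)) \<partial>lborel) = 1"
    and J: "J = 1 + nat \<lceil>log 2 (L / m)\<rceil>"
    and w: "\<And>j. j \<in> {1..J} \<Longrightarrow> w j = 1 / real J"
    and s: "\<And>j. j \<in> {1..J} \<Longrightarrow> 0 < s j \<and> (s j)\<^sup>2 = 2 ^ (j - 1) / L"
begin

definition p :: "real \<times> real \<Rightarrow> real" where "p x = exp (- U x)"
definition q1 :: "real \<Rightarrow> real" where "q1 x = (\<integral>t. p (x, t) \<partial>lborel)"
definition q2 :: "real \<Rightarrow> real" where "q2 z = (\<integral>t. p (t, z) \<partial>lborel)"
definition K1 :: "real \<Rightarrow> real \<Rightarrow> real measure" where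
  "K1 z = multiscale_rwm_kernel J w s (cond_density1 p z)"
definition K2 :: "real \<Rightarrow> real \<Rightarrow> real measure" where
  "K2 x = multiscale_rwm_kernel J w s (cond_density2 p x)"
text \<open>Expectation under the target, taken over the product of two Lebesgue measures so that it
  can be iterated in either order.\<close>

definition I :: "(real \<times> real \<Rightarrow> real) \<Rightarrow> real" where
  "I h = (\<integral>x. p x * h x \<partial>(lborel \<Otimes>\<^sub>M lborel))"

lemma U_measurable [measurable]: "U \<in> borel_measurable (borel \<Otimes>\<^sub>M borel)"
proof -
  have "continuous_on UNIV U" using strongly_convex_continuous[OF sc] m by simp
  then have "U \<in> borel_measurable borel" by (rule borel_measurable_continuous_onI)
  then show ?thesis by (simp add: borel_prod)
qed

lemma p_measurable [measurable]: "p \<in> borel_measurable (borel \<Otimes>\<^sub>M borel)"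
  unfolding p_def[abs_def] by measurable

lemma p_pos: "0 < p x" by (simp add: p_def)

lemma slice_convex: "strongly_convex m (\<lambda>x. U (x, z))" "strongly_convex m (\<lambda>z. U (x, z))"
  by (rule strongly_convex_slices[OF sc])+

lemma slice_integrable: "integrable lborel (\<lambda>x. p (x, z))" "integrable lborel (\<lambda>z. p (x, z))"
  unfolding p_def by (rule strongly_convex_integrable[OF _ m], rule slice_convex)+

lemma q_pos: "0 < q1 x" "0 < q2 z"
  unfolding q1_def q2_def p_def by (rule strongly_convex_integral_pos[OF _ m], rule slice_convex)+

text \<open>The potential of a conditional density is a slice of \<open>U\<close> plus a constant,
  so it inherits both convexity bounds with the same m and L.\<close>

lemma cond_density_eq:
  "cond_density1 p z = (\<lambda>x. exp (- (U (x, z) + ln (q2 z))))"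
  "cond_density2 p x = (\<lambda>z. exp (- (U (x, z) + ln (q1 x))))"
  using q_pos unfolding cond_density1_def cond_density2_def q1_def[symmetric] q2_def[symmetric]
  by (simp_all add: fun_eq_iff exp_diff p_def exp_minus field_simps exp_add)

lemma cond_density_times:
  "q2 z * cond_density1 p z x = p (x, z)" "q1 x * cond_density2 p x z = p (x, z)"
  using q_pos(1)[of x] q_pos(2)[of z] by (simp_all add: cond_density1_def cond_density2_def q1_def[symmetric] q2_def[symmetric])

lemma cond_density_integral: "(\<integral>x. cond_density1 p z x \<partial>lborel) = 1" "(\<integral>z. cond_density2 p x z \<partial>lborel) = 1"
  using q_pos(1)[of x] q_pos(2)[of z] by (simp_all add: cond_density1_def cond_density2_def q1_def[symmetric] q2_def[symmetric])

lemma cond_density_measurable [measurable]: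
  "(\<lambda>(z, x). cond_density1 p z x) \<in> borel_measurable (borel \<Otimes>\<^sub>M borel)"
  "(\<lambda>(x, z). cond_density2 p x z) \<in> borel_measurable (borel \<Otimes>\<^sub>M borel)"
  unfolding cond_density1_def cond_density2_def by measurable

lemma J_pos: "0 < J" by (simp add: J)

lemma w_nonneg: "j \<in> {1..J} \<Longrightarrow> 0 \<le> w j" using w by simp

lemma w_sum: "sum w {1..J} = 1" using w J_pos by simp

lemma rwm_cond:
  assumes "j \<in> {1..J}"
  shows "rwm (cond_density1 p z) (s j)" "rwm (cond_density2 p x) (s j)"
proof -
  have "cond_density1 p z \<in> borel_measurable borel" "cond_density2 p x \<in> borel_measurable borel"
    unfolding cond_density1_def cond_density2_def by measurable
  moreover have "integrable lborel (cond_density1 p z)" "integrable lborel (cond_density2 p x)"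
    unfolding cond_density1_def cond_density2_def using slice_integrable by auto
  ultimately show "rwm (cond_density1 p z) (s j)" "rwm (cond_density2 p x) (s j)"
    using s[OF assms] cond_density_integral
    by (unfold_locales; simp add: cond_density_eq)+
qed

lemma K_measurable [measurable]:
  "(\<lambda>(z, x). K1 z x) \<in> (borel \<Otimes>\<^sub>M borel) \<rightarrow>\<^sub>M subprob_algebra borel"
  "(\<lambda>(x, z). K2 x z) \<in> (borel \<Otimes>\<^sub>M borel) \<rightarrow>\<^sub>M subprob_algebra borel"
  unfolding K1_def K2_def
  by (intro measurable_multiscale_rwm_kernel rwm_cond w_nonneg w_sum cond_density_measurable; assumption)+

lemma K_prob: "prob_space (K1 z x)" "prob_space (K2 x z)"
  unfolding K1_def K2_def by (intro prob_space_multiscale_rwm_kernel rwm_cond w_nonneg w_sum; assumption)+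

lemma sets_K [simp, measurable_cong]: "sets (K1 z x) = sets borel" "sets (K2 x z) = sets borel"
  unfolding K1_def K2_def by simp_all

lemma K_integral:
  assumes "bounded_borel h"
  shows "(\<integral>y. h y \<partial>K1 z x) = multiscale_op J w s (cond_density1 p z) h x"
    "(\<integral>y. h y \<partial>K2 x z) = multiscale_op J w s (cond_density2 p x) h z"
  unfolding K1_def K2_def by (intro integral_multiscale_rwm_kernel rwm_cond w_nonneg assms; assumption)+

text \<open>Multiplying the one-dimensional estimate by the marginal density of the conditioning
  coordinate replaces conditional weights by joint ones, ready for integration over that
  coordinate.\<close>

lemma K_gap:
  assumes h: "bounded_borel h"
  shows "(\<integral>x. p (x, z) * ((\<integral>y. h y \<partial>K1 z x) - e)\<^sup>2 \<partial>lborel)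
      + (\<integral>x. p (x, z) * (h x - (\<integral>x. cond_density1 p z x * h x \<partial>lborel))\<^sup>2 \<partial>lborel) / (110000000 * real J)
    \<le> (\<integral>x. p (x, z) * (h x - e)\<^sup>2 \<partial>lborel)" (is ?A)
  and "(\<integral>z. p (x, z) * ((\<integral>y. h y \<partial>K2 x z) - e)\<^sup>2 \<partial>lborel)
      + (\<integral>z. p (x, z) * (h z - (\<integral>z. cond_density2 p x z * h z \<partial>lborel))\<^sup>2 \<partial>lborel) / (110000000 * real J)
    \<le> (\<integral>z. p (x, z) * (h z - e)\<^sup>2 \<partial>lborel)" (is ?B)
proof -
  have *: "(\<integral>x. cond_density1 p z x * (multiscale_op J w s (cond_density1 p z) h x - e)\<^sup>2 \<partial>lborel)
      + (\<integral>x. cond_density1 p z x * (h x - (\<integral>x. cond_density1 p z x * h x \<partial>lborel))\<^sup>2 \<partial>lborel) / (110000000 * real J)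
    \<le> (\<integral>x. cond_density1 p z x * (h x - e)\<^sup>2 \<partial>lborel)"
    using cond_density_integral(1)[of z] unfolding cond_density_eq
    by (intro multiscale_op_gap[OF strongly_convex_add_const[OF slice_convex(1)]
        midpoint_smooth_add_const[OF midpoint_smooth_slices(1)[OF sm]] m mL _ J w s h])
  have q2: "q2 z * (\<integral>x. cond_density1 p z x * f x \<partial>lborel) = (\<integral>x. p (x, z) * f x \<partial>lborel)" for f
    unfolding cond_density_times(1)[symmetric] mult.assoc by simp
  show ?A
    using mult_left_mono[OF * less_imp_le[OF q_pos(2)[of z]]]
    unfolding distrib_left times_divide_eq_right q2 K_integral(1)[OF h] .
  have *: "(\<integral>z. cond_density2 p x z * (multiscale_op J w s (cond_density2 p x) h z - e)\<^sup>2 \<partial>lborel)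
      + (\<integral>z. cond_density2 p x z * (h z - (\<integral>z. cond_density2 p x z * h z \<partial>lborel))\<^sup>2 \<partial>lborel) / (110000000 * real J)
    \<le> (\<integral>z. cond_density2 p x z * (h z - e)\<^sup>2 \<partial>lborel)"
    using cond_density_integral(2)[of x] unfolding cond_density_eq
    by (intro multiscale_op_gap[OF strongly_convex_add_const[OF slice_convex(2)]
        midpoint_smooth_add_const[OF midpoint_smooth_slices(2)[OF sm]] m mL _ J w s h])
  have q1: "q1 x * (\<integral>z. cond_density2 p x z * f z \<partial>lborel) = (\<integral>z. p (x, z) * f z \<partial>lborel)" for f
    unfolding cond_density_times(2)[symmetric] mult.assoc by simp
  show ?B
    using mult_left_mono[OF * less_imp_le[OF q_pos(1)[of x]]]
    unfolding distrib_left times_divide_eq_right q1 K_integral(2)[OF h] .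
qed

lemma p_integrable: "integrable (lborel \<Otimes>\<^sub>M lborel) p"
  and p_mass: "(\<integral>x. p x \<partial>(lborel \<Otimes>\<^sub>M lborel)) = 1"
proof -
  have nn: "(\<integral>\<^sup>+x. ennreal (p x) \<partial>(lborel \<Otimes>\<^sub>M lborel)) = 1"
    using mass by (simp add: lborel_prod p_def)
  show "integrable (lborel \<Otimes>\<^sub>M lborel) p"
    using nn p_pos by (intro integrableI_nonneg) (auto simp: less_imp_le)
  show "(\<integral>x. p x \<partial>(lborel \<Otimes>\<^sub>M lborel)) = 1"
    using nn p_pos by (subst integral_eq_nn_integral) (auto simp: less_imp_le)
qed

lemma bounded_borel_pair_measurable:
  fixes h :: "real \<times> real \<Rightarrow> real"
  shows "bounded_borel h \<Longrightarrow> h \<in> borel_measurable (borel \<Otimes>\<^sub>M borel)"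
  by (simp add: bounded_borel_measurable borel_prod)

lemma bounded_borel_slices:
  fixes h :: "real \<times> real \<Rightarrow> real"
  assumes "bounded_borel h"
  shows "bounded_borel (\<lambda>x. h (x, z))" "bounded_borel (\<lambda>z. h (x, z))"
proof -
  obtain C where C: "\<And>x. \<bar>h x\<bar> \<le> C" using bounded_borelE[OF assms] by metis
  note [measurable] = bounded_borel_pair_measurable[OF assms]
  show "bounded_borel (\<lambda>x. h (x, z))" "bounded_borel (\<lambda>z. h (x, z))"
    by (rule bounded_borelI[where C=C]; use C in \<open>simp\<close>)+
qed

lemma p_times_integrable:
  assumes "bounded_borel h" shows "integrable (lborel \<Otimes>\<^sub>M lborel) (\<lambda>x. p x * h x)"
proof -
  obtain C where C: "\<And>x. \<bar>h x\<bar> \<le> C" using bounded_borelE[OF assms] by metis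
  show ?thesis
    using bounded_borel_pair_measurable[OF assms] C
    by (intro integrable_times_bounded_borel[OF p_integrable, where C=C]) auto
qed

lemma I_iterated:
  assumes h: "bounded_borel h"
  shows "I h = (\<integral>x. (\<integral>z. p (x, z) * h (x, z) \<partial>lborel) \<partial>lborel)"
    "I h = (\<integral>z. (\<integral>x. p (x, z) * h (x, z) \<partial>lborel) \<partial>lborel)"
    "integrable lborel (\<lambda>x. (\<integral>z. p (x, z) * h (x, z) \<partial>lborel))"
    "integrable lborel (\<lambda>z. (\<integral>x. p (x, z) * h (x, z) \<partial>lborel))"
proof -
  have i: "integrable (lborel \<Otimes>\<^sub>M lborel) (\<lambda>(x, z). p (x, z) * h (x, z))"
    using p_times_integrable[OF h] by (simp add: split_beta')
  show "I h = (\<integral>x. (\<integral>z. p (x, z) * h (x, z) \<partial>lborel) \<partial>lborel)"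
    using lborel_pair.integral_fst'[OF i] by (simp add: I_def split_beta')
  show "I h = (\<integral>z. (\<integral>x. p (x, z) * h (x, z) \<partial>lborel) \<partial>lborel)"
    using lborel_pair.integral_snd[OF i] by (simp add: I_def split_beta')
  show "integrable lborel (\<lambda>x. (\<integral>z. p (x, z) * h (x, z) \<partial>lborel))"
    using lborel_pair.integrable_fst'[OF i] by simp
  show "integrable lborel (\<lambda>z. (\<integral>x. p (x, z) * h (x, z) \<partial>lborel))"
    using lborel_pair.integrable_snd[OF i] by simp
qed

lemma I_add: "bounded_borel g \<Longrightarrow> bounded_borel h \<Longrightarrow> I (\<lambda>x. g x + h x) = I g + I h"
  unfolding I_def using p_times_integrable by (simp add: distrib_left)

lemma I_cmult: "I (\<lambda>x. c * h x) = c * I h"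
  unfolding I_def by (simp add: mult.left_commute)

lemma I_const: "I (\<lambda>x. c) = c"
  unfolding I_def using p_mass by simp

lemma I_mono: "bounded_borel g \<Longrightarrow> bounded_borel h \<Longrightarrow> (\<And>x. g x \<le> h x) \<Longrightarrow> I g \<le> I h"
  unfolding I_def using p_times_integrable p_pos
  by (intro integral_mono mult_left_mono) (auto simp: less_imp_le)

lemma I_nonneg: "(\<And>x. 0 \<le> h x) \<Longrightarrow> 0 \<le> I h"
  unfolding I_def using p_pos by (intro integral_nonneg_AE) (auto simp: less_imp_le)

definition avg2 :: "(real \<times> real \<Rightarrow> real) \<Rightarrow> real \<times> real \<Rightarrow> real" where
  "avg2 f = (\<lambda>(x, z). \<integral>y. f (x, y) \<partial>K2 x z)"

definition cond_mean1 :: "(real \<times> real \<Rightarrow> real) \<Rightarrow> real \<Rightarrow> real" where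
  "cond_mean1 f z = (\<integral>x. cond_density1 p z x * f (x, z) \<partial>lborel)"

definition cond_mean2 :: "(real \<times> real \<Rightarrow> real) \<Rightarrow> real \<Rightarrow> real" where
  "cond_mean2 f x = (\<integral>z. cond_density2 p x z * f (x, z) \<partial>lborel)"

lemma bounded_borel_avg2:
  assumes f: "bounded_borel f"
  shows "bounded_borel (avg2 f)"
proof -
  obtain C where C: "\<And>x. \<bar>f x\<bar> \<le> C" using bounded_borelE[OF f] by metis
  note [measurable] = bounded_borel_pair_measurable[OF f]
  have fs: "(\<lambda>y. f (x, y)) \<in> borel_measurable borel" for x by measurable
  note measurable_jump_density[OF cond_density_measurable(2), measurable (raw)]
  have "(\<lambda>q. \<Sum>j\<in>{1..J}. w j * ((\<integral>y. jump_density (cond_density2 p (fst q)) (s j) (snd q) y * f (fst q, y) \<partial>lborel)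
      + (1 - (\<integral>y. jump_density (cond_density2 p (fst q)) (s j) (snd q) y \<partial>lborel)) * f (fst q, snd q)))
      \<in> borel_measurable (borel \<Otimes>\<^sub>M borel)" by measurable
  also have "(\<lambda>q. \<Sum>j\<in>{1..J}. w j * ((\<integral>y. jump_density (cond_density2 p (fst q)) (s j) (snd q) y * f (fst q, y) \<partial>lborel)
      + (1 - (\<integral>y. jump_density (cond_density2 p (fst q)) (s j) (snd q) y \<partial>lborel)) * f (fst q, snd q))) = avg2 f"
    using K_integral(2)[OF bounded_borel_slices(2)[OF f]]
    by (auto simp: avg2_def multiscale_op_def rwm_op_def fun_eq_iff)
  finally have "avg2 f \<in> borel_measurable borel" by (simp add: borel_prod)
  then show ?thesis
    by (rule bounded_borelI[where C=C])
      (use abs_integral_le[OF fs _ K_prob(2) sets_K(2)] C in \<open>auto simp: avg2_def split_beta'\<close>)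
qed

lemma cond_density_integrable: "integrable lborel (cond_density1 p z)" "integrable lborel (cond_density2 p x)"
  unfolding cond_density1_def cond_density2_def using slice_integrable by auto

lemma cond_density_nonneg: "0 \<le> cond_density1 p z x" "0 \<le> cond_density2 p x z"
  unfolding cond_density_eq by simp_all

lemma bounded_borel_cond_mean:
  assumes f: "bounded_borel f"
  shows "bounded_borel (cond_mean1 f)" "bounded_borel (cond_mean2 f)"
proof -
  obtain C where C: "\<And>x. \<bar>f x\<bar> \<le> C" using bounded_borelE[OF f] by metis
  note [measurable] = bounded_borel_pair_measurable[OF f]
  note measurable_curried[OF cond_density_measurable(1), measurable (raw)]
    measurable_curried[OF cond_density_measurable(2), measurable (raw)]
  have "cond_mean1 f \<in> borel_measurable borel" unfolding cond_mean1_def[abs_def] by measurable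
  then show "bounded_borel (cond_mean1 f)"
    by (rule bounded_borelI[where C=C])
       (unfold cond_mean1_def, rule abs_integral_density_le, use C cond_density_integrable cond_density_nonneg cond_density_integral in auto)
  have "cond_mean2 f \<in> borel_measurable borel" unfolding cond_mean2_def[abs_def] by measurable
  then show "bounded_borel (cond_mean2 f)"
    by (rule bounded_borelI[where C=C])
       (unfold cond_mean2_def, rule abs_integral_density_le, use C cond_density_integrable cond_density_nonneg cond_density_integral in auto)
qed

lemmas bounded_borel_intros = bounded_borel_square bounded_borel_diff bounded_borel_fst bounded_borel_snd
  bounded_borel_avg2 bounded_borel_cond_mean bounded_borel_const

abbreviation "\<kappa> \<equiv> 1 / (110000000 * real J)"

text \<open>On each fibre the centring g(x) is a constant, so any function of the first coordinate
  may be subtracted. It is applied with g = 0 and with \<open>g\<close> the conditional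
  mean.\<close>

lemma avg2_gap:
  assumes f: "bounded_borel f" and g: "bounded_borel g"
  shows "I (\<lambda>x. (avg2 f x - g (fst x))\<^sup>2) + \<kappa> * I (\<lambda>x. (f x - cond_mean2 f (fst x))\<^sup>2) \<le> I (\<lambda>x. (f x - g (fst x))\<^sup>2)"
proof -
  let ?F = "\<lambda>x. (avg2 f x - g (fst x))\<^sup>2" and ?V = "\<lambda>x. (f x - cond_mean2 f (fst x))\<^sup>2" and ?G = "\<lambda>x. (f x - g (fst x))\<^sup>2"
  have b: "bounded_borel ?F" "bounded_borel ?V" "bounded_borel ?G" by (intro bounded_borel_intros f g)+
  have "I ?F + \<kappa> * I ?V = (\<integral>x. (\<integral>z. p (x, z) * ?F (x, z) \<partial>lborel) + \<kappa> * (\<integral>z. p (x, z) * ?V (x, z) \<partial>lborel) \<partial>lborel)"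
    unfolding I_iterated(1)[OF b(1)] I_iterated(1)[OF b(2)] using I_iterated(3)[OF b(1)] I_iterated(3)[OF b(2)] by simp
  also have "\<dots> \<le> (\<integral>x. (\<integral>z. p (x, z) * ?G (x, z) \<partial>lborel) \<partial>lborel)"
    using I_iterated(3)[OF b(1)] I_iterated(3)[OF b(2)] I_iterated(3)[OF b(3)]
      K_gap(2)[OF bounded_borel_slices(2)[OF f]]
    by (intro integral_mono) (auto simp: avg2_def cond_mean2_def)
  also have "\<dots> = I ?G" by (rule I_iterated(1)[OF b(3), symmetric])
  finally show ?thesis .
qed

definition avg1 :: "(real \<times> real \<Rightarrow> real) \<Rightarrow> real \<times> real \<Rightarrow> real" where
  "avg1 f = (\<lambda>(x, z). \<integral>y. f (y, z) \<partial>K1 z x)"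

lemma bounded_borel_avg1:
  assumes f: "bounded_borel f"
  shows "bounded_borel (avg1 f)"
proof -
  obtain C where C: "\<And>x. \<bar>f x\<bar> \<le> C" using bounded_borelE[OF f] by metis
  note [measurable] = bounded_borel_pair_measurable[OF f]
  have fs: "(\<lambda>y. f (y, x)) \<in> borel_measurable borel" for x by measurable
  note measurable_jump_density[OF cond_density_measurable(1), measurable (raw)]
  have "(\<lambda>q. \<Sum>j\<in>{1..J}. w j * ((\<integral>y. jump_density (cond_density1 p (snd q)) (s j) (fst q) y * f (y, snd q) \<partial>lborel)
      + (1 - (\<integral>y. jump_density (cond_density1 p (snd q)) (s j) (fst q) y \<partial>lborel)) * f (fst q, snd q)))
      \<in> borel_measurable (borel \<Otimes>\<^sub>M borel)" by measurable
  also have "(\<lambda>q. \<Sum>j\<in>{1..J}. w j * ((\<integral>y. jump_density (cond_density1 p (snd q)) (s j) (fst q) y * f (y, snd q) \<partial>lborel)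
      + (1 - (\<integral>y. jump_density (cond_density1 p (snd q)) (s j) (fst q) y \<partial>lborel)) * f (fst q, snd q))) = avg1 f"
    using K_integral(1)[OF bounded_borel_slices(1)[OF f]]
    by (auto simp: avg1_def multiscale_op_def rwm_op_def fun_eq_iff)
  finally have "avg1 f \<in> borel_measurable borel" by (simp add: borel_prod)
  then show ?thesis
    by (rule bounded_borelI[where C=C])
      (use abs_integral_le[OF fs _ K_prob(1) sets_K(1)] C in \<open>auto simp: avg1_def split_beta'\<close>)
qed

lemma avg1_gap:
  assumes f: "bounded_borel f"
  shows "I (\<lambda>x. (avg1 f x)\<^sup>2) + \<kappa> * I (\<lambda>x. (f x - cond_mean1 f (snd x))\<^sup>2) \<le> I (\<lambda>x. (f x)\<^sup>2)"
proof -
  let ?F = "\<lambda>x. (avg1 f x)\<^sup>2" and ?V = "\<lambda>x. (f x - cond_mean1 f (snd x))\<^sup>2" and ?G = "\<lambda>x. (f x)\<^sup>2"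
  have b: "bounded_borel ?F" "bounded_borel ?V" "bounded_borel ?G" by (intro bounded_borel_intros bounded_borel_avg1 f)+
  have "I ?F + \<kappa> * I ?V = (\<integral>z. (\<integral>x. p (x, z) * ?F (x, z) \<partial>lborel) + \<kappa> * (\<integral>x. p (x, z) * ?V (x, z) \<partial>lborel) \<partial>lborel)"
    unfolding I_iterated(2)[OF b(1)] I_iterated(2)[OF b(2)] using I_iterated(4)[OF b(1)] I_iterated(4)[OF b(2)] by simp
  also have "\<dots> \<le> (\<integral>z. (\<integral>x. p (x, z) * ?G (x, z) \<partial>lborel) \<partial>lborel)"
    using I_iterated(4)[OF b(1)] I_iterated(4)[OF b(2)] I_iterated(4)[OF b(3)]
      K_gap(1)[OF bounded_borel_slices(1)[OF f], where e=0]
    by (intro integral_mono) (auto simp: avg1_def cond_mean1_def)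
  also have "\<dots> = I ?G" by (rule I_iterated(2)[OF b(3), symmetric])
  finally show ?thesis .
qed

text \<open>The tower property: f minus its conditional mean is orthogonal to all functions of the
  first coordinate.\<close>

lemma I_cond_mean2:
  assumes f: "bounded_borel f" and g: "bounded_borel g"
  shows "I (\<lambda>x. f x * g (fst x)) = I (\<lambda>x. cond_mean2 f (fst x) * g (fst x))"
proof -
  have b: "bounded_borel (\<lambda>x. f x * g (fst x))" "bounded_borel (\<lambda>x :: real \<times> real. cond_mean2 f (fst x) * g (fst x))"
    by (intro bounded_borel_mult bounded_borel_intros f g)+
  have "(\<integral>z. p (x, z) * (f (x, z) * g x) \<partial>lborel) = (\<integral>z. p (x, z) * (cond_mean2 f x * g x) \<partial>lborel)" for x
  proof -
    have "(\<integral>z. p (x, z) * f (x, z) \<partial>lborel) = q1 x * cond_mean2 f x"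
      unfolding cond_mean2_def cond_density_times(2)[symmetric] mult.assoc by simp
    then show ?thesis by (simp add: mult.assoc[symmetric] q1_def)
  qed
  then show ?thesis unfolding I_iterated(1)[OF b(1)] I_iterated(1)[OF b(2)] by simp
qed

lemma nn_integral_eq_I:
  assumes h: "bounded_borel h" "\<And>x. 0 \<le> h x"
  shows "(\<integral>\<^sup>+x. (\<integral>\<^sup>+z. ennreal (p (x, z) * h (x, z)) \<partial>lborel) \<partial>lborel) = ennreal (I h)"
    "(\<integral>\<^sup>+z. (\<integral>\<^sup>+x. ennreal (p (x, z) * h (x, z)) \<partial>lborel) \<partial>lborel) = ennreal (I h)"
proof -
  note [measurable] = bounded_borel_pair_measurable[OF h(1)]
  have "(\<integral>\<^sup>+x. ennreal (p x * h x) \<partial>(lborel \<Otimes>\<^sub>M lborel)) = ennreal (I h)"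
    unfolding I_def using p_times_integrable[OF h(1)] h(2) p_pos
    by (intro nn_integral_eq_integral) (auto simp: less_imp_le)
  then show 1: "(\<integral>\<^sup>+x. (\<integral>\<^sup>+z. ennreal (p (x, z) * h (x, z)) \<partial>lborel) \<partial>lborel) = ennreal (I h)"
    by (subst lborel.nn_integral_fst) auto
  show "(\<integral>\<^sup>+z. (\<integral>\<^sup>+x. ennreal (p (x, z) * h (x, z)) \<partial>lborel) \<partial>lborel) = ennreal (I h)"
    unfolding 1[symmetric] by (rule lborel_pair.Fubini') measurable
qed

text \<open>Since \<open>g\<close> has mean zero, the second moment is smallest around 0, so the
  unknown centring \<open>e\<close> of the marginal estimate can be removed.\<close>

lemma marginal_gap:
  assumes g: "bounded_borel g" and c: "bounded_borel c" and mean: "I (\<lambda>x. g (fst x)) = 0"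
  shows "I (\<lambda>x. (g (fst x))\<^sup>2) \<le> 213000000 * L / m * I (\<lambda>x. (g (fst x) - c (snd x))\<^sup>2)"
proof -
  note [measurable] = bounded_borel_measurable[OF g] bounded_borel_measurable[OF c]
  have L0: "0 < L" using m mL by simp
  have q: "(\<integral>\<^sup>+x. ennreal (exp (- marginal_potential U x) * h x) \<partial>lborel) = ennreal (I (\<lambda>x. h (fst x)))"
    if h: "bounded_borel h" "\<And>x. 0 \<le> h x" for h
  proof -
    have "ennreal (exp (- marginal_potential U x) * h x) = (\<integral>\<^sup>+z. ennreal (p (x, z) * h x) \<partial>lborel)" for x
      using nn_integral_slice[OF sc m, of x] h(2)[of x]
      by (simp add: ennreal_mult p_def nn_integral_multc)
    then show ?thesis using nn_integral_eq_I(1)[OF bounded_borel_fst[OF h(1)]] h(2) by simp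
  qed
  have "(\<integral>\<^sup>+x. ennreal (exp (- marginal_potential U x) * (g x)\<^sup>2) \<partial>lborel) < \<infinity>"
    by (subst q) (auto intro: bounded_borel_intros g)
  then obtain e where e: "(\<integral>\<^sup>+x. ennreal (exp (- marginal_potential U x) * (g x - e)\<^sup>2) \<partial>lborel)
    \<le> ennreal (213000000 * L / m) * (\<integral>\<^sup>+z. (\<integral>\<^sup>+x. ennreal (exp (- U (x, z)) * (g x - c z)\<^sup>2) \<partial>lborel) \<partial>lborel)"
    using marginal_variance_le[OF sc m sm L0, of g c] by auto
  have bc: "bounded_borel (\<lambda>x. (g (fst x) - c (snd x))\<^sup>2)" by (intro bounded_borel_intros g c)
  have bge: "bounded_borel (\<lambda>x. (g x - e)\<^sup>2)" by (intro bounded_borel_intros g)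
  have "ennreal (I (\<lambda>x. (g (fst x) - e)\<^sup>2)) \<le> ennreal (213000000 * L / m) * ennreal (I (\<lambda>x. (g (fst x) - c (snd x))\<^sup>2))"
    using e nn_integral_eq_I(2)[OF bc] unfolding q[OF bge zero_le_power2] by (simp add: p_def)
  then have le: "I (\<lambda>x. (g (fst x) - e)\<^sup>2) \<le> 213000000 * L / m * I (\<lambda>x. (g (fst x) - c (snd x))\<^sup>2)"
    using m L0 I_nonneg[of "\<lambda>x. (g (fst x) - c (snd x))\<^sup>2"]
    by (simp add: ennreal_mult[symmetric])
  have "(g (fst x) - e)\<^sup>2 = (g (fst x))\<^sup>2 + ((- (2 * e)) * g (fst x) + e\<^sup>2)" for x :: "real \<times> real"
    by (simp add: power2_eq_square algebra_simps)
  then have "I (\<lambda>x. (g (fst x) - e)\<^sup>2) = I (\<lambda>x. (g (fst x))\<^sup>2 + ((- (2 * e)) * g (fst x) + e\<^sup>2))" by simp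
  also have "\<dots> = I (\<lambda>x. (g (fst x))\<^sup>2) + I (\<lambda>x. (- (2 * e)) * g (fst x) + e\<^sup>2)"
    by (intro I_add bounded_borel_intros bounded_borel_add bounded_borel_mult g)
  also have "I (\<lambda>x. (- (2 * e)) * g (fst x) + e\<^sup>2) = I (\<lambda>x. (- (2 * e)) * g (fst x)) + I (\<lambda>x. e\<^sup>2)"
    by (intro I_add bounded_borel_intros bounded_borel_mult g)
  also have "\<dots> = e\<^sup>2" unfolding I_cmult mean I_const by simp
  finally have "I (\<lambda>x. (g (fst x))\<^sup>2) \<le> I (\<lambda>x. (g (fst x) - e)\<^sup>2)" by simp
  with le show ?thesis by linarith
qed

text \<open>This is \<kappa> \<delta> / 3 with \<delta> = m / (213000000 L).\<close>

definition rate :: real where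
  "rate = \<kappa> * m / (639000000 * L)"

text \<open>The two half-steps lose \<open>\<kappa> b\<^sup>2\<close> and \<open>\<kappa> u\<^sup>2\<close>, where \<open>b\<close> is the distance of \<open>f\<close> to its conditional mean
  \<open>g\<close> and \<open>u\<close> that of \<open>avg2 f\<close> to its own conditional mean \<open>c\<close>. If both are small, then \<open>g\<close>, a function of
  the first coordinate, is close to \<open>c\<close>, a function of the second one, which \<open>marginal_gap\<close> excludes.\<close>

lemma scan_contraction:
  assumes f: "bounded_borel f" and mean: "I f = 0"
  shows "I (\<lambda>x. (avg1 (avg2 f) x)\<^sup>2) \<le> (1 - rate) * I (\<lambda>x. (f x)\<^sup>2)"
proof -
  define F where "F = avg2 f"
  define g where "g = cond_mean2 f"
  define c where "c = cond_mean1 F"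
  have F: "bounded_borel F" unfolding F_def by (intro bounded_borel_intros f)
  have g: "bounded_borel g" unfolding g_def by (intro bounded_borel_intros f)
  have c: "bounded_borel c" unfolding c_def by (intro bounded_borel_intros F)
  define b2 where "b2 = I (\<lambda>x. (f x - g (fst x))\<^sup>2)"
  define u2 where "u2 = I (\<lambda>x. (F x - c (snd x))\<^sup>2)"
  define a2 where "a2 = I (\<lambda>x. (g (fst x))\<^sup>2)"
  define n2 where "n2 = I (\<lambda>x. (f x)\<^sup>2)"
  have nonneg: "0 \<le> b2" "0 \<le> u2" "0 \<le> a2" unfolding b2_def u2_def a2_def by (rule I_nonneg; simp)+
  have L0: "0 < L" using m mL by simp
  have k0: "0 < \<kappa>" using J_pos by simp
  have 1: "I (\<lambda>x. (avg1 F x)\<^sup>2) + \<kappa> * u2 \<le> I (\<lambda>x. (F x)\<^sup>2)"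
    unfolding u2_def c_def by (rule avg1_gap[OF F])
  have 2: "I (\<lambda>x. (F x)\<^sup>2) + \<kappa> * b2 \<le> n2"
    using avg2_gap[OF f bounded_borel_const[of 0]] unfolding F_def b2_def g_def n2_def by simp
  \<comment> \<open>The half-step fixes functions of the first coordinate and contracts, so its
    output is no further from \<open>g\<close> than \<open>f\<close> was.\<close>
  have "I (\<lambda>x. (F x - g (fst x))\<^sup>2) + \<kappa> * b2 \<le> b2"
    using avg2_gap[OF f g] unfolding F_def b2_def g_def by simp
  moreover have "0 \<le> \<kappa> * b2" using k0 nonneg(1) by (intro mult_nonneg_nonneg) auto
  ultimately have 3: "I (\<lambda>x. (F x - g (fst x))\<^sup>2) \<le> b2" by linarith
  have pyth: "n2 = a2 + b2"
  proof -
    have "I (\<lambda>x. f x * g (fst x)) = a2"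
      unfolding I_cond_mean2[OF f g] a2_def by (simp add: g_def power2_eq_square)
    moreover have "(f x)\<^sup>2 = (f x - g (fst x))\<^sup>2 + (2 * (f x * g (fst x)) + (- 1) * (g (fst x))\<^sup>2)" for x
      by (simp add: power2_eq_square algebra_simps)
    then have "n2 = I (\<lambda>x. (f x - g (fst x))\<^sup>2 + (2 * (f x * g (fst x)) + (- 1) * (g (fst x))\<^sup>2))"
      unfolding n2_def by simp
    then have "n2 = b2 + I (\<lambda>x. 2 * (f x * g (fst x)) + (- 1) * (g (fst x))\<^sup>2)"
      unfolding b2_def by (subst (asm) I_add) (intro bounded_borel_intros bounded_borel_add bounded_borel_mult f g; simp)+
    moreover have "I (\<lambda>x. 2 * (f x * g (fst x)) + (- 1) * (g (fst x))\<^sup>2) = I (\<lambda>x. 2 * (f x * g (fst x))) + I (\<lambda>x. (- 1) * (g (fst x))\<^sup>2)"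
      by (intro I_add bounded_borel_intros bounded_borel_mult f g)
    ultimately show ?thesis unfolding I_cmult by (simp add: a2_def)
  qed
  have "I (\<lambda>x. g (fst x)) = I f"
    using I_cond_mean2[OF f bounded_borel_const[of 1]] by (simp add: g_def)
  then have "I (\<lambda>x. g (fst x)) = 0" using mean by simp
  then have A: "a2 \<le> 213000000 * L / m * I (\<lambda>x. (g (fst x) - c (snd x))\<^sup>2)"
    unfolding a2_def by (intro marginal_gap g c)
  have X: "I (\<lambda>x. (g (fst x) - c (snd x))\<^sup>2) \<le> 2 * b2 + 2 * u2"
  proof -
    have "I (\<lambda>x. (g (fst x) - c (snd x))\<^sup>2) \<le> I (\<lambda>x. 2 * (F x - g (fst x))\<^sup>2 + 2 * (F x - c (snd x))\<^sup>2)"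
    proof (rule I_mono)
      show "(g (fst x) - c (snd x))\<^sup>2 \<le> 2 * (F x - g (fst x))\<^sup>2 + 2 * (F x - c (snd x))\<^sup>2" for x
        using zero_le_power2[of "(F x - g (fst x)) + (F x - c (snd x))"] by (simp add: power2_eq_square algebra_simps)
    qed (intro bounded_borel_intros bounded_borel_add bounded_borel_mult F g c)+
    also have "\<dots> = I (\<lambda>x. 2 * (F x - g (fst x))\<^sup>2) + I (\<lambda>x. 2 * (F x - c (snd x))\<^sup>2)"
      by (intro I_add bounded_borel_intros bounded_borel_mult F g c)
    also have "\<dots> \<le> 2 * b2 + 2 * u2" unfolding I_cmult u2_def using 3 by simp
    finally show ?thesis .
  qed
  have "0 \<le> 213000000 * L / m" using L0 m by simp
  from order_trans[OF A mult_left_mono[OF X this]] have a2: "a2 \<le> 213000000 * L / m * (2 * b2 + 2 * u2)" .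
  \<comment> \<open>The term b2 in n2 = a2 + b2 is absorbed into the same constant; together with
    the factor 2 from the triangle inequality this produces the 3 in \<open>rate\<close>.\<close>
  have K1: "1 \<le> 213000000 * L / m" using m mL by (simp add: field_simps)
  have "n2 \<le> 213000000 * L / m * (2 * b2 + 2 * u2) + 213000000 * L / m * (b2 + u2)"
  proof -
    have "1 * (b2 + u2) \<le> 213000000 * L / m * (b2 + u2)" using nonneg by (intro mult_right_mono K1) simp
    from add_mono[OF a2 this] have "a2 + 1 * (b2 + u2) \<le> 213000000 * L / m * (2 * b2 + 2 * u2) + 213000000 * L / m * (b2 + u2)" .
    moreover have "n2 \<le> a2 + 1 * (b2 + u2)" using nonneg unfolding pyth by simp
    ultimately show ?thesis by (rule order_trans[rotated])
  qed
  also have "\<dots> = 639000000 * L / m * (b2 + u2)" using m by (simp add: field_simps)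
  finally have "m / (639000000 * L) * n2 \<le> m / (639000000 * L) * (639000000 * L / m * (b2 + u2))"
    using m L0 by (intro mult_left_mono) auto
  also have "\<dots> = b2 + u2" using m L0 by simp
  finally have "\<kappa> * (m / (639000000 * L) * n2) \<le> \<kappa> * (b2 + u2)" using k0 by (intro mult_left_mono) auto
  also have "\<kappa> * (m / (639000000 * L) * n2) = rate * n2" by (simp add: rate_def)
  also have "\<kappa> * (b2 + u2) = \<kappa> * b2 + \<kappa> * u2" by (rule distrib_left)
  finally have "rate * n2 \<le> \<kappa> * b2 + \<kappa> * u2" .
  then show ?thesis using 1 2 unfolding F_def n2_def by (simp add: left_diff_distrib)
qed

section \<open>The scan kernel as a composition of operators\<close>

abbreviation "T \<equiv> scan_kernel K1 K2"

lemma measurable_return_Pair: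
  "(\<lambda>q :: real \<times> real. return borel (fst q, snd q)) \<in> borel \<Otimes>\<^sub>M borel \<rightarrow>\<^sub>M subprob_algebra (borel :: (real \<times> real) measure)"
  by (rule measurable_compose[OF _ return_measurable]) (simp add: borel_prod)

lemma second_step_measurable:
  "(\<lambda>y. K2 y z \<bind> (\<lambda>t. return borel (y, t))) \<in> borel \<rightarrow>\<^sub>M subprob_algebra (borel :: (real \<times> real) measure)"
proof (rule measurable_bind[where N=borel])
  show "(\<lambda>y. K2 y z) \<in> borel \<rightarrow>\<^sub>M subprob_algebra borel"
    using measurable_compose[OF measurable_Pair[OF measurable_ident_sets measurable_const] K_measurable(2), of borel z]
    by simp
  show "(\<lambda>x :: real \<times> real. return borel (fst x, snd x)) \<in> borel \<Otimes>\<^sub>M borel \<rightarrow>\<^sub>M subprob_algebra (borel :: (real \<times> real) measure)"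
    by (rule measurable_return_Pair)
qed

lemma sets_T: "sets (T x) = sets (borel :: (real \<times> real) measure)"
  and finite_measure_T: "finite_measure (T x)"
proof -
  obtain a b where x: "x = (a, b)" by force
  have K1: "K1 b a \<in> space (subprob_algebra borel)"
    using K_prob(1)[of b a] by (simp add: space_subprob_algebra prob_space_imp_subprob_space)
  have step: "(\<lambda>y. K2 y b \<bind> (\<lambda>t. return borel (y, t))) \<in> K1 b a \<rightarrow>\<^sub>M subprob_algebra (borel :: (real \<times> real) measure)"
    using second_step_measurable[of b] by (simp add: measurable_cong_sets[OF sets_K(1) refl])
  have "space (K1 b a) \<noteq> {}" using sets_eq_imp_space_eq[OF sets_K(1)[of b a]] by simp
  then show "sets (T x) = sets (borel :: (real \<times> real) measure)"
    unfolding x scan_kernel_def using sets_bind[OF sets_kernel[OF step]] by simp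
  have "subprob_space (K1 b a \<bind> (\<lambda>y. K2 y b \<bind> (\<lambda>t. return borel (y, t))))"
    by (rule subprob_space_bind[OF prob_space_imp_subprob_space[OF K_prob(1)] step])
  then show "finite_measure (T x)"
    unfolding x scan_kernel_def by (simp add: subprob_space.axioms)
qed

text \<open>The second coordinate is resampled given the new first one. For a fixed outcome
  \<open>y\<close> of the first step the inner average is thus \<open>avg2 f (y, b)\<close>, started
  from the old second coordinate \<open>b\<close>.\<close>

lemma kernel_op_T:
  assumes f: "bounded_borel f"
  shows "kernel_op T f = avg1 (avg2 f)"
proof
  fix x :: "real \<times> real"
  obtain a b where x: "x = (a, b)" by force
  obtain C where C: "\<And>x. \<bar>f x\<bar> \<le> C" using bounded_borelE[OF f] by metis
  have fm: "f \<in> borel_measurable borel" by (rule bounded_borel_measurable[OF f])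
  let ?N = "\<lambda>y. K2 y b \<bind> (\<lambda>t. return borel (y, t))"
  have step: "(\<lambda>y. ?N y) \<in> K1 b a \<rightarrow>\<^sub>M subprob_algebra (borel :: (real \<times> real) measure)"
    using second_step_measurable[of b] by (simp add: measurable_cong_sets[OF sets_K(1) refl])
  have inner: "(\<integral>v. f v \<partial>?N y) = avg2 f (y, b)" for y
  proof -
    have pm: "Pair y \<in> K2 y b \<rightarrow>\<^sub>M (borel :: (real \<times> real) measure)"
      unfolding measurable_cong_sets[OF sets_K(2) refl] by (simp add: borel_prod[symmetric])
    have "space (K2 y b) \<noteq> {}" using sets_eq_imp_space_eq[OF sets_K(2)[of y b]] by simp
    then have "?N y = distr (K2 y b) borel (Pair y)"
      using bind_return_distr'[OF _ pm] by simp
    then show ?thesis using integral_distr[OF pm fm] by (simp add: avg2_def)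
  qed
  have "kernel_op T f x = (\<integral>v. f v \<partial>(K1 b a \<bind> (\<lambda>y. ?N y)))"
    by (simp add: kernel_op_def scan_kernel_def x)
  also have "\<dots> = (\<integral>y. (\<integral>v. f v \<partial>?N y) \<partial>K1 b a)"
  proof (rule integral_bind[OF fm _ step])
    show "\<bar>f v\<bar> \<le> C" for v by (rule C)
    show "finite_measure (K1 b a)" using K_prob(1) by (rule prob_space.finite_measure)
    show "AE y in K1 b a. emeasure (?N y) (space (?N y)) \<le> ennreal 1"
    proof (rule AE_I2)
      fix y assume "y \<in> space (K1 b a)"
      then have "subprob_space (?N y)"
        using subprob_space_kernel[OF step] by simp
      then show "emeasure (?N y) (space (?N y)) \<le> ennreal 1"
        using subprob_space.subprob_emeasure_le_1 by simp
    qed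
  qed
  also have "\<dots> = avg1 (avg2 f) x" by (simp add: inner avg1_def x)
  finally show "kernel_op T f x = avg1 (avg2 f) x" .
qed

section \<open>The target measure and the passage to square-integrable functions\<close>

definition \<phi> :: "(real \<times> real) measure" where
  "\<phi> = density lborel (\<lambda>x. ennreal (p x))"

lemma p_borel: "p \<in> borel_measurable borel"
  using p_measurable by (simp add: borel_prod)

lemma sets_\<phi> [simp, measurable_cong]: "sets \<phi> = sets borel"
  by (simp add: \<phi>_def)

lemma prob_space_\<phi>: "prob_space \<phi>"
proof (rule prob_spaceI)
  show "emeasure \<phi> (space \<phi>) = 1"
  proof -
    have "emeasure \<phi> (space \<phi>) = (\<integral>\<^sup>+x. ennreal (p x) \<partial>lborel)"
      unfolding \<phi>_def using p_borel by (subst emeasure_density) auto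
    then show ?thesis using mass by (simp add: p_def)
  qed
qed

lemma integral_\<phi>:
  assumes "h \<in> borel_measurable borel"
  shows "(\<integral>x. h x \<partial>\<phi>) = I h"
  unfolding \<phi>_def I_def lborel_prod using assms p_borel p_pos
  by (subst integral_density) (auto simp: less_imp_le)

lemma nn_integral_scan_le:
  assumes f: "bounded_borel f" and mean: "I f = 0"
  shows "(\<integral>\<^sup>+x. ennreal ((kernel_op T f x)\<^sup>2) \<partial>\<phi>) \<le> ennreal ((1 - rate) * I (\<lambda>x. (f x)\<^sup>2))"
proof -
  interpret prob_space \<phi> by (rule prob_space_\<phi>)
  have b: "bounded_borel (\<lambda>x. (avg1 (avg2 f) x)\<^sup>2)"
    by (intro bounded_borel_intros bounded_borel_avg1 f)
  then obtain C where C: "\<And>x. \<bar>(avg1 (avg2 f) x)\<^sup>2\<bar> \<le> C" using bounded_borelE by metis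
  have bm: "(\<lambda>x. (avg1 (avg2 f) x)\<^sup>2) \<in> borel_measurable borel" using b by (rule bounded_borel_measurable)
  have "integrable \<phi> (\<lambda>x. (avg1 (avg2 f) x)\<^sup>2)"
    using C bm by (intro integrable_const_bound[where B=C]) auto
  then have "(\<integral>\<^sup>+x. ennreal ((kernel_op T f x)\<^sup>2) \<partial>\<phi>) = ennreal (\<integral>x. (avg1 (avg2 f) x)\<^sup>2 \<partial>\<phi>)"
    unfolding kernel_op_T[OF f] by (intro nn_integral_eq_integral) auto
  also have "\<dots> = ennreal (I (\<lambda>x. (avg1 (avg2 f) x)\<^sup>2))" by (simp add: integral_\<phi>[OF bm])
  also have "\<dots> \<le> ennreal ((1 - rate) * I (\<lambda>x. (f x)\<^sup>2))"
    by (intro ennreal_leI scan_contraction f mean)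
  finally show ?thesis .
qed

lemma rate_bounds: "0 \<le> rate" "rate \<le> 1"
proof -
  have J1: "1 \<le> real J" using J_pos by simp
  show "0 \<le> rate" unfolding rate_def using m mL by simp
  have "rate = (1 / (110000000 * real J)) * (m / L) * (1 / 639000000)" by (simp add: rate_def)
  also have "\<dots> \<le> 1 * 1 * 1"
    using m mL J1 by (intro mult_mono) (auto simp: divide_le_eq)
  finally show "rate \<le> 1" by simp
qed

text \<open>Square-integrable functions are approximated by recentred truncations, to which the bounded
  case applies; Fatou's lemma passes to the limit.\<close>

lemma nn_integral_scan_le_L2:
  assumes f: "f \<in> L20 \<phi>" and n: "(\<integral>x. (f x)\<^sup>2 \<partial>\<phi>) \<le> 1"
  shows "(\<integral>\<^sup>+x. ennreal ((kernel_op T f x)\<^sup>2) \<partial>\<phi>) \<le> ennreal (1 - rate)"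
proof -
  interpret prob_space \<phi> by (rule prob_space_\<phi>)
  have fm: "f \<in> borel_measurable borel" and f2: "integrable \<phi> (\<lambda>x. (f x)\<^sup>2)" and f0: "(\<integral>x. f x \<partial>\<phi>) = 0"
    using f by (auto simp: L20_def)
  note [measurable] = fm
  have f1: "integrable \<phi> f" by (rule square_integrable_imp_integrable[OF _ f2]) measurable
  define t where "t n x = max (- real n) (min (real n) (f x))" for n x
  define c where "c n = (\<integral>x. t n x \<partial>\<phi>)" for n
  define g where "g n x = t n x - c n" for n x
  have tm [measurable]: "t n \<in> borel_measurable borel" for n unfolding t_def by measurable
  have tb: "bounded_borel (t n)" for n
    by (rule bounded_borelI[where C="real n"]) (auto simp: t_def)
  have gb: "bounded_borel (g n)" for n unfolding g_def by (intro bounded_borel_diff tb bounded_borel_const)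
  have gm: "g n \<in> borel_measurable borel" for n by (rule bounded_borel_measurable[OF gb])
  have t_le: "\<bar>t n x\<bar> \<le> \<bar>f x\<bar>" for n x by (auto simp: t_def)
  have t_lim: "(\<lambda>n. t n x) \<longlonglongrightarrow> f x" for x
  proof (rule tendsto_eventually)
    show "\<forall>\<^sub>F n in sequentially. t n x = f x"
      using eventually_ge_at_top[of "nat \<lceil>\<bar>f x\<bar>\<rceil>"]
    proof eventually_elim
      case (elim n)
      then have "\<bar>f x\<bar> \<le> real n" by linarith
      then show ?case by (simp add: t_def)
    qed
  qed
  have ti: "integrable \<phi> (t n)" for n
    by (intro integrable_const_bound[where B="real n"]) (auto simp: t_def)
  have t2i: "integrable \<phi> (\<lambda>x. (t n x)\<^sup>2)" for n
    by (rule Bochner_Integration.integrable_bound[OF f2]) (use t_le[of n] in \<open>auto intro!: power_mono simp: abs_le_square_iff[symmetric]\<close>)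
  have "c \<longlonglongrightarrow> (\<integral>x. f x \<partial>\<phi>)" unfolding c_def
    by (rule integral_dominated_convergence[where w="\<lambda>x. \<bar>f x\<bar>"]) (use f1 t_lim t_le in auto)
  then have c_lim: "c \<longlonglongrightarrow> 0" unfolding f0 .
  then have "Bseq c" by (intro convergent_imp_Bseq) (auto simp: convergent_def)
  then obtain B where B: "\<And>n. \<bar>c n\<bar> \<le> B" by (auto simp: Bseq_def)
  have g_lim: "(\<lambda>n. g n x) \<longlonglongrightarrow> f x" for x
    unfolding g_def using tendsto_diff[OF t_lim c_lim] by simp
  have g_le: "\<bar>g n x\<bar> \<le> \<bar>f x\<bar> + B" for n x
    unfolding g_def using t_le[of n x] B[of n] by linarith
  have Ig: "I (g n) = 0" for n
    unfolding integral_\<phi>[OF gm, symmetric] g_def using ti[of n] by (simp add: c_def prob_space)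
  \<comment> \<open>Truncation lowers the second moment pointwise, and recentring at the mean lowers
    it again.\<close>
  have Ig2: "I (\<lambda>x. (g n x)\<^sup>2) \<le> 1" for n
  proof -
    have "I (\<lambda>x. (g n x)\<^sup>2) = (\<integral>x. (g n x)\<^sup>2 \<partial>\<phi>)"
      using gm[of n] by (intro integral_\<phi>[symmetric]) auto
    also have "\<dots> = (\<integral>x. (t n x)\<^sup>2 - (2 * c n) * t n x + (c n)\<^sup>2 \<partial>\<phi>)"
      unfolding g_def by (intro Bochner_Integration.integral_cong) (auto simp: power2_eq_square algebra_simps)
    also have "\<dots> = (\<integral>x. (t n x)\<^sup>2 \<partial>\<phi>) - (2 * c n) * c n + (c n)\<^sup>2"
      using ti[of n] t2i[of n] by (simp add: c_def prob_space)
    also have "\<dots> \<le> (\<integral>x. (t n x)\<^sup>2 \<partial>\<phi>)" by (simp add: power2_eq_square)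
    also have "\<dots> \<le> (\<integral>x. (f x)\<^sup>2 \<partial>\<phi>)"
      using t2i[of n] f2 t_le[of n] by (intro integral_mono) (auto simp: abs_le_square_iff[symmetric])
    finally show ?thesis using n by simp
  qed
  have lim: "ennreal ((kernel_op T f x)\<^sup>2) \<le> liminf (\<lambda>n. ennreal ((kernel_op T (g n) x)\<^sup>2))" for x
  proof (cases "integrable (T x) f")
    case True
    interpret Tx: finite_measure "T x" by (rule finite_measure_T)
    have mT: "h \<in> borel_measurable (T x)" if "h \<in> borel_measurable borel" for h :: "real \<times> real \<Rightarrow> real"
      using that unfolding measurable_cong_sets[OF sets_T refl] .
    have "(\<lambda>n. kernel_op T (g n) x) \<longlonglongrightarrow> kernel_op T f x"
      unfolding kernel_op_def
    proof (rule integral_dominated_convergence[where w="\<lambda>y. \<bar>f y\<bar> + B"])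
      show "integrable (T x) (\<lambda>y. \<bar>f y\<bar> + B)" using True by auto
    qed (use mT[OF fm] mT[OF gm] g_lim g_le in auto)
    then have "(\<lambda>n. ennreal ((kernel_op T (g n) x)\<^sup>2)) \<longlonglongrightarrow> ennreal ((kernel_op T f x)\<^sup>2)"
      by (intro tendsto_intros)
    then have "liminf (\<lambda>n. ennreal ((kernel_op T (g n) x)\<^sup>2)) = ennreal ((kernel_op T f x)\<^sup>2)"
      by (rule lim_imp_Liminf[rotated]) simp
    then show ?thesis by simp
  next
    \<comment> \<open>If \<open>f\<close> is not integrable under T(x), the integral defining the
      operator is 0 by default and the bound is trivial.\<close>
    case False
    then show ?thesis by (simp add: kernel_op_def not_integrable_integral_eq)
  qed
  have Tg: "(\<lambda>x. ennreal ((kernel_op T (g n) x)\<^sup>2)) \<in> borel_measurable \<phi>" for n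
  proof -
    have "avg1 (avg2 (g n)) \<in> borel_measurable borel"
      by (intro bounded_borel_measurable bounded_borel_avg1 bounded_borel_avg2 gb)
    then show ?thesis unfolding kernel_op_T[OF gb] by measurable
  qed
  have "(\<integral>\<^sup>+x. ennreal ((kernel_op T f x)\<^sup>2) \<partial>\<phi>) \<le> (\<integral>\<^sup>+x. liminf (\<lambda>n. ennreal ((kernel_op T (g n) x)\<^sup>2)) \<partial>\<phi>)"
    by (intro nn_integral_mono lim)
  also have "\<dots> \<le> liminf (\<lambda>n. \<integral>\<^sup>+x. ennreal ((kernel_op T (g n) x)\<^sup>2) \<partial>\<phi>)"
    by (rule nn_integral_liminf) (rule Tg)
  also have "\<dots> \<le> liminf (\<lambda>n. ennreal (1 - rate))"
  proof (intro Liminf_mono always_eventually allI)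
    fix n
    have "(\<integral>\<^sup>+x. ennreal ((kernel_op T (g n) x)\<^sup>2) \<partial>\<phi>) \<le> ennreal ((1 - rate) * I (\<lambda>x. (g n x)\<^sup>2))"
      by (rule nn_integral_scan_le[OF gb Ig])
    also have "\<dots> \<le> ennreal ((1 - rate) * 1)"
      using Ig2 rate_bounds by (intro ennreal_leI mult_left_mono) auto
    finally show "(\<integral>\<^sup>+x. ennreal ((kernel_op T (g n) x)\<^sup>2) \<partial>\<phi>) \<le> ennreal (1 - rate)" by simp
  qed
  also have "\<dots> = ennreal (1 - rate)" by (simp add: Liminf_const)
  finally show ?thesis .
qed

theorem kernel_opnorm_T: "(kernel_opnorm \<phi> T)\<^sup>2 \<le> 1 - rate"
proof -
  let ?S = "{L2norm \<phi> (kernel_op T f) | f. f \<in> L20 \<phi> \<and> L2norm \<phi> f \<le> 1}"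
  have ub: "v \<le> sqrt (1 - rate)" if vS: "v \<in> ?S" for v
  proof -
    obtain f where v: "v = L2norm \<phi> (kernel_op T f)" and f: "f \<in> L20 \<phi>" "L2norm \<phi> f \<le> 1" using vS by blast
    have "(\<integral>x. (f x)\<^sup>2 \<partial>\<phi>) \<le> 1" using f(2) by (simp add: L2norm_def)
    from nn_integral_scan_le_L2[OF f(1) this]
    have le: "(\<integral>\<^sup>+x. ennreal ((kernel_op T f x)\<^sup>2) \<partial>\<phi>) \<le> ennreal (1 - rate)" .
    have "(\<integral>x. (kernel_op T f x)\<^sup>2 \<partial>\<phi>) \<le> 1 - rate"
    proof (cases "integrable \<phi> (\<lambda>x. (kernel_op T f x)\<^sup>2)")
      case True
      then show ?thesis using le rate_bounds
        by (subst (asm) nn_integral_eq_integral) auto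
    qed (use rate_bounds in \<open>simp add: not_integrable_integral_eq\<close>)
    then show ?thesis by (simp add: v L2norm_def)
  qed
  \<comment> \<open>The zero function makes the set nonempty and its supremum nonnegative; the
    latter justifies squaring the upper bound.\<close>
  have "(\<lambda>x. 0) \<in> L20 \<phi>" by (simp add: L20_def)
  then have zero: "0 \<in> ?S"
    by (intro CollectI exI[of _ "\<lambda>x. 0"]) (simp add: L2norm_def kernel_op_def)
  have "0 \<le> kernel_opnorm \<phi> T"
    unfolding kernel_opnorm_def using zero ub by (intro cSup_upper bdd_aboveI) auto
  moreover have "kernel_opnorm \<phi> T \<le> sqrt (1 - rate)"
    unfolding kernel_opnorm_def using zero ub by (intro cSup_least) auto
  ultimately have "(kernel_opnorm \<phi> T)\<^sup>2 \<le> (sqrt (1 - rate))\<^sup>2" by (intro power_mono)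
  then show ?thesis using rate_bounds by simp
qed

end

text \<open>The infimum is at most its value at c = 1, where crude estimates give b <= 1/16; half of
  (1 / (256 * 96))^2 is below 10^-9. Nonnegativity permits squaring.\<close>

lemma C_star_bounds: "0 \<le> C_star" "C_star \<le> 1 / 10 ^ 9"
proof -
  let ?f = "\<lambda>c. (min (b_const c / 8) ((b_const c)\<^sup>2 * sqrt c / (96 * sqrt 3)))\<^sup>2"
  have bdd: "bdd_below (?f ` {1..2})" by (intro bdd_belowI2[where m=0]) auto
  show "0 \<le> C_star" unfolding C_star_def by (intro mult_nonneg_nonneg cINF_greatest) auto
  have b0: "0 \<le> b_const 1" by (simp add: b_const_def)
  have b: "b_const 1 \<le> 1 / 16"
  proof -
    have e1: "exp (- 2.6 :: real) \<le> 1 / (1 + 2.6)" using exp_minus_le_inverse[of "2.6"] by simp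
    have e2: "exp (- (1.5\<^sup>2 / (2 * 1)) :: real) \<le> 1 / (1 + 1.5\<^sup>2 / (2 * 1))"
      using exp_minus_le_inverse[of "1.5\<^sup>2 / (2 * 1)"] by simp
    have "sqrt 4 \<le> sqrt (2 * pi * 1)" using pi_gt3 by (intro real_sqrt_le_mono) simp
    then have s: "1 / sqrt (2 * pi * 1) \<le> 1 / 2" by (simp add: field_simps)
    have "b_const 1 \<le> 1/2 * (1 / (1 + 2.6)) * (1 / 2) * (1 / (1 + 1.5\<^sup>2 / (2 * 1)))"
      unfolding b_const_def using e1 e2 s by (intro mult_mono) auto
    also have "\<dots> \<le> 1 / 16" by (simp add: power2_eq_square)
    finally show ?thesis .
  qed
  have "(INF c\<in>{1..2}. ?f c) \<le> ?f 1" by (rule cINF_lower[OF bdd]) simp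
  also have "\<dots> \<le> ((1 / 16)\<^sup>2 / 96)\<^sup>2"
  proof (rule power_mono)
    have "(b_const 1)\<^sup>2 * sqrt 1 / (96 * sqrt 3) \<le> (1 / 16)\<^sup>2 * 1 / (96 * 1)"
      using b b0 by (intro frac_le mult_mono power_mono) auto
    then show "min (b_const 1 / 8) ((b_const 1)\<^sup>2 * sqrt 1 / (96 * sqrt 3)) \<le> (1 / 16)\<^sup>2 / 96" by simp
    show "0 \<le> min (b_const 1 / 8) ((b_const 1)\<^sup>2 * sqrt 1 / (96 * sqrt 3))" using b0 by simp
  qed
  finally show "C_star \<le> 1 / 10 ^ 9" unfolding C_star_def by (simp add: power2_eq_square)
qed

theorem proposition28:
  fixes \<phi> :: "(real \<times> real) measure"
    and p :: "real \<times> real \<Rightarrow> real"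
    and grad :: "real \<times> real \<Rightarrow> real \<times> real"
    and hess :: "real \<times> real \<Rightarrow> real \<times> real \<Rightarrow> real \<times> real"
    and m L :: real
    and J :: nat
    and w \<sigma> :: "nat \<Rightarrow> real"
    and H1 H2 :: "real \<Rightarrow> real \<Rightarrow> real measure"
    and T :: "real \<times> real \<Rightarrow> (real \<times> real) measure"
  assumes "prob_space \<phi>"
    and "\<phi> = density lborel (\<lambda>x. ennreal (p x))"
    and "\<And>x. 0 < p x"
    and "\<And>x. GDERIV (\<lambda>y. - ln (p y)) x :> grad x"
    and "\<And>x. (grad has_derivative hess x) (at x)"
    and "0 < m" and "m \<le> L"
    and "\<And>x l. eigenvalue_of (hess x) l \<Longrightarrow> m \<le> l \<and> l \<le> L"
    and "J = 1 + nat \<lceil>log 2 (L / m)\<rceil>"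
    and "\<And>j. j \<in> {1..J} \<Longrightarrow> w j = 1 / real J"
    and "\<And>j. j \<in> {1..J} \<Longrightarrow> 0 < \<sigma> j \<and> (\<sigma> j)\<^sup>2 = 2 ^ (j - 1) / L"
    and "H1 = (\<lambda>x2. multiscale_rwm_kernel J w \<sigma> (cond_density1 p x2))"
    and "H2 = (\<lambda>x1. multiscale_rwm_kernel J w \<sigma> (cond_density2 p x1))"
    and "T = scan_kernel H1 H2"
  shows "1 - (kernel_opnorm \<phi> T)\<^sup>2
           \<ge> (C_star / (1 + real_of_int \<lceil>log 2 (L / m)\<rceil>))\<^sup>2 * (m / L)"
proof -
  define U where "U x = - ln (p x)" for x
  have U: "GDERIV U x :> grad x" for x using assms(4) unfolding U_def[abs_def] .
  have expU: "exp (- U x) = p x" for x using assms(3)[of x] by (simp add: U_def)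
  have bounds: "m * (norm v)\<^sup>2 \<le> inner (hess x v) v" "inner (hess x v) v \<le> L * (norm v)\<^sup>2" for x v
    using quadratic_form_bounds[OF has_derivative_linear[OF assms(5)] second_derivative_symmetric[OF U assms(5)], of x m L v]
      assms(8)[of x] by blast+
  have sc: "strongly_convex m U" and sm: "midpoint_smooth L U"
    by (rule hessian_bounds_imp_convexity[OF U assms(5) bounds])+
  \<comment> \<open>Measurability of the density comes from continuity of the convex potential; it
    is required to turn the mass of \<phi> into an integral.\<close>
  have "U \<in> borel_measurable borel"
    using strongly_convex_continuous[OF sc] assms(6) by (intro borel_measurable_continuous_onI) auto
  then have "(\<lambda>x. exp (- U x)) \<in> borel_measurable borel" by measurable
  then have pm: "p \<in> borel_measurable borel" unfolding expU .
  have "emeasure \<phi> (space \<phi>) = (\<integral>\<^sup>+x. ennreal (p x) \<partial>lborel)"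
    unfolding assms(2) using pm by (subst emeasure_density) auto
  then have mass: "(\<integral>\<^sup>+x. ennreal (exp (- U x)) \<partial>lborel) = 1"
    unfolding expU using prob_space.emeasure_space_1[OF assms(1)] by simp
  interpret S: log_concave_scan U m L J w \<sigma>
    by unfold_locales (fact sc sm assms(6) assms(7) mass assms(9) assms(10) assms(11))+
  have p: "S.p = p" by (simp add: S.p_def[abs_def] expU)
  have \<phi>: "S.\<phi> = \<phi>" unfolding S.\<phi>_def p assms(2) ..
  have T: "scan_kernel S.K1 S.K2 = T"
    unfolding S.K1_def[abs_def] S.K2_def[abs_def] p assms(12-14) ..
  \<comment> \<open>The logarithm is nonnegative, so \<open>nat\<close> loses nothing and the
    denominator of the claim is J.\<close>
  have "1 \<le> L / m" using assms(6,7) by simp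
  then have "0 \<le> log 2 (L / m)" by simp
  then have J: "1 + real_of_int \<lceil>log 2 (L / m)\<rceil> = real J" unfolding assms(9) by simp
  have J1: "1 \<le> real J" unfolding assms(9) by simp
  \<comment> \<open>The claim needs at most 10^-18 / J^2, while \<open>rate\<close> provides more
    than 10^-17 / J, both times m / L; one factor 1 / J is given away.\<close>
  have "(C_star / real J)\<^sup>2 * (m / L) \<le> S.rate"
  proof -
    have "C_star\<^sup>2 \<le> (1 / 10 ^ 9)\<^sup>2" using C_star_bounds by (intro power_mono)
    then have "C_star\<^sup>2 / (real J)\<^sup>2 \<le> (1 / 10 ^ 9)\<^sup>2 / (real J)\<^sup>2" by (rule divide_right_mono) simp
    also have "\<dots> \<le> (1 / 10 ^ 9)\<^sup>2 / real J"
      using J1 by (intro divide_left_mono) (auto simp: power2_eq_square)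
    also have "\<dots> \<le> 1 / (110000000 * real J) * (1 / 639000000)" using J1 by (simp add: field_simps)
    finally have "(C_star / real J)\<^sup>2 * (m / L) \<le> 1 / (110000000 * real J) * (1 / 639000000) * (m / L)"
      using assms(6,7) unfolding power_divide by (intro mult_right_mono) auto
    then show ?thesis by (simp add: S.rate_def)
  qed
  then show ?thesis using S.kernel_opnorm_T unfolding J \<phi> T by linarith
qed

end
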